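(* Let $r\in C([0,\infty))$ be a non-negative function such that $r(x)>0$ for $x>0$, and let $$K(x,y)=r(x)r(y),\qquad (x,y)\in(0,\infty)\times(0,\infty).$$ Let $f^{in}\in L^1_1(0,\infty)$ with $f^{in}\ge 0$ a.e. in $(0,\infty)$. Then there is a non-negative function $$f\in C([0,\infty);L^1(0,\infty))\cap L^\infty(0,\infty;L^1_1(0,\infty))$$ such that $$\int_0^\infty \vartheta(x)\left(f(t,x)-f^{in}(x)\right)dx=\frac12\int_0^t\int_0^\infty\int_0^\infty \tilde\vartheta(x,y)K(x,y)f(s,x)f(s,y)\,dy\,dx\,ds$$ for all $t>0$ and all $\vartheta\in L^\infty(0,\infty)$, and $$M_0(f(t))\le M_0(f^{in})\quad\text{and}\quad M_1(f(t))\le M_1(f^{in}),\qquad t\ge 0 .$$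
   Context: For $\mu\in\mathbb{R}$, $L^1_\mu(0,\infty):=\{g\in L^1(0,\infty): \|g\|_{1,\mu}:=\int_0^\infty(1+x^\mu)|g(x)|\,dx<\infty\}$ and $M_\mu(g):=\int_0^\infty x^\mu g(x)\,dx$ for $g\in L^1_\mu(0,\infty)$. For $\vartheta\in L^\infty(0,\infty)$, $\tilde\vartheta(x,y):=\vartheta(x+y)-\vartheta(x)-\vartheta(y)$. (The displayed identity is the weak formulation of Smoluchowski's coagulation equation $\partial_t f(t,x)=\frac12\int_0^x K(y,x-y)f(t,y)f(t,x-y)\,dy-\int_0^\infty K(x,y)f(t,x)f(t,y)\,dy$ with $f(0)=f^{in}$.) *)

theory Defs
  imports "HOL-Analysis.Analysis"
begin

text \<open>
  Elements of the function spaces are represented by functions on \<^typ>\<open>real\<close> of which only the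
  values on \<open>(0,\<infinity>)\<close> matter, with Lebesgue measure throughout. They are not quotiented by
  almost-everywhere equality.
\<close>

definition L1 :: "(real \<Rightarrow> real) set" where
  "L1 = {g. g absolutely_integrable_on {0<..}}"

definition L1_weighted :: "real \<Rightarrow> (real \<Rightarrow> real) set" where
  "L1_weighted \<mu> =
     {g \<in> L1. (\<lambda>x. (1 + x powr \<mu>) * \<bar>g x\<bar>) absolutely_integrable_on {0<..}}"

definition norm_L1 :: "(real \<Rightarrow> real) \<Rightarrow> real" where
  "norm_L1 g = (LINT x:{0<..}|lebesgue. \<bar>g x\<bar>)"

definition norm_L1_weighted :: "real \<Rightarrow> (real \<Rightarrow> real) \<Rightarrow> real" where
  "norm_L1_weighted \<mu> g = (LINT x:{0<..}|lebesgue. (1 + x powr \<mu>) * \<bar>g x\<bar>)"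

text \<open>Meaningful only for \<open>g \<in> L1_weighted \<mu>\<close>; the Bochner integral of a non-integrable
  function is 0.\<close>

definition moment :: "real \<Rightarrow> (real \<Rightarrow> real) \<Rightarrow> real" where
  "moment \<mu> g = (LINT x:{0<..}|lebesgue. x powr \<mu> * g x)"

definition Linf :: "(real \<Rightarrow> real) set" where
  "Linf = {\<theta>. \<theta> \<in> borel_measurable (lebesgue_on {0<..}) \<and>
              (\<exists>C. AE x in lebesgue_on {0<..}. \<bar>\<theta> x\<bar> \<le> C)}"

definition tilde :: "(real \<Rightarrow> real) \<Rightarrow> real \<Rightarrow> real \<Rightarrow> real" where
  "tilde \<theta> x y = \<theta> (x + y) - \<theta> x - \<theta> y"

text \<open>\<open>C([0,\<infinity>); L\<^sup>1(0,\<infinity>))\<close>, continuity being with respect to the \<open>L\<^sup>1\<close>-norm.\<close>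

definition C_L1 :: "(real \<Rightarrow> real \<Rightarrow> real) set" where
  "C_L1 = {f. (\<forall>t\<ge>0. f t \<in> L1) \<and>
     (\<forall>t\<ge>0. ((\<lambda>s. norm_L1 (\<lambda>x. f s x - f t x)) \<longlongrightarrow> 0) (at t within {0..}))}"

text \<open>\<open>L\<^sup>\<infinity>(0,\<infinity>; L\<^sup>1\<^sub>\<mu>(0,\<infinity>))\<close> in the sense of Bochner: \<open>f\<close> is essentially bounded and
  strongly measurable, that is, almost everywhere the limit in the norm of \<open>L\<^sup>1\<^sub>\<mu>\<close> of simple
  functions of \<open>t\<close> with values in \<open>L\<^sup>1\<^sub>\<mu>\<close>.\<close>

definition Linf_L1_weighted :: "real \<Rightarrow> (real \<Rightarrow> real \<Rightarrow> real) set" where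
  "Linf_L1_weighted \<mu> = {f.
     (\<exists>\<phi> :: nat \<Rightarrow> real \<Rightarrow> real \<Rightarrow> real.
        (\<forall>n. simple_function (lebesgue_on {0<..}) (\<phi> n) \<and> (\<forall>t>0. \<phi> n t \<in> L1_weighted \<mu>)) \<and>
        (AE t in lebesgue_on {0<..}.
           (\<lambda>n. norm_L1_weighted \<mu> (\<lambda>x. \<phi> n t x - f t x)) \<longlonglongrightarrow> 0)) \<and>
     (\<exists>C. AE t in lebesgue_on {0<..}. f t \<in> L1_weighted \<mu> \<and> norm_L1_weighted \<mu> (f t) \<le> C)}"

text \<open>
  The iterated integral over \<open>(0,t) \<times> (0,\<infinity>) \<times> (0,\<infinity>)\<close> on the right-hand side of the weak
  formulation is well defined: the integrand is Lebesgue integrable in \<open>(x,y)\<close> for almost every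
  \<open>s\<close>, and the resulting function of \<open>s\<close> is integrable. For \<open>\<theta> = 1\<close>, \<open>tilde \<theta> = -1\<close>, so that if
  this holds for all \<open>\<theta> \<in> Linf\<close> with \<open>K\<close> and \<open>f\<close> non-negative, the integral converges absolutely.
\<close>

definition coag_integrable ::
  "(real \<Rightarrow> real \<Rightarrow> real) \<Rightarrow> (real \<Rightarrow> real \<Rightarrow> real) \<Rightarrow> (real \<Rightarrow> real) \<Rightarrow> real \<Rightarrow> bool" where
  "coag_integrable K f \<theta> t \<longleftrightarrow>
     (AE s\<in>{0<..<t} in lebesgue.
        (\<lambda>(x, y). tilde \<theta> x y * K x y * f s x * f s y) absolutely_integrable_on ({0<..} \<times> {0<..})) \<and>
     (\<lambda>s. LINT x:{0<..}|lebesgue. LINT y:{0<..}|lebesgue. tilde \<theta> x y * K x y * f s x * f s y)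
        absolutely_integrable_on {0<..<t}"

end

theory Submission
  imports Defs "HOL-Complex_Analysis.Great_Picard"
begin

text \<open>
  The proof solves approximate problems by an explicit Euler scheme and passes to the limit strongly in
  \<open>L\<^sup>1\<close>; the only compactness used concerns real-valued functions of time.

  Fix \<open>n\<close>, let only particles of size at most \<open>n\<close> react, and step forward by a small time \<open>h\<close>. Writing
  \<open>R\<close> for the integral of \<open>r f\<close> and \<open>S(a)\<close> for its part over sizes greater than \<open>a\<close>, a step satisfies
  the weak formulation exactly. The test function \<open>1\<close> gives \<open>h \<Sum> R\<^sup>2 \<le> 2 M\<^sub>0\<close>. The test function
  \<open>min x a\<close> is subadditive, and each collision of two particles larger than \<open>a\<close> lowers it by \<open>a\<close>;
  hence \<open>h \<Sum> S(a)\<^sup>2 \<le> 2 M\<^sub>1 / a\<close> (\<open>coag_step_mass\<close>, \<open>coag_step_cut\<close>). The second bound makes large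
  particles negligible in the collision term however fast \<open>r\<close> grows.

  Because the kernel is a product, sizes up to \<open>X\<close> interact with larger ones only through the scalar
  \<open>R\<close>. The accumulated rate \<open>A\<close>, the time integral of \<open>R\<close>, is Hoelder continuous of exponent \<open>1/2\<close>
  uniformly in \<open>n\<close>, up to the step size, by the first bound, so a subsequence converges locally
  uniformly. The factor \<open>exp (r A)\<close> removes the loss term, and what remains on sizes up to \<open>X\<close> is a
  quadratic equation with locally Lipschitz right-hand side; Gronwall's inequality then bounds the
  distance of two approximations by the distance of their functions \<open>A\<close> and the step sizes (\<open>F_Cauchy\<close>).
  With the bound on the first moment, the approximations are Cauchy in \<open>L\<^sup>1\<close>, uniformly on bounded time
  intervals.

  In the weak formulation, cutting the collision term off at size \<open>X\<close> costs a multiple of \<open>X\<^sup>-\<^sup>1\<^sup>/\<^sup>2\<close>,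
  uniformly in \<open>n\<close>, and the remaining term converges (\<open>f_weak_formulation\<close>). Tested with the sign of
  \<open>f t - f s\<close>, the limit equation bounds \<open>\<parallel>f t - f s\<parallel>\<^sub>1\<close> by \<open>3/2\<close> times the integral of \<open>R\<^sup>2\<close> over \<open>[s,t]\<close>, which
  is continuity in time. The approximations are step functions of time, so they also show that \<open>f\<close> is
  strongly measurable with values in the weighted space.
\<close>

section \<open>Bounded multipliers, pairings and convolutions\<close>

lemma integrable_bounded_mult:
  fixes u \<psi> :: "'a \<Rightarrow> real"
  assumes "integrable M u" "\<psi> \<in> borel_measurable M" "\<And>x. \<bar>\<psi> x\<bar> \<le> C"
  shows "integrable M (\<lambda>x. \<psi> x * u x)" and "\<bar>\<integral>x. \<psi> x * u x \<partial>M\<bar> \<le> C * (\<integral>x. \<bar>u x\<bar> \<partial>M)"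
proof -
  have [measurable]: "u \<in> borel_measurable M" "\<psi> \<in> borel_measurable M" using assms by auto
  have iC: "integrable M (\<lambda>x. C * \<bar>u x\<bar>)" using assms(1) by auto
  have le: "\<bar>\<psi> x * u x\<bar> \<le> C * \<bar>u x\<bar>" for x
    using assms(3)[of x] by (simp add: abs_mult mult_right_mono)
  show 1: "integrable M (\<lambda>x. \<psi> x * u x)"
    by (rule Bochner_Integration.integrable_bound[OF iC]) (auto intro!: AE_I2 order_trans[OF le])
  have "\<bar>\<integral>x. \<psi> x * u x \<partial>M\<bar> \<le> (\<integral>x. \<bar>\<psi> x * u x\<bar> \<partial>M)"
    by (rule integral_abs_bound)
  also have "\<dots> \<le> (\<integral>x. C * \<bar>u x\<bar> \<partial>M)"
    using 1 iC le by (intro integral_mono) auto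
  finally show "\<bar>\<integral>x. \<psi> x * u x \<partial>M\<bar> \<le> C * (\<integral>x. \<bar>u x\<bar> \<partial>M)" by simp
qed

text \<open>
  With \<open>\<phi> (x, y) = \<psi> (x + y)\<close> this is the gain term of the coagulation equation tested with \<open>\<psi>\<close>, with
  \<open>\<phi> (x, y) = \<psi> (x + y) - \<psi> x - \<psi> y\<close> the whole collision term; both occur below, hence the general kernel.
\<close>

definition pairing :: "(real \<times> real \<Rightarrow> real) \<Rightarrow> (real \<Rightarrow> real) \<Rightarrow> (real \<Rightarrow> real) \<Rightarrow> real" where
  "pairing \<phi> u v = (\<integral>z. \<phi> z * (u (fst z) * v (snd z)) \<partial>(lborel \<Otimes>\<^sub>M lborel))"

lemma integrable_tensor:
  fixes u v :: "real \<Rightarrow> real"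
  assumes u: "integrable lborel u" and v: "integrable lborel v"
  shows "integrable (lborel \<Otimes>\<^sub>M lborel) (\<lambda>z. u (fst z) * v (snd z))"
    and "(\<integral>z. u (fst z) * v (snd z) \<partial>(lborel \<Otimes>\<^sub>M lborel)) = (LBINT x. u x) * (LBINT x. v x)"
proof -
  have [measurable]: "u \<in> borel_measurable borel" "v \<in> borel_measurable borel" using assms by auto
  have "integrable (lborel \<Otimes>\<^sub>M lborel) (\<lambda>(x,y). u x * v y)"
    by (rule lborel_pair.Fubini_integrable) (use u v in \<open>auto simp: abs_mult\<close>)
  then show 1: "integrable (lborel \<Otimes>\<^sub>M lborel) (\<lambda>z. u (fst z) * v (snd z))"
    by (simp add: case_prod_beta')
  from lborel_pair.integral_fst'[OF 1]
  show "(\<integral>z. u (fst z) * v (snd z) \<partial>(lborel \<Otimes>\<^sub>M lborel)) = (LBINT x. u x) * (LBINT x. v x)"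
    using u v by simp
qed

lemma integrable_pairing:
  fixes \<phi> :: "real \<times> real \<Rightarrow> real" and u v :: "real \<Rightarrow> real"
  assumes "integrable lborel u" "integrable lborel v"
    and "\<phi> \<in> borel_measurable (borel \<Otimes>\<^sub>M borel)" "\<And>z. \<bar>\<phi> z\<bar> \<le> C"
  shows "integrable (lborel \<Otimes>\<^sub>M lborel) (\<lambda>z. \<phi> z * (u (fst z) * v (snd z)))"
  by (rule integrable_bounded_mult(1)[OF integrable_tensor(1)[OF assms(1,2)] _ assms(4)])
     (use assms(3) in simp)

lemma pairing_iterated:
  assumes "integrable lborel u" "integrable lborel v"
    and "\<phi> \<in> borel_measurable (borel \<Otimes>\<^sub>M borel)" "\<And>z. \<bar>\<phi> z\<bar> \<le> C"
  shows "pairing \<phi> u v = (LBINT x. (LBINT y. \<phi> (x, y) * (u x * v y)))"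
  unfolding pairing_def using lborel_pair.integral_fst'[OF integrable_pairing[OF assms]] by simp

lemma pairing_bound:
  assumes "integrable lborel u" "integrable lborel v"
    and "\<phi> \<in> borel_measurable (borel \<Otimes>\<^sub>M borel)" "\<And>z. \<bar>\<phi> z\<bar> \<le> C"
  shows "\<bar>pairing \<phi> u v\<bar> \<le> C * ((LBINT x. \<bar>u x\<bar>) * (LBINT x. \<bar>v x\<bar>))"
proof -
  have "\<bar>pairing \<phi> u v\<bar> \<le> C * (\<integral>z. \<bar>u (fst z) * v (snd z)\<bar> \<partial>(lborel \<Otimes>\<^sub>M lborel))"
    unfolding pairing_def
    by (rule integrable_bounded_mult(2)[OF integrable_tensor(1)[OF assms(1,2)] _ assms(4)])
       (use assms(3) in simp)
  also have "(\<integral>z. \<bar>u (fst z) * v (snd z)\<bar> \<partial>(lborel \<Otimes>\<^sub>M lborel)) = (LBINT x. \<bar>u x\<bar>) * (LBINT x. \<bar>v x\<bar>)"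
    unfolding abs_mult using assms by (intro integrable_tensor(2)) auto
  finally show ?thesis .
qed

text \<open>
  Bilinearity: \<open>u \<otimes> u - v \<otimes> v = u \<otimes> (u - v) + (u - v) \<otimes> v\<close>.
\<close>

lemma pairing_diff_bound:
  assumes u: "integrable lborel u" and v: "integrable lborel v"
    and \<phi>: "\<phi> \<in> borel_measurable (borel \<Otimes>\<^sub>M borel)" "\<And>z. \<bar>\<phi> z\<bar> \<le> C"
  shows "\<bar>pairing \<phi> u u - pairing \<phi> v v\<bar> \<le>
    C * (((LBINT x. \<bar>u x\<bar>) + (LBINT x. \<bar>v x\<bar>)) * (LBINT x. \<bar>u x - v x\<bar>))"
proof -
  have d: "integrable lborel (\<lambda>x. u x - v x)" using u v by simp
  have "pairing \<phi> u u - pairing \<phi> v v =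
    pairing \<phi> u (\<lambda>x. u x - v x) + pairing \<phi> (\<lambda>x. u x - v x) v"
    unfolding pairing_def using u v d \<phi>
    apply (subst Bochner_Integration.integral_diff[symmetric])
      apply (rule integrable_pairing; assumption)+
    apply (subst Bochner_Integration.integral_add[symmetric])
      apply (rule integrable_pairing; assumption)+
    by (simp add: algebra_simps)
  then show ?thesis
    using pairing_bound[OF u d \<phi>] pairing_bound[OF d v \<phi>] by (simp add: algebra_simps)
qed

lemma pairing_diff_kernel_bound:
  assumes u: "integrable lborel u" and v: "integrable lborel v"
    and \<phi>: "\<phi> \<in> borel_measurable (borel \<Otimes>\<^sub>M borel)" "\<And>z. \<bar>\<phi> z\<bar> \<le> C"
    and \<psi>: "\<psi> \<in> borel_measurable (borel \<Otimes>\<^sub>M borel)" "\<And>z. \<bar>\<psi> z\<bar> \<le> C'"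
    and d: "\<And>z. \<bar>\<phi> z - \<psi> z\<bar> \<le> D"
  shows "\<bar>pairing \<phi> u v - pairing \<psi> u v\<bar> \<le> D * ((LBINT x. \<bar>u x\<bar>) * (LBINT x. \<bar>v x\<bar>))"
proof -
  have "pairing \<phi> u v - pairing \<psi> u v = pairing (\<lambda>z. \<phi> z - \<psi> z) u v"
    unfolding pairing_def
    apply (subst Bochner_Integration.integral_diff[symmetric])
    using integrable_pairing[OF u v \<phi>] integrable_pairing[OF u v \<psi>] by (simp_all add: algebra_simps)
  also have "\<bar>\<dots>\<bar> \<le> D * ((LBINT x. \<bar>u x\<bar>) * (LBINT x. \<bar>v x\<bar>))"
    using \<phi> \<psi> by (intro pairing_bound u v d) auto
  finally show ?thesis .
qed

definition conv :: "(real \<Rightarrow> real) \<Rightarrow> (real \<Rightarrow> real) \<Rightarrow> real \<Rightarrow> real" where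
  "conv u v x = (LBINT y. u y * v (x - y))"

lemma measurable_conv[measurable]:
  assumes [measurable]: "u \<in> borel_measurable borel" "v \<in> borel_measurable borel"
  shows "conv u v \<in> borel_measurable borel"
  unfolding conv_def by measurable

text \<open>
  The defining integral of \<open>conv u v\<close> need only converge at almost every point. At the other points
  \<open>conv u v\<close> is \<open>0\<close>, so that the convolution of nonnegative functions is nonnegative everywhere.
\<close>

lemma integral_conv:
  assumes u: "integrable lborel u" and v: "integrable lborel v"
    and \<psi>: "\<psi> \<in> borel_measurable borel" "\<And>x. \<bar>\<psi> x\<bar> \<le> C"
  shows "integrable lborel (\<lambda>x. \<psi> x * conv u v x)"
    and "(LBINT x. \<psi> x * conv u v x) = pairing (\<lambda>z. \<psi> (fst z + snd z)) u v"
proof -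
  have [measurable]: "u \<in> borel_measurable borel" "v \<in> borel_measurable borel"
    "\<psi> \<in> borel_measurable borel" using assms by auto
  have v': "integrable lborel (\<lambda>x. v (x - y))" for y
    using lborel_integrable_real_affine[OF v, of 1 "-y"] by simp
  have nv: "(LBINT x. \<bar>v (x - y)\<bar>) = (LBINT x. \<bar>v x\<bar>)" for y
    using lborel_integral_real_affine[of 1 "\<lambda>x. \<bar>v x\<bar>" "-y"] by simp
  have I0: "integrable (lborel \<Otimes>\<^sub>M lborel) (\<lambda>(y,x). u y * v (x - y))"
  proof (rule lborel_pair.Fubini_integrable)
    show "integrable lborel (\<lambda>y. LBINT x. norm (case (y,x) of (y,x) \<Rightarrow> u y * v (x - y)))"
      using u by (simp add: abs_mult nv)
    show "AE y in lborel. integrable lborel (\<lambda>x. case (y,x) of (y,x) \<Rightarrow> u y * v (x - y))"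
      using v' by simp
  qed simp
  have I: "integrable (lborel \<Otimes>\<^sub>M lborel) (\<lambda>z. \<psi> (snd z) * (case z of (y,x) \<Rightarrow> u y * v (x - y)))"
    by (rule integrable_bounded_mult(1)[OF I0, where C=C]) (use \<psi> in auto)
  then have I': "integrable (lborel \<Otimes>\<^sub>M lborel) (\<lambda>(y,x). \<psi> x * (u y * v (x - y)))"
    by (simp add: case_prod_beta')
  show "integrable lborel (\<lambda>x. \<psi> x * conv u v x)"
    using lborel_pair.integrable_snd[OF I'] by (simp add: conv_def)
  have "(LBINT x. \<psi> x * conv u v x) = (LBINT x. LBINT y. \<psi> x * (u y * v (x - y)))"
    by (simp add: conv_def)
  also have "\<dots> = (LBINT y. LBINT x. \<psi> x * (u y * v (x - y)))"
    by (rule lborel_pair.Fubini_integral[OF I'])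
  also have "\<dots> = (LBINT y. LBINT x. \<psi> (y + x) * (u y * v x))"
  proof (rule Bochner_Integration.integral_cong[OF refl])
    fix y
    show "(LBINT x. \<psi> x * (u y * v (x - y))) = (LBINT x. \<psi> (y + x) * (u y * v x))"
      using lborel_integral_real_affine[of 1 "\<lambda>x. \<psi> x * (u y * v (x - y))" y] by simp
  qed
  also have "\<dots> = pairing (\<lambda>z. \<psi> (fst z + snd z)) u v"
    by (subst pairing_iterated[OF u v, where C=C]) (use \<psi> in auto)
  finally show "(LBINT x. \<psi> x * conv u v x) = pairing (\<lambda>z. \<psi> (fst z + snd z)) u v" .
qed

section \<open>Sums as integrals of step functions\<close>

text \<open>
  Since \<open>nat\<close> sends negative integers to \<open>0\<close>, step functions extend constantly to negative times.
\<close>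

definition step_idx :: "real \<Rightarrow> real \<Rightarrow> nat" where
  "step_idx h t = nat \<lfloor>t / h\<rfloor>"

lemma measurable_step_idx[measurable]: "step_idx h \<in> borel \<rightarrow>\<^sub>M count_space UNIV"
  unfolding step_idx_def by measurable

lemma step_idx_bounds:
  assumes "h > 0" "t \<ge> 0"
  shows "real (step_idx h t) * h \<le> t" "t < (real (step_idx h t) + 1) * h"
proof -
  have "real (step_idx h t) = of_int \<lfloor>t / h\<rfloor>" using assms by (simp add: step_idx_def)
  moreover have "of_int \<lfloor>t / h\<rfloor> \<le> t / h" "t / h < of_int \<lfloor>t / h\<rfloor> + 1" by linarith+
  ultimately have "real (step_idx h t) \<le> t / h" "t / h < real (step_idx h t) + 1" by simp_all
  then show "real (step_idx h t) * h \<le> t" "t < (real (step_idx h t) + 1) * h"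
    using assms by (simp_all only: pos_le_divide_eq pos_divide_less_eq)
qed

lemma step_idx_eq:
  assumes "h > 0" "real k * h \<le> t" "t < (real k + 1) * h"
  shows "step_idx h t = k"
proof -
  have "\<lfloor>t / h\<rfloor> = int k"
    using assms by (intro floor_unique) (auto simp: field_simps)
  then show ?thesis by (simp add: step_idx_def)
qed

lemma step_idx_mono:
  assumes "h > 0" "s \<le> t" shows "step_idx h s \<le> step_idx h t"
  unfolding step_idx_def using assms by (intro nat_mono floor_mono divide_right_mono) auto

lemma has_integral_step_idx:
  fixes c :: "nat \<Rightarrow> real"
  assumes h: "h > 0"
  shows "k * h \<le> t \<Longrightarrow> t \<le> (real k + 1) * h \<Longrightarrow>
    ((\<lambda>s. c (step_idx h s)) has_integral (h * (\<Sum>j<k. c j) + (t - real k * h) * c k)) {0..t}"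
proof (induction k arbitrary: t)
  case 0
  have "((\<lambda>s. c (step_idx h s)) has_integral t * c 0) {0..t}"
  proof (rule has_integral_spike_finite[of "{t}"])
    show "((\<lambda>s. c 0) has_integral t * c 0) {0..t}"
      using has_integral_const_real[of "c 0" 0 t] 0 by simp
    show "c (step_idx h x) = c 0" if "x \<in> {0..t} - {t}" for x
      using that 0 by (subst step_idx_eq[OF h, of 0]) auto
  qed simp
  then show ?case by simp
next
  case (Suc k)
  define t0 where "t0 = (real k + 1) * h"
  have a: "((\<lambda>s. c (step_idx h s)) has_integral (h * (\<Sum>j<k. c j) + (t0 - real k * h) * c k)) {0..t0}"
    using h by (intro Suc.IH) (auto simp: t0_def algebra_simps)
  have b: "((\<lambda>s. c (step_idx h s)) has_integral (t - t0) * c (Suc k)) {t0..t}"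
  proof (rule has_integral_spike_finite[of "{t}"])
    show "((\<lambda>s. c (Suc k)) has_integral (t - t0) * c (Suc k)) {t0..t}"
      using has_integral_const_real[of "c (Suc k)" t0 t] Suc.prems
      by (simp add: t0_def algebra_simps)
    show "c (step_idx h x) = c (Suc k)" if "x \<in> {t0..t} - {t}" for x
      using that Suc.prems by (subst step_idx_eq[OF h, of "Suc k"]) (auto simp: t0_def algebra_simps)
  qed simp
  have "0 \<le> t0" "t0 \<le> t" using Suc.prems h by (auto simp: t0_def algebra_simps)
  from has_integral_combine[OF this a b] show ?case
    by (simp add: t0_def algebra_simps)
qed

text \<open>
  The last, incomplete step is kept exactly: its contribution is the product of its length, less than
  \<open>h\<close>, with a value of \<open>c\<close> that need not be bounded uniformly in \<open>h\<close>.
\<close>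

lemma integral_step_idx:
  fixes c :: "nat \<Rightarrow> real"
  assumes h: "h > 0" and t: "t \<ge> 0"
  shows "set_integrable lborel {0..t} (\<lambda>s. c (step_idx h s))"
    and "(LBINT s:{0..t}. c (step_idx h s)) =
      h * (\<Sum>j<step_idx h t. c j) + (t - real (step_idx h t) * h) * c (step_idx h t)"
proof -
  let ?B = "\<Sum>j\<le>step_idx h t. \<bar>c j\<bar>"
  have m[measurable]: "(\<lambda>s. c (step_idx h s)) \<in> borel_measurable borel" by measurable
  have "\<bar>c (step_idx h s)\<bar> \<le> ?B" if "s \<in> {0..t}" for s
    using that step_idx_mono[OF h, of s t]
    by (intro member_le_sum[of _ _ "\<lambda>j. \<bar>c j\<bar>"]) auto
  then show i: "set_integrable lborel {0..t} (\<lambda>s. c (step_idx h s))"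
    unfolding set_integrable_def
    by (intro integrableI_bounded_set_indicator[where B="?B"] AE_I2) (auto simp: emeasure_lborel_Icc_eq)
  have "((\<lambda>s. c (step_idx h s)) has_integral (LBINT s:{0..t}. c (step_idx h s))) {0..t}"
    using set_borel_integral_eq_integral[OF i] by (simp add: has_integral_integral)
  moreover have "((\<lambda>s. c (step_idx h s)) has_integral (h * (\<Sum>j<step_idx h t. c j) + (t - real (step_idx h t) * h) * c (step_idx h t))) {0..t}"
    using step_idx_bounds[OF h t] by (intro has_integral_step_idx h) auto
  ultimately show "(LBINT s:{0..t}. c (step_idx h s)) =
      h * (\<Sum>j<step_idx h t. c j) + (t - real (step_idx h t) * h) * c (step_idx h t)"
    by (rule has_integral_unique)
qed

section \<open>Gronwall's inequality\<close>

text \<open>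
  Let \<open>S\<close> be the supremum of \<open>exp (- 2 C t) D t\<close>. Inserting \<open>D s \<le> S exp (2 C s)\<close> into the integral
  returns at most half of \<open>S\<close>, so \<open>S \<le> \<epsilon> + S / 2\<close>. This is why the constant is \<open>2\<close> and the exponent is doubled.
\<close>

lemma Gronwall:
  fixes D :: "real \<Rightarrow> real"
  assumes D: "\<And>t. 0 \<le> t \<Longrightarrow> t \<le> T \<Longrightarrow> D t \<le> \<epsilon> + C * (LBINT s:{0..t}. D s)"
    and int: "set_integrable lborel {0..T} D"
    and bound: "\<And>t. 0 \<le> t \<Longrightarrow> t \<le> T \<Longrightarrow> D t \<le> M"
    and C: "C > 0" and e: "\<epsilon> \<ge> 0" and t: "0 \<le> t" "t \<le> T"
  shows "D t \<le> 2 * \<epsilon> * exp (2 * C * t)"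
proof -
  define S where "S = (SUP t\<in>{0..T}. exp (- (2*C*t)) * D t)"
  have bdd: "bdd_above ((\<lambda>t. exp (- (2*C*t)) * D t) ` {0..T})"
  proof (rule bdd_aboveI2[where M="\<bar>M\<bar>"])
    fix t assume "t \<in> {0..T}"
    then have "exp (- (2*C*t)) * D t \<le> exp (- (2*C*t)) * \<bar>M\<bar>" "exp (- (2*C*t)) \<le> 1"
      using bound[of t] C by auto
    moreover have "exp (- (2*C*t)) * \<bar>M\<bar> \<le> 1 * \<bar>M\<bar>"
      using calculation(2) by (intro mult_right_mono) auto
    ultimately show "exp (- (2*C*t)) * D t \<le> \<bar>M\<bar>" by linarith
  qed
  have DS: "D s \<le> S * exp (2 * C * s)" if "s \<in> {0..T}" for s
  proof -
    have "exp (- (2 * C * s)) * D s \<le> S"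
      unfolding S_def using that by (intro cSUP_upper bdd)
    then show ?thesis by (simp add: exp_minus field_simps)
  qed
  have eint: "((\<lambda>s. S * exp (2 * C * s)) has_integral (S * (exp (2*C*t) - 1) / (2*C))) {0..t}" if "0 \<le> t" for t
  proof -
    have "((\<lambda>s. S * exp (2 * C * s)) has_integral (S * exp (2*C*t) / (2*C) - S * exp (2*C*0) / (2*C))) {0..t}"
      using that C
      by (intro fundamental_theorem_of_calculus)
         (auto intro!: derivative_eq_intros simp: has_real_derivative_iff_has_vector_derivative[symmetric])
    then show ?thesis by (simp add: diff_divide_distrib right_diff_distrib)
  qed
  have main: "exp (- (2*C*t)) * D t \<le> \<epsilon> + \<bar>S\<bar> / 2" if t: "t \<in> {0..T}" for t
  proof -
    have i1: "set_integrable lborel {0..t} D"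
      using int t by (rule_tac set_integrable_subset) auto
    have i2: "set_integrable lborel {0..t} (\<lambda>s. S * exp (2 * C * s))"
      by (rule borel_integrable_atLeastAtMost') (auto intro!: continuous_intros)
    have "(LBINT s:{0..t}. D s) \<le> (LBINT s:{0..t}. S * exp (2 * C * s))"
      using t DS by (intro set_integral_mono i1 i2) auto
    also have "\<dots> = S * (exp (2*C*t) - 1) / (2*C)"
      using set_borel_integral_eq_integral(2)[OF i2] integral_unique[OF eint[of t]] t by (simp only: atLeastAtMost_iff)
    finally have "D t \<le> \<epsilon> + C * (S * (exp (2*C*t) - 1) / (2*C))"
      using D[of t] t C by (smt (verit) atLeastAtMost_iff mult_left_mono)
    also have "\<dots> = \<epsilon> + S * (exp (2*C*t) - 1) / 2" using C by simp
    also have "\<dots> \<le> \<epsilon> * exp (2*C*t) + \<bar>S\<bar>/2 * exp (2*C*t)"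
    proof -
      have e1: "exp (2*C*t) \<ge> 1" using C t by simp
      have "\<epsilon> * 1 \<le> \<epsilon> * exp (2*C*t)" using e e1 by (intro mult_left_mono) auto
      moreover have "S * (exp (2*C*t) - 1) \<le> \<bar>S\<bar> * (exp (2*C*t) - 0)"
        using e1 by (intro mult_mono) auto
      ultimately show ?thesis by simp
    qed
    finally have "D t \<le> (\<epsilon> + \<bar>S\<bar>/2) * exp (2*C*t)" by (simp add: algebra_simps)
    then show ?thesis by (simp add: exp_minus field_simps)
  qed
  have "S \<le> \<epsilon> + \<bar>S\<bar>/2"
    unfolding S_def using t by (intro cSUP_least) (use main in \<open>auto simp: S_def\<close>)
  then have "S \<le> 2 * \<epsilon>" using e by linarith
  then show ?thesis
    using DS[of t] t by (smt (verit) atLeastAtMost_iff exp_gt_zero mult_right_mono)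
qed

section \<open>Completeness of \<open>L\<^sup>1\<close>\<close>

text \<open>
  The last conclusion passes the Cauchy rate of the sequence on to the limit. Applied at every time
  separately, it turns a Cauchy estimate uniform in time into convergence uniform in time.
\<close>

lemma L1_complete:
  fixes F :: "nat \<Rightarrow> 'a \<Rightarrow> real"
  assumes i: "\<And>n. integrable M (F n)"
    and c: "\<And>e. e > 0 \<Longrightarrow> \<exists>N. \<forall>m\<ge>N. \<forall>n\<ge>N. (\<integral>x. \<bar>F m x - F n x\<bar> \<partial>M) < e"
    and nn: "\<And>n x. 0 \<le> F n x"
  obtains f where "integrable M f" "\<And>x. 0 \<le> f x"
    "\<And>e N m. m \<ge> N \<Longrightarrow> \<forall>m\<ge>N. \<forall>n\<ge>N. (\<integral>x. \<bar>F m x - F n x\<bar> \<partial>M) \<le> e \<Longrightarrow> (\<integral>x. \<bar>F m x - f x\<bar> \<partial>M) \<le> e"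
proof -
  obtain \<rho> where \<rho>: "strict_mono \<rho>" "AE x in M. Cauchy (\<lambda>i. F (\<rho> i) x)"
    using cauchy_L1_AE_cauchy_subseq[of M F, unfolded real_norm_def, OF i c] by blast
  define f where "f x = (if Cauchy (\<lambda>i. F (\<rho> i) x) then lim (\<lambda>i. F (\<rho> i) x) else 0)" for x
  have [measurable]: "F n \<in> borel_measurable M" for n using i by auto
  have fm[measurable]: "f \<in> borel_measurable M" unfolding f_def by measurable
  have lim: "AE x in M. (\<lambda>i. F (\<rho> i) x) \<longlonglongrightarrow> f x"
    using \<rho>(2) by (auto simp: f_def convergent_LIMSEQ_iff[symmetric] Cauchy_convergent_iff)
  have f0: "0 \<le> f x" for x
    by (auto simp: f_def Cauchy_convergent_iff convergent_LIMSEQ_iff nn intro!: LIMSEQ_le_const)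
  have key: "(\<integral>\<^sup>+x. \<bar>F m x - f x\<bar> \<partial>M) \<le> ennreal e"
    if N: "m \<ge> N" "\<forall>m\<ge>N. \<forall>n\<ge>N. (\<integral>x. \<bar>F m x - F n x\<bar> \<partial>M) \<le> e" for e N m
  proof -
    have "(\<integral>\<^sup>+x. \<bar>F m x - f x\<bar> \<partial>M) = (\<integral>\<^sup>+x. liminf (\<lambda>i. ennreal \<bar>F m x - F (\<rho> i) x\<bar>) \<partial>M)"
    proof (rule nn_integral_cong_AE)
      show "AE x in M. ennreal \<bar>F m x - f x\<bar> = liminf (\<lambda>i. ennreal \<bar>F m x - F (\<rho> i) x\<bar>)"
        using lim
      proof eventually_elim
        case (elim x)
        have "(\<lambda>i. ennreal \<bar>F m x - F (\<rho> i) x\<bar>) \<longlonglongrightarrow> ennreal \<bar>F m x - f x\<bar>"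
          by (intro tendsto_ennrealI tendsto_rabs tendsto_diff tendsto_const elim)
          then show ?case by (intro lim_imp_Liminf[symmetric]) simp_all
        qed
    qed
    also have "\<dots> \<le> liminf (\<lambda>i. \<integral>\<^sup>+x. \<bar>F m x - F (\<rho> i) x\<bar> \<partial>M)"
      by (rule nn_integral_liminf) simp
    also have "\<dots> \<le> liminf (\<lambda>i. ennreal e)"
    proof (rule Liminf_mono, unfold eventually_sequentially, intro exI allI impI)
      fix k assume "N \<le> k"
      then have "N \<le> \<rho> k" using seq_suble[OF \<rho>(1), of k] by linarith
      then have "(\<integral>x. \<bar>F m x - F (\<rho> k) x\<bar> \<partial>M) \<le> e" using N by auto
      then show "(\<integral>\<^sup>+x. \<bar>F m x - F (\<rho> k) x\<bar> \<partial>M) \<le> ennreal e"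
        by (subst nn_integral_eq_integral) (use i in \<open>auto intro!: ennreal_leI\<close>)
    qed
    finally show ?thesis by (simp add: Liminf_const)
  qed
  have di: "integrable M (\<lambda>x. F m x - f x)"
    if N: "m \<ge> N" "\<forall>m\<ge>N. \<forall>n\<ge>N. (\<integral>x. \<bar>F m x - F n x\<bar> \<partial>M) \<le> e" for e N m
    using key[OF N] by (intro integrableI_bounded) (auto intro: le_less_trans)
  obtain N0 where "\<forall>m\<ge>N0. \<forall>n\<ge>N0. (\<integral>x. \<bar>F m x - F n x\<bar> \<partial>M) < 1" using c[of 1] by auto
  then have "integrable M (\<lambda>x. F N0 x - f x)" by (intro di[of N0 N0 1]) (auto intro: less_imp_le)
  from Bochner_Integration.integrable_diff[OF i[of N0] this] have fi: "integrable M f" by simp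
  show ?thesis
  proof (rule that[OF fi f0])
    fix e :: real and N m :: nat
    assume N: "m \<ge> N" "\<forall>m\<ge>N. \<forall>n\<ge>N. (\<integral>x. \<bar>F m x - F n x\<bar> \<partial>M) \<le> e"
    have "0 \<le> (\<integral>x. \<bar>F m x - F m x\<bar> \<partial>M)" by simp
    then have e: "0 \<le> e" using N by fastforce
    have "ennreal (\<integral>x. \<bar>F m x - f x\<bar> \<partial>M) = (\<integral>\<^sup>+x. \<bar>F m x - f x\<bar> \<partial>M)"
      using fi i by (intro nn_integral_eq_integral[symmetric]) auto
    also have "\<dots> \<le> ennreal e" by (rule key[OF N])
    finally show "(\<integral>x. \<bar>F m x - f x\<bar> \<partial>M) \<le> e" using e by simp
  qed
qed

section \<open>One explicit Euler step\<close>

text \<open>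
  Functions on \<open>(0,\<infinity>)\<close> are extended by zero, so that all integrals may be taken over the whole line.
\<close>

definition size_density :: "(real \<Rightarrow> real) \<Rightarrow> bool" where
  "size_density f \<longleftrightarrow> integrable lborel f \<and> (\<forall>x. 0 \<le> f x) \<and> (\<forall>x\<le>0. f x = 0)"

lemma size_densityD:
  assumes "size_density f"
  shows "integrable lborel f" "f \<in> borel_measurable borel" "0 \<le> f x" "x \<le> 0 \<Longrightarrow> f x = 0"
  using assms by (auto simp: size_density_def)

definition coag_step :: "real \<Rightarrow> (real \<Rightarrow> real) \<Rightarrow> (real \<Rightarrow> real) \<Rightarrow> real \<Rightarrow> real" where
  "coag_step h \<rho> f x = f x + h * (conv (\<lambda>x. \<rho> x * f x) (\<lambda>x. \<rho> x * f x) x / 2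
     - \<rho> x * f x * (LBINT y. \<rho> y * f y))"

definition pair_tilde :: "(real \<Rightarrow> real) \<Rightarrow> real \<times> real \<Rightarrow> real" where
  "pair_tilde \<theta> z = tilde \<theta> (fst z) (snd z)"

lemma measurable_pair_tilde[measurable]:
  assumes [measurable]: "\<theta> \<in> borel_measurable borel"
  shows "pair_tilde \<theta> \<in> borel_measurable (borel \<Otimes>\<^sub>M borel)"
  unfolding pair_tilde_def tilde_def by measurable

lemma pair_tilde_bound:
  assumes "\<And>x. \<bar>\<theta> x\<bar> \<le> C" shows "\<bar>pair_tilde \<theta> z\<bar> \<le> 3 * C"
  using assms[of "fst z"] assms[of "snd z"] assms[of "fst z + snd z"]
  by (auto simp: pair_tilde_def tilde_def)

lemma pairing_tilde:
  assumes g: "integrable lborel g" and \<psi>: "\<psi> \<in> borel_measurable borel" "\<And>x. \<bar>\<psi> x\<bar> \<le> C"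
  shows "pairing (pair_tilde \<psi>) g g = pairing (\<lambda>z. \<psi> (fst z + snd z)) g g
    - 2 * (LBINT x. \<psi> x * g x) * (LBINT x. g x)"
proof -
  have [measurable]: "\<psi> \<in> borel_measurable borel" by fact
  have \<psi>g: "integrable lborel (\<lambda>x. \<psi> x * g x)"
    using integrable_bounded_mult(1)[OF g _ \<psi>(2)] \<psi>(1) by simp
  have i1: "integrable (lborel \<Otimes>\<^sub>M lborel) (\<lambda>z. \<psi> (fst z + snd z) * (g (fst z) * g (snd z)))"
    by (rule integrable_pairing[OF g g _ \<psi>(2)]) measurable
  note i2 = integrable_tensor[OF \<psi>g g] and i3 = integrable_tensor[OF g \<psi>g]
  have "pairing (pair_tilde \<psi>) g g = (\<integral>z. \<psi> (fst z + snd z) * (g (fst z) * g (snd z))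
     - (\<psi> (fst z) * g (fst z)) * g (snd z) - g (fst z) * (\<psi> (snd z) * g (snd z)) \<partial>(lborel \<Otimes>\<^sub>M lborel))"
    unfolding pairing_def pair_tilde_def tilde_def
    by (rule arg_cong[where f="integral\<^sup>L _"]) (auto simp: algebra_simps)
  also have "\<dots> = pairing (\<lambda>z. \<psi> (fst z + snd z)) g g
     - (LBINT x. \<psi> x * g x) * (LBINT x. g x) - (LBINT x. g x) * (LBINT x. \<psi> x * g x)"
    unfolding pairing_def using i1 i2 i3 by simp
  finally show ?thesis by simp
qed

context
  fixes h B :: real and \<rho> f g :: "real \<Rightarrow> real" and R :: real
  assumes dens: "size_density f"
    and \<rho>[measurable]: "\<rho> \<in> borel_measurable borel" and \<rho>0: "\<And>x. 0 \<le> \<rho> x" and \<rho>B: "\<And>x. \<rho> x \<le> B"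
    and h: "0 \<le> h"
  defines "g \<equiv> \<lambda>x. \<rho> x * f x" and "R \<equiv> LBINT y. \<rho> y * f y"
begin

lemma rate_density: "size_density g" "0 \<le> R" "R \<le> B * (LBINT x. f x)"
proof -
  have i: "integrable lborel g"
    unfolding g_def using size_densityD[OF dens] \<rho>0 \<rho>B
    by (intro integrable_bounded_mult(1)[where C=B]) auto
  then show "size_density g"
    using size_densityD[OF dens] \<rho>0 by (auto simp: size_density_def g_def)
  show "0 \<le> R" unfolding R_def using size_densityD[OF dens] \<rho>0 by (intro integral_nonneg_AE) auto
  have "R \<le> (LBINT x. B * f x)"
    unfolding R_def using i size_densityD[OF dens] \<rho>B
    by (intro integral_mono) (auto simp: g_def mult_right_mono)
  then show "R \<le> B * (LBINT x. f x)" by simp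
qed

lemma coag_step_eq: "coag_step h \<rho> f x = f x + h * (conv g g x / 2 - g x * R)"
  by (simp only: coag_step_def g_def R_def)

text \<open>
  Here the loss term stays with \<open>f\<close>, in the form in which an exponential weight can absorb it.
\<close>

lemma coag_step_weak_split:
  assumes \<psi>: "\<psi> \<in> borel_measurable borel" "\<And>x. \<bar>\<psi> x\<bar> \<le> C"
  shows "integrable lborel (\<lambda>x. \<psi> x * coag_step h \<rho> f x)"
    and "(LBINT x. \<psi> x * coag_step h \<rho> f x) =
      (LBINT x. \<psi> x * (1 - h * R * \<rho> x) * f x) + h / 2 * pairing (\<lambda>z. \<psi> (fst z + snd z)) g g"
proof -
  have [measurable]: "\<psi> \<in> borel_measurable borel" "f \<in> borel_measurable borel"
    using \<psi> size_densityD[OF dens] by auto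
  note gd = size_densityD[OF rate_density(1)]
  have i1: "integrable lborel (\<lambda>x. \<psi> x * f x)" "integrable lborel (\<lambda>x. \<psi> x * g x)"
    using integrable_bounded_mult(1)[OF size_densityD(1)[OF dens] _ \<psi>(2)]
      integrable_bounded_mult(1)[OF gd(1) _ \<psi>(2)] \<psi>(1) by auto
  note i2 = integral_conv[OF gd(1) gd(1) \<psi>]
  have eq: "\<psi> x * coag_step h \<rho> f x = (\<psi> x * f x - h * R * (\<psi> x * g x)) + h/2 * (\<psi> x * conv g g x)" for x
    by (simp add: coag_step_eq algebra_simps)
  show "integrable lborel (\<lambda>x. \<psi> x * coag_step h \<rho> f x)"
    unfolding eq using i1 i2 by simp
  have eq2: "\<psi> x * (1 - h * R * \<rho> x) * f x = \<psi> x * f x - h * R * (\<psi> x * g x)" for x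
    by (simp add: g_def algebra_simps)
  show "(LBINT x. \<psi> x * coag_step h \<rho> f x) =
      (LBINT x. \<psi> x * (1 - h * R * \<rho> x) * f x) + h / 2 * pairing (\<lambda>z. \<psi> (fst z + snd z)) g g"
    unfolding eq eq2 using i1 i2 by simp
qed

lemma coag_step_weak:
  assumes \<psi>: "\<psi> \<in> borel_measurable borel" "\<And>x. \<bar>\<psi> x\<bar> \<le> C"
  shows "(LBINT x. \<psi> x * coag_step h \<rho> f x) =
    (LBINT x. \<psi> x * f x) + h / 2 * pairing (pair_tilde \<psi>) g g"
proof -
  note gd = size_densityD[OF rate_density(1)]
  have i1: "integrable lborel (\<lambda>x. \<psi> x * f x)" "integrable lborel (\<lambda>x. \<psi> x * g x)"
    using integrable_bounded_mult(1)[OF size_densityD(1)[OF dens] _ \<psi>(2)]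
      integrable_bounded_mult(1)[OF gd(1) _ \<psi>(2)] \<psi>(1) by auto
  have eq2: "\<psi> x * (1 - h * R * \<rho> x) * f x = \<psi> x * f x - h * R * (\<psi> x * g x)" for x
    by (simp add: g_def algebra_simps)
  have "(LBINT x. \<psi> x * (1 - h * R * \<rho> x) * f x) = (LBINT x. \<psi> x * f x) - h * R * (LBINT x. \<psi> x * g x)"
    unfolding eq2 using i1 by simp
  moreover have "(LBINT x. g x) = R" by (simp add: g_def R_def)
  ultimately have "(LBINT x. \<psi> x * coag_step h \<rho> f x) = (LBINT x. \<psi> x * f x)
      - h * (LBINT x. g x) * (LBINT x. \<psi> x * g x) + h / 2 * pairing (\<lambda>z. \<psi> (fst z + snd z)) g g"
    using coag_step_weak_split(2)[OF \<psi>] by simp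
  then show ?thesis
    unfolding pairing_tilde[OF gd(1) \<psi>] by (simp add: algebra_simps)
qed

text \<open>
  The loss \<open>h \<rho> f R\<close> does not exceed \<open>f\<close> since \<open>h \<rho> R \<le> 1\<close>, and the gain is nonnegative.
\<close>

lemma coag_step_density:
  assumes small: "h * B * (B * (LBINT x. f x)) \<le> 1"
  shows "size_density (coag_step h \<rho> f)"
proof -
  note gd = size_densityD[OF rate_density(1)]
  have "integrable lborel (\<lambda>x. 1 * coag_step h \<rho> f x)"
    by (rule coag_step_weak_split(1)[where C=1]) auto
  moreover have "0 \<le> coag_step h \<rho> f x" for x
  proof -
    have "h * (\<rho> x * R) \<le> h * (B * (B * (LBINT x. f x)))"
      using h \<rho>0[of x] \<rho>B[of x] rate_density by (intro mult_left_mono mult_mono) auto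
    then have "h * (\<rho> x * R) \<le> 1" using small by (simp add: mult.assoc)
    then have "h * (\<rho> x * R) * f x \<le> 1 * f x"
      using size_densityD[OF dens] by (intro mult_right_mono) auto
    moreover have "h * (\<rho> x * R) * f x = h * (g x * R)" by (simp add: g_def)
    ultimately have "h * (g x * R) \<le> f x" by (simp only: mult_1)
    moreover have "0 \<le> conv g g x"
      unfolding conv_def using gd by (intro integral_nonneg_AE) auto
    then have "0 \<le> h * (conv g g x / 2)" using h by simp
    ultimately show ?thesis
      unfolding coag_step_eq right_diff_distrib by linarith
  qed
  moreover have "coag_step h \<rho> f x = 0" if "x \<le> 0" for x
  proof -
    have "g y * g (x - y) = 0" for y
      using gd(4)[of y] gd(4)[of "x - y"] that by (cases "y \<le> 0") auto
    then have "conv g g x = (\<integral>y. 0 \<partial>(lborel :: real measure))"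
      unfolding conv_def by (simp only:)
    then show ?thesis
      using size_densityD(4)[OF dens that] gd(4)[OF that] by (simp add: coag_step_eq)
  qed
  ultimately show ?thesis by (simp add: size_density_def)
qed

lemma coag_step_mass:
  "(LBINT x. coag_step h \<rho> f x) = (LBINT x. f x) - h / 2 * R\<^sup>2"
proof -
  note gd = size_densityD[OF rate_density(1)]
  have "pairing (pair_tilde (\<lambda>x. 1)) g g = - (R * R)"
    using integrable_tensor(2)[OF gd(1) gd(1)]
    by (simp add: pairing_def pair_tilde_def tilde_def) (simp add: g_def R_def)
  then show ?thesis
    using coag_step_weak[of "\<lambda>x. 1" 1] by (simp add: power2_eq_square)
qed

end

text \<open>
  The function \<open>min x a\<close>, made bounded on the whole line by the value \<open>0\<close> at negative sizes.
\<close>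

definition cut :: "real \<Rightarrow> real \<Rightarrow> real" where "cut a x = max 0 (min x a)"

lemma measurable_cut[measurable]: "cut a \<in> borel_measurable borel"
  unfolding cut_def by measurable

lemma cut_bound: "0 \<le> a \<Longrightarrow> \<bar>cut a x\<bar> \<le> a" by (auto simp: cut_def)

text \<open>
  Markov's inequality: \<open>cut a\<close> equals \<open>a\<close> beyond \<open>a\<close>.
\<close>

lemma cut_mass_tail:
  assumes f: "size_density f" and a: "0 < a" and m: "(LBINT x. cut a x * f x) \<le> M"
  shows "(LBINT x. indicator {a<..} x * f x) \<le> M / a"
proof -
  note fd[measurable] = size_densityD(2)[OF f]
  have "(LBINT x. indicator {a<..} x * f x) \<le> (LBINT x. (1/a) * (cut a x * f x))"
  proof (rule integral_mono)
    show "integrable lborel (\<lambda>x. indicator {a<..} x * f x)"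
      using size_densityD[OF f] by (intro integrable_bounded_mult(1)[where C=1]) (auto simp: indicator_def)
    show "integrable lborel (\<lambda>x. (1/a) * (cut a x * f x))"
      using size_densityD[OF f] cut_bound[of a] a by (intro integrable_mult_right integrable_bounded_mult(1)[where C=a]) auto
    fix x show "indicator {a<..} x * f x \<le> (1/a) * (cut a x * f x)"
      using a size_densityD(3)[OF f, of x] by (auto simp: cut_def indicator_def)
  qed
  also have "\<dots> \<le> M / a" using m a by (simp add: divide_right_mono)
  finally show ?thesis .
qed

text \<open>
  \<open>cut a\<close> is subadditive, and \<open>cut a (x + y) - cut a x - cut a y = - a\<close> if \<open>x\<close> and \<open>y\<close> both exceed \<open>a\<close>.
  Thus collisions between large particles are paid for by the first moment, whatever the size of \<open>\<rho>\<close>.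
\<close>

lemma coag_step_cut:
  assumes dens: "size_density f"
    and \<rho>[measurable]: "\<rho> \<in> borel_measurable borel" and \<rho>0: "\<And>x. 0 \<le> \<rho> x" and \<rho>B: "\<And>x. \<rho> x \<le> B"
    and h: "0 \<le> h" and a: "0 \<le> a"
  shows "(LBINT x. cut a x * coag_step h \<rho> f x)
    + h * a / 2 * (LBINT x. indicator {a<..} x * (\<rho> x * f x))\<^sup>2 \<le> (LBINT x. cut a x * f x)"
proof -
  define g where "g = (\<lambda>x. \<rho> x * f x)"
  define S where "S = (LBINT x. indicator {a<..} x * g x)"
  note gd = size_densityD[OF rate_density(1)[OF dens \<rho> \<rho>0 \<rho>B h, folded g_def]]
  have gi: "integrable lborel (\<lambda>x. indicator {a<..} x * g x)"
    using gd by (intro integrable_bounded_mult(1)[where C=1]) (auto simp: indicator_def)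
  have "pairing (pair_tilde (cut a)) g g \<le>
    (\<integral>z. - a * ((indicator {a<..} (fst z) * g (fst z)) * (indicator {a<..} (snd z) * g (snd z))) \<partial>(lborel \<Otimes>\<^sub>M lborel))"
    unfolding pairing_def
  proof (rule integral_mono)
    show "integrable (lborel \<Otimes>\<^sub>M lborel) (\<lambda>z. pair_tilde (cut a) z * (g (fst z) * g (snd z)))"
      by (rule integrable_pairing[OF gd(1) gd(1) _ pair_tilde_bound[OF cut_bound[OF a]]]) measurable
    show "integrable (lborel \<Otimes>\<^sub>M lborel) (\<lambda>z. - a * ((indicator {a<..} (fst z) * g (fst z)) * (indicator {a<..} (snd z) * g (snd z))))"
      by (intro integrable_mult_right integrable_tensor(1) gi)
    fix z :: "real \<times> real"
    \<comment> \<open>Subadditivity, with the gap \<open>a\<close> when both sizes exceed \<open>a\<close>.\<close>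
    have "pair_tilde (cut a) z \<le> - a * (indicator {a<..} (fst z) * indicator {a<..} (snd z))"
      using a by (auto simp: pair_tilde_def tilde_def cut_def indicator_def)
    then have "pair_tilde (cut a) z * (g (fst z) * g (snd z)) \<le>
      - a * (indicator {a<..} (fst z) * indicator {a<..} (snd z)) * (g (fst z) * g (snd z))"
      using gd by (intro mult_right_mono) auto
    then show "pair_tilde (cut a) z * (g (fst z) * g (snd z)) \<le>
      - a * ((indicator {a<..} (fst z) * g (fst z)) * (indicator {a<..} (snd z) * g (snd z)))"
      by (simp add: algebra_simps)
  qed
  also have "\<dots> = - a * (S * S)"
    unfolding S_def using integrable_tensor(2)[OF gi gi] by simp
  finally have "h / 2 * pairing (pair_tilde (cut a)) g g \<le> h / 2 * (- a * (S * S))"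
    using h by (intro mult_left_mono) auto
  then show ?thesis
    using coag_step_weak[OF dens \<rho> \<rho>0 \<rho>B h _ cut_bound[OF a], folded g_def, of "\<lambda>x. x"]
      coag_step_weak[OF dens \<rho> \<rho>0 \<rho>B h measurable_cut cut_bound[OF a], folded g_def]
    by (simp add: S_def g_def power2_eq_square algebra_simps)
qed

section \<open>The Euler approximations\<close>

text \<open>
  The data in Borel form: \<open>r\<close> and \<open>f0\<close> are functions on the whole line, and \<open>b n\<close> bounds \<open>r\<close> up to size \<open>n\<close>.
\<close>

locale coagulation_data =
  fixes r :: "real \<Rightarrow> real" and b :: "nat \<Rightarrow> real" and f0 :: "real \<Rightarrow> real"
  assumes r_meas[measurable]: "r \<in> borel_measurable borel"
    and r_nonneg: "\<And>x. 0 \<le> r x"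
    and r_bound: "\<And>x n. x \<le> real n \<Longrightarrow> r x \<le> b n"
    and f0: "size_density f0"
    and f0_first: "integrable lborel (\<lambda>x. x * f0 x)"
begin

definition M0 :: real where "M0 = (LBINT x. f0 x)"
definition M1 :: real where "M1 = (LBINT x. x * f0 x)"
text \<open>
  Since every rate \<open>R\<close> of the \<open>n\<close>-th approximation is at most \<open>b n * M0\<close>, this step size gives
  \<open>h n * b n * R \<le> 1\<close>, which keeps the scheme nonnegative, and \<open>h n * R\<^sup>2 \<le> 1 / (n + 1)\<close>, which makes
  a single step negligible in the weak formulation.
\<close>

definition h :: "nat \<Rightarrow> real" where "h n = 1 / ((real n + 1) * (1 + (b n)\<^sup>2 * (1 + M0)\<^sup>2))"
definition rtrunc :: "nat \<Rightarrow> real \<Rightarrow> real" where "rtrunc n x = (if x \<le> real n then r x else 0)"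

primrec euler :: "nat \<Rightarrow> nat \<Rightarrow> real \<Rightarrow> real" where
  "euler n 0 = f0"
| "euler n (Suc k) = coag_step (h n) (rtrunc n) (euler n k)"

definition g :: "nat \<Rightarrow> nat \<Rightarrow> real \<Rightarrow> real" where "g n k x = rtrunc n x * euler n k x"
definition R :: "nat \<Rightarrow> nat \<Rightarrow> real" where "R n k = (LBINT x. g n k x)"
definition S :: "real \<Rightarrow> nat \<Rightarrow> nat \<Rightarrow> real" where "S a n k = (LBINT x. indicator {a<..} x * g n k x)"

lemma b_nonneg: "0 \<le> b n"
  using r_bound[of n n] r_nonneg[of n] by auto

lemma rtrunc_meas[measurable]: "rtrunc n \<in> borel_measurable borel"
  unfolding rtrunc_def by measurable

lemma rtrunc_bounds: "0 \<le> rtrunc n x" "rtrunc n x \<le> b n"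
  using r_nonneg r_bound b_nonneg by (auto simp: rtrunc_def)

lemma M_nonneg: "0 \<le> M0" "0 \<le> M1"
proof -
  show "0 \<le> M0" unfolding M0_def using size_densityD[OF f0] by (intro integral_nonneg_AE) auto
  have "0 \<le> x * f0 x" for x using size_densityD(3,4)[OF f0, of x] by (cases "x \<le> 0") auto
  then show "0 \<le> M1" unfolding M1_def by (intro integral_nonneg_AE) auto
qed

lemma h_pos: "0 < h n"
proof -
  have "0 < 1 + (b n)\<^sup>2 * (1 + M0)\<^sup>2" by (intro add_pos_nonneg) auto
  then show ?thesis unfolding h_def by (intro divide_pos_pos mult_pos_pos) auto
qed

lemma h_small: "h n \<le> 1 / (real n + 1)" "h n * (b n)\<^sup>2 * (1 + M0)\<^sup>2 \<le> 1 / (real n + 1)"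
    "h n * b n * (b n * M0) \<le> 1"
proof -
  let ?q = "(b n)\<^sup>2 * (1 + M0)\<^sup>2"
  have q: "0 \<le> ?q" by simp
  have eq: "h n = 1 / (real n + 1) * (1 / (1 + ?q))" by (simp add: h_def)
  have "1 / (1 + ?q) \<le> 1" "?q / (1 + ?q) \<le> 1" using add_pos_nonneg[OF zero_less_one q] by (simp_all only: divide_le_eq_1) simp_all
  then have "1 / (real n + 1) * (1 / (1 + ?q)) \<le> 1 / (real n + 1) * 1"
    "1 / (real n + 1) * (?q / (1 + ?q)) \<le> 1 / (real n + 1) * 1"
    by (intro mult_left_mono; simp)+
  then show "h n \<le> 1 / (real n + 1)" and 2: "h n * (b n)\<^sup>2 * (1 + M0)\<^sup>2 \<le> 1 / (real n + 1)"
    using eq by (simp_all add: algebra_simps)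
  have "M0 \<le> (1 + M0)\<^sup>2" using M_nonneg by (simp add: power2_eq_square algebra_simps)
  then have "h n * (b n)\<^sup>2 * M0 \<le> h n * (b n)\<^sup>2 * (1 + M0)\<^sup>2"
    using h_pos[of n] by (intro mult_left_mono) auto
  also have "\<dots> \<le> 1" using 2 by (rule order_trans) simp
  finally show "h n * b n * (b n * M0) \<le> 1" by (simp add: power2_eq_square algebra_simps)
qed

lemma euler_invariant:
  "size_density (euler n k) \<and> (LBINT x. euler n k x) + h n / 2 * (\<Sum>j<k. (R n j)\<^sup>2) = M0"
proof (induction k)
  case 0
  then show ?case using f0 by (simp add: M0_def)
next
  case (Suc k)
  then have d: "size_density (euler n k)"
    and m: "(LBINT x. euler n k x) + h n / 2 * (\<Sum>j<k. (R n j)\<^sup>2) = M0" by auto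
  have "0 \<le> h n / 2 * (\<Sum>j<k. (R n j)\<^sup>2)"
    using h_pos[of n] by (intro mult_nonneg_nonneg sum_nonneg) auto
  then have "(LBINT x. euler n k x) \<le> M0" using m by linarith
  then have "h n * b n * (b n * (LBINT x. euler n k x)) \<le> h n * b n * (b n * M0)"
    using h_pos[of n] b_nonneg[of n] by (intro mult_left_mono) auto
  then have s: "h n * b n * (b n * (LBINT x. euler n k x)) \<le> 1" using h_small(3)[of n] by linarith
  have hn: "0 \<le> h n" using h_pos[of n] by simp
  have "size_density (euler n (Suc k))"
    using coag_step_density[OF d rtrunc_meas rtrunc_bounds hn s] by simp
  moreover have "(LBINT x. euler n (Suc k) x) = (LBINT x. euler n k x) - h n / 2 * (R n k)\<^sup>2"
    using coag_step_mass[OF d rtrunc_meas rtrunc_bounds hn] by (simp add: R_def g_def)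
  ultimately show ?case using m by (simp add: algebra_simps)
qed

lemmas euler_density = euler_invariant[THEN conjunct1]

lemma euler_mass: "(LBINT x. euler n k x) \<le> M0"
    and sum_R: "h n * (\<Sum>j<k. (R n j)\<^sup>2) \<le> 2 * M0"
proof -
  have m: "(LBINT x. euler n k x) + h n / 2 * (\<Sum>j<k. (R n j)\<^sup>2) = M0" using euler_invariant by auto
  have "0 \<le> h n / 2 * (\<Sum>j<k. (R n j)\<^sup>2)"
    using h_pos[of n] by (intro mult_nonneg_nonneg sum_nonneg) auto
  then show "(LBINT x. euler n k x) \<le> M0" using m by linarith
  have "0 \<le> (LBINT x. euler n k x)"
    using size_densityD[OF euler_density] by (intro integral_nonneg_AE) auto
  then show "h n * (\<Sum>j<k. (R n j)\<^sup>2) \<le> 2 * M0" using m by linarith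
qed

lemma g_density: "size_density (g n k)" and R_nonneg: "0 \<le> R n k" and R_bound: "R n k \<le> b n * M0"
proof -
  have hn: "0 \<le> h n" using h_pos[of n] by simp
  note r = rate_density[OF euler_density rtrunc_meas[of n] rtrunc_bounds hn, of n k]
  have gg: "g n k = (\<lambda>x. rtrunc n x * euler n k x)" by (auto simp: g_def)
  show "size_density (g n k)" "0 \<le> R n k" using r unfolding gg R_def by auto
  have "b n * (LBINT x. euler n k x) \<le> b n * M0"
    using euler_mass b_nonneg by (intro mult_left_mono) auto
  then show "R n k \<le> b n * M0" using r(3) unfolding gg R_def by linarith
qed

lemma euler_cut:
  assumes a: "0 \<le> a"
  shows "(LBINT x. cut a x * euler n k x) + a / 2 * (h n * (\<Sum>j<k. (S a n j)\<^sup>2)) \<le> (LBINT x. cut a x * f0 x)"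
proof (induction k)
  case (Suc k)
  have hn: "0 \<le> h n" using h_pos[of n] by simp
  have "(LBINT x. cut a x * euler n (Suc k) x) + h n * a / 2 * (S a n k)\<^sup>2 \<le> (LBINT x. cut a x * euler n k x)"
    using coag_step_cut[OF euler_density rtrunc_meas rtrunc_bounds hn a] by (simp add: S_def g_def)
  then show ?case using Suc by (simp add: algebra_simps)
qed simp

lemma integral_cut_le:
  assumes a: "0 \<le> a" shows "(LBINT x. cut a x * f0 x) \<le> M1"
  unfolding M1_def
proof (rule integral_mono[OF _ f0_first])
  show "integrable lborel (\<lambda>x. cut a x * f0 x)"
    using size_densityD[OF f0] cut_bound[OF a] by (intro integrable_bounded_mult(1)) auto
  fix x show "cut a x * f0 x \<le> x * f0 x"
    using size_densityD(3,4)[OF f0, of x] by (cases "x \<le> 0") (auto simp: cut_def intro: mult_right_mono)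
qed

lemma euler_cut_mass: "0 \<le> a \<Longrightarrow> (LBINT x. cut a x * euler n k x) \<le> M1"
  and sum_S: "0 < a \<Longrightarrow> h n * (\<Sum>j<k. (S a n j)\<^sup>2) \<le> 2 * M1 / a"
proof -
  { assume a: "0 \<le> a"
    have "0 \<le> h n * (\<Sum>j<k. (S a n j)\<^sup>2)"
      using h_pos[of n] by (intro mult_nonneg_nonneg sum_nonneg) auto
    then have "0 \<le> a / 2 * (h n * (\<Sum>j<k. (S a n j)\<^sup>2))" using a by simp
    then show "(LBINT x. cut a x * euler n k x) \<le> M1"
      using euler_cut[OF a, of n k] integral_cut_le[OF a] by linarith }
  { assume a: "0 < a"
    have "0 \<le> (LBINT x. cut a x * euler n k x)"
      using size_densityD[OF euler_density] by (intro integral_nonneg_AE) (auto simp: cut_def)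
    then have "a / 2 * (h n * (\<Sum>j<k. (S a n j)\<^sup>2)) \<le> M1"
      using euler_cut[of a n k] integral_cut_le[of a] a by linarith
    then show "h n * (\<Sum>j<k. (S a n j)\<^sup>2) \<le> 2 * M1 / a" using a by (simp add: field_simps) }
qed

definition loss :: "nat \<Rightarrow> nat \<Rightarrow> real" where "loss n k = h n * (\<Sum>j<k. R n j)"

text \<open>
  Cauchy and Schwarz turn the square summability of the rates into Hoelder continuity of exponent \<open>1/2\<close>
  of the accumulated rate.
\<close>

lemma loss_diff:
  assumes "j \<le> k"
  shows "0 \<le> loss n k - loss n j" "(loss n k - loss n j)\<^sup>2 \<le> 2 * M0 * (h n * real (k - j))"
proof -
  have eq: "loss n k - loss n j = h n * (\<Sum>i\<in>{j..<k}. R n i)"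
    using sum_diff_nat_ivl[of 0 j k "R n"] assms
    by (simp add: loss_def atLeast0LessThan right_diff_distrib[symmetric])
  show "0 \<le> loss n k - loss n j"
    unfolding eq using h_pos[of n] R_nonneg by (intro mult_nonneg_nonneg sum_nonneg) auto
  have "(\<Sum>i\<in>{j..<k}. R n i)\<^sup>2 \<le> (\<Sum>i\<in>{j..<k}. 1\<^sup>2) * (\<Sum>i\<in>{j..<k}. (R n i)\<^sup>2)"
    using Cauchy_Schwarz_ineq_sum[of "\<lambda>i. 1" "R n" "{j..<k}"] by simp
  also have "\<dots> \<le> real (k - j) * (\<Sum>i<k. (R n i)\<^sup>2)"
    by (auto intro!: mult_left_mono sum_mono2)
  finally have "(h n)\<^sup>2 * (\<Sum>i\<in>{j..<k}. R n i)\<^sup>2 \<le> (h n)\<^sup>2 * (real (k - j) * (\<Sum>i<k. (R n i)\<^sup>2))"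
    by (intro mult_left_mono) auto
  also have "\<dots> = h n * real (k - j) * (h n * (\<Sum>i<k. (R n i)\<^sup>2))" by (simp add: power2_eq_square algebra_simps)
  also have "\<dots> \<le> h n * real (k - j) * (2 * M0)"
    using sum_R h_pos[of n] by (intro mult_left_mono) auto
  finally show "(loss n k - loss n j)\<^sup>2 \<le> 2 * M0 * (h n * real (k - j))"
    unfolding eq by (simp add: power_mult_distrib algebra_simps)
qed

end

section \<open>Strong convergence on bounded size ranges\<close>

lemma exp_diff_le:
  fixes x y L :: real
  assumes "x \<le> L" "y \<le> L"
  shows "\<bar>exp x - exp y\<bar> \<le> exp L * \<bar>x - y\<bar>"
proof -
  have *: "exp v - exp u \<le> exp L * (v - u)" if "u \<le> v" "v \<le> L" for u v :: real
  proof -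
    have "1 - (v - u) \<le> exp (u - v)" using exp_ge_add_one_self[of "u - v"] by linarith
    then have "exp v * (1 - exp (u - v)) \<le> exp v * (v - u)" by (intro mult_left_mono) auto
    also have "\<dots> \<le> exp L * (v - u)" using that by (intro mult_right_mono) auto
    finally show ?thesis by (simp add: right_diff_distrib exp_diff)
  qed
  show ?thesis
    using *[of x y] *[of y x] assms by (cases "x \<le> y") (auto simp: abs_if)
qed

lemma exp_times_one_minus:
  fixes z :: real
  assumes "0 \<le> z" "z \<le> 1"
  shows "\<bar>exp z * (1 - z) - 1\<bar> \<le> z\<^sup>2"
proof -
  have "(1 + z) * (1 - z) \<le> exp z * (1 - z)"
    using assms exp_ge_add_one_self[of z] by (intro mult_right_mono) auto
  moreover have "exp z * (1 - z) \<le> exp z * exp (- z)"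
    using exp_ge_add_one_self[of "-z"] by (intro mult_left_mono) auto
  ultimately show ?thesis
    by (simp add: exp_minus power2_eq_square algebra_simps abs_le_iff)
qed

context coagulation_data
begin

definition F :: "nat \<Rightarrow> real \<Rightarrow> real \<Rightarrow> real" where "F n t = euler n (step_idx (h n) t)"
definition A :: "nat \<Rightarrow> real \<Rightarrow> real" where "A n t = loss n (step_idx (h n) t)"
definition act :: "nat \<Rightarrow> (real \<Rightarrow> real) \<Rightarrow> real \<Rightarrow> real" where
  "act X u x = indicator {..real X} x * r x * u x"

lemma F_density: "size_density (F n t)" unfolding F_def by (rule euler_density)
lemma F_mass: "(LBINT x. F n t x) \<le> M0" unfolding F_def by (rule euler_mass)
lemma F_cut_mass: "0 \<le> a \<Longrightarrow> (LBINT x. cut a x * F n t x) \<le> M1" unfolding F_def by (rule euler_cut_mass)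

lemma loss_bound:
  assumes "h n * real k \<le> T"
  shows "0 \<le> loss n k" "loss n k \<le> sqrt (2 * M0 * T)"
proof -
  have l: "0 \<le> loss n k" "(loss n k)\<^sup>2 \<le> 2 * M0 * (h n * real k)"
    using loss_diff[of 0 k n] by (auto simp: loss_def)
  then show "0 \<le> loss n k" by simp
  have "2 * M0 * (h n * real k) \<le> 2 * M0 * T" using assms M_nonneg by (intro mult_left_mono) auto
  then show "loss n k \<le> sqrt (2 * M0 * T)" using l by (intro real_le_rsqrt) auto
qed

lemma A_bounds:
  assumes "0 \<le> t" "t \<le> T"
  shows "0 \<le> A n t" "A n t \<le> sqrt (2 * M0 * T)"
  using loss_bound[of n "step_idx (h n) t" T] step_idx_bounds(1)[OF h_pos[of n] assms(1)] assms
  by (auto simp: A_def mult.commute)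

lemma act_bound:
  assumes "size_density u"
  shows "size_density (act X u)" "(LBINT x. \<bar>act X u x\<bar>) \<le> b X * (LBINT x. u x)"
proof -
  note ud = size_densityD[OF assms]
  have bd: "\<bar>indicator {..real X} x * r x\<bar> \<le> b X" for x
    using r_nonneg[of x] r_bound[of x X] b_nonneg[of X] by (auto simp: indicator_def)
  have m: "(\<lambda>x. indicator {..real X} x * r x) \<in> borel_measurable lborel" by measurable
  have i: "integrable lborel (act X u)"
    using integrable_bounded_mult(1)[OF ud(1) m bd] by (simp add: act_def[abs_def])
  then show "size_density (act X u)"
    using ud r_nonneg by (auto simp: size_density_def act_def)
  have "(LBINT x. \<bar>act X u x\<bar>) \<le> (LBINT x. b X * u x)"
  proof (rule integral_mono)
    fix x show "\<bar>act X u x\<bar> \<le> b X * u x"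
      using mult_right_mono[OF bd[of x] ud(3)[of x]] ud(3)[of x] by (simp add: act_def abs_mult)
  qed (use i ud in auto)
  then show "(LBINT x. \<bar>act X u x\<bar>) \<le> b X * (LBINT x. u x)" by simp
qed

lemma act_diff_bound:
  assumes "size_density u" "size_density v"
  shows "(LBINT x. \<bar>act X u x - act X v x\<bar>) \<le> b X * (LBINT x. indicator {..real X} x * \<bar>u x - v x\<bar>)"
proof -
  note ud = size_densityD[OF assms(1)] and vd = size_densityD[OF assms(2)]
  have i: "integrable lborel (\<lambda>x. indicator {..real X} x * \<bar>u x - v x\<bar>)"
    using ud vd by (intro integrable_bounded_mult(1)[where C=1]) (auto simp: indicator_def)
  have "(LBINT x. \<bar>act X u x - act X v x\<bar>) \<le> (LBINT x. b X * (indicator {..real X} x * \<bar>u x - v x\<bar>))"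
  proof (rule integral_mono)
    show "integrable lborel (\<lambda>x. \<bar>act X u x - act X v x\<bar>)"
      using size_densityD(1)[OF act_bound(1)[OF assms(1)]] size_densityD(1)[OF act_bound(1)[OF assms(2)]] by auto
    fix x
    have "\<bar>act X u x - act X v x\<bar> = indicator {..real X} x * (r x * \<bar>u x - v x\<bar>)"
      using r_nonneg[of x] by (auto simp: act_def indicator_def right_diff_distrib[symmetric] abs_mult)
    also have "\<dots> \<le> b X * (indicator {..real X} x * \<bar>u x - v x\<bar>)"
      using r_bound[of x X] by (auto simp: indicator_def mult_right_mono)
    finally show "\<bar>act X u x - act X v x\<bar> \<le> b X * (indicator {..real X} x * \<bar>u x - v x\<bar>)" .
  qed (use i in auto)
  then show ?thesis by simp
qed

text \<open>
  A particle of size at most \<open>X\<close> can only arise from two such particles. As far as gains are concerned,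
  sizes up to \<open>X\<close> therefore evolve independently of the larger ones.
\<close>

lemma pairing_restrict:
  assumes X: "X \<le> n" and \<psi>: "\<And>x. x > real X \<Longrightarrow> \<psi> x = 0"
  shows "pairing (\<lambda>z. \<psi> (fst z + snd z)) (g n k) (g n k) =
    pairing (\<lambda>z. \<psi> (fst z + snd z)) (act X (euler n k)) (act X (euler n k))"
  unfolding pairing_def
proof (rule Bochner_Integration.integral_cong[OF refl])
  fix z :: "real \<times> real"
  note gd = size_densityD[OF g_density[of n k]] and ed = size_densityD[OF euler_density[of n k]]
  consider "fst z \<le> 0" | "snd z \<le> 0" | "fst z + snd z > real X"
    | "fst z > 0" "snd z > 0" "fst z \<le> X" "snd z \<le> X" by linarith
  then show "\<psi> (fst z + snd z) * (g n k (fst z) * g n k (snd z)) =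
    \<psi> (fst z + snd z) * (act X (euler n k) (fst z) * act X (euler n k) (snd z))"
  proof cases
    case 4
    then show ?thesis using X by (simp add: act_def g_def rtrunc_def)
  qed (simp_all add: act_def gd(4) ed(4) \<psi>)
qed

text \<open>
  Multiplication by \<open>exp (r x * A n t)\<close> removes the loss term. The estimates are made for the weighted
  density integrated against a fixed \<open>\<sigma>\<close> with values in \<open>[-1,1]\<close>. Choosing \<open>\<sigma>\<close> as a sign at the end recovers
  the \<open>L\<^sup>1\<close> norm, and up to then only scalar functions have to be summed over time.
\<close>

definition expw :: "(real \<Rightarrow> real) \<Rightarrow> real \<Rightarrow> real \<Rightarrow> real" where
  "expw \<sigma> l x = \<sigma> x * exp (r x * l)"

definition dual :: "nat \<Rightarrow> (real \<Rightarrow> real) \<Rightarrow> real \<Rightarrow> (real \<Rightarrow> real) \<Rightarrow> real" where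
  "dual X \<sigma> l u = pairing (\<lambda>z. expw \<sigma> l (fst z + snd z)) (act X u) (act X u)"

context
  fixes X :: nat and \<sigma> :: "real \<Rightarrow> real"
  assumes \<sigma>[measurable]: "\<sigma> \<in> borel_measurable borel"
    and \<sigma>1: "\<And>x. \<bar>\<sigma> x\<bar> \<le> 1" and \<sigma>0: "\<And>x. x > real X \<Longrightarrow> \<sigma> x = 0"
begin

lemma expw_meas[measurable]: "expw \<sigma> l \<in> borel_measurable borel"
  unfolding expw_def[abs_def] by measurable

lemma expw_sum_meas[measurable]: "(\<lambda>z. expw \<sigma> l (fst z + snd z)) \<in> borel_measurable (borel \<Otimes>\<^sub>M borel)"
  by measurable

lemma expw_bound:
  assumes "0 \<le> l" "l \<le> L" shows "\<bar>expw \<sigma> l x\<bar> \<le> exp (b X * L)"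
proof (cases "x > real X")
  case False
  have "r x * l \<le> b X * L" using r_bound[of x X] False b_nonneg[of X] assms by (intro mult_mono) auto
  then have "\<bar>\<sigma> x\<bar> * exp (r x * l) \<le> 1 * exp (b X * L)" by (intro mult_mono \<sigma>1) auto
  then show ?thesis by (simp add: expw_def abs_mult)
qed (simp add: expw_def \<sigma>0)

lemma expw_diff_bound:
  assumes "0 \<le> l" "l \<le> L" "0 \<le> m" "m \<le> L"
  shows "\<bar>expw \<sigma> l x - expw \<sigma> m x\<bar> \<le> exp (b X * L) * (b X * \<bar>l - m\<bar>)"
proof (cases "x > real X")
  case False
  have le: "r x \<le> b X" "0 \<le> r x" using r_bound[of x X] r_nonneg[of x] False by auto
  then have "r x * l \<le> b X * L" "r x * m \<le> b X * L" using b_nonneg[of X] assms by (auto intro!: mult_mono)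
  then have "\<bar>exp (r x * l) - exp (r x * m)\<bar> \<le> exp (b X * L) * \<bar>r x * l - r x * m\<bar>" by (rule exp_diff_le)
  also have "\<bar>r x * l - r x * m\<bar> = r x * \<bar>l - m\<bar>" using le by (simp add: right_diff_distrib[symmetric] abs_mult)
  also have "exp (b X * L) * \<dots> \<le> exp (b X * L) * (b X * \<bar>l - m\<bar>)"
    using le by (intro mult_left_mono mult_right_mono) auto
  finally have "\<bar>\<sigma> x\<bar> * \<bar>exp (r x * l) - exp (r x * m)\<bar> \<le> 1 * (exp (b X * L) * (b X * \<bar>l - m\<bar>))"
    by (intro mult_mono \<sigma>1) auto
  then show ?thesis by (simp add: expw_def right_diff_distrib[symmetric] abs_mult)
qed (use b_nonneg[of X] in \<open>simp add: expw_def \<sigma>0\<close>)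

lemma dual_bound:
  assumes l: "0 \<le> l" "l \<le> L" and u: "size_density u" "(LBINT x. u x) \<le> M0"
  shows "\<bar>dual X \<sigma> l u\<bar> \<le> exp (b X * L) * (b X * M0)\<^sup>2"
proof -
  note a = act_bound[OF u(1), of X]
  have n: "(LBINT x. \<bar>act X u x\<bar>) \<le> b X * M0"
    by (rule order_trans[OF a(2) mult_left_mono[OF u(2) b_nonneg]])
  have "\<bar>dual X \<sigma> l u\<bar> \<le> exp (b X * L) * ((LBINT x. \<bar>act X u x\<bar>) * (LBINT x. \<bar>act X u x\<bar>))"
    unfolding dual_def by (rule pairing_bound[OF size_densityD(1)[OF a(1)] size_densityD(1)[OF a(1)] expw_sum_meas expw_bound[OF l]])
  also have "\<dots> \<le> exp (b X * L) * ((b X * M0) * (b X * M0))"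
    using n b_nonneg[of X] M_nonneg by (intro mult_left_mono mult_mono) auto
  finally show ?thesis by (simp add: power2_eq_square)
qed

lemma dual_diff_time:
  assumes l: "0 \<le> l" "l \<le> L" "0 \<le> m" "m \<le> L" and u: "size_density u" "(LBINT x. u x) \<le> M0"
  shows "\<bar>dual X \<sigma> l u - dual X \<sigma> m u\<bar> \<le> exp (b X * L) * (b X * \<bar>l - m\<bar>) * (b X * M0)\<^sup>2"
proof -
  note a = act_bound[OF u(1), of X]
  have n: "(LBINT x. \<bar>act X u x\<bar>) \<le> b X * M0"
    by (rule order_trans[OF a(2) mult_left_mono[OF u(2) b_nonneg]])
  have "\<bar>dual X \<sigma> l u - dual X \<sigma> m u\<bar> \<le> exp (b X * L) * (b X * \<bar>l - m\<bar>) * ((LBINT x. \<bar>act X u x\<bar>) * (LBINT x. \<bar>act X u x\<bar>))"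
    unfolding dual_def
    by (rule pairing_diff_kernel_bound[OF size_densityD(1)[OF a(1)] size_densityD(1)[OF a(1)]
        expw_sum_meas expw_bound[OF l(1,2)] expw_sum_meas expw_bound[OF l(3,4)] expw_diff_bound[OF l]])
  also have "\<dots> \<le> exp (b X * L) * (b X * \<bar>l - m\<bar>) * ((b X * M0) * (b X * M0))"
    using n b_nonneg[of X] M_nonneg by (intro mult_left_mono mult_mono) auto
  finally show ?thesis by (simp add: power2_eq_square)
qed

lemma dual_diff_arg:
  assumes l: "0 \<le> l" "l \<le> L" and u: "size_density u" "(LBINT x. u x) \<le> M0"
    and v: "size_density v" "(LBINT x. v x) \<le> M0"
  shows "\<bar>dual X \<sigma> l u - dual X \<sigma> l v\<bar> \<le>
    exp (b X * L) * (2 * (b X)\<^sup>2 * M0 * (LBINT x. indicator {..real X} x * \<bar>u x - v x\<bar>))"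
proof -
  note a = act_bound[OF u(1), of X] and a' = act_bound[OF v(1), of X]
  have n: "(LBINT x. \<bar>act X u x\<bar>) \<le> b X * M0" "(LBINT x. \<bar>act X v x\<bar>) \<le> b X * M0"
    by (rule order_trans[OF a(2) mult_left_mono[OF u(2) b_nonneg]]
      order_trans[OF a'(2) mult_left_mono[OF v(2) b_nonneg]])+
  let ?d = "LBINT x. \<bar>act X u x - act X v x\<bar>" and ?D = "LBINT x. indicator {..real X} x * \<bar>u x - v x\<bar>"
  have "\<bar>dual X \<sigma> l u - dual X \<sigma> l v\<bar> \<le> exp (b X * L) *
     (((LBINT x. \<bar>act X u x\<bar>) + (LBINT x. \<bar>act X v x\<bar>)) * ?d)"
    unfolding dual_def
    by (rule pairing_diff_bound[OF size_densityD(1)[OF a(1)] size_densityD(1)[OF a'(1)]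
        expw_sum_meas expw_bound[OF l]])
  also have "\<dots> \<le> exp (b X * L) * ((b X * M0 + b X * M0) * (b X * ?D))"
    using n b_nonneg[of X] M_nonneg act_diff_bound[OF u(1) v(1), of X]
    by (intro mult_left_mono mult_mono add_mono) auto
  finally show ?thesis by (simp add: power2_eq_square algebra_simps)
qed

text \<open>
  One step changes the weighted integral by the weighted gain and two errors of second order in \<open>h\<close>: with
  \<open>z = h r R\<close>, the factor \<open>exp z * (1 - z)\<close> differs from \<open>1\<close> by at most \<open>z\<^sup>2\<close>, and the gain carries the weight of
  the end of the step rather than that of its beginning.
\<close>

lemma dual_step:
  assumes X: "X \<le> n" and L: "loss n (Suc k) \<le> L"
  shows "\<bar>(LBINT x. expw \<sigma> (loss n (Suc k)) x * euler n (Suc k) x)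
      - (LBINT x. expw \<sigma> (loss n k) x * euler n k x)
      - h n / 2 * dual X \<sigma> (loss n k) (euler n k)\<bar>
    \<le> exp (b X * L) * h n * ((b X)\<^sup>2 * M0 * (h n * (R n k)\<^sup>2) + (b X)^3 * M0\<^sup>2 / 2 * (h n * R n k))"
proof -
  let ?l = "loss n k" and ?l' = "loss n (Suc k)" and ?e = "euler n k" and ?E = "exp (b X * L)"
  have l': "?l' = ?l + h n * R n k" by (simp add: loss_def algebra_simps)
  have hR: "0 \<le> h n * R n k" using h_pos[of n] R_nonneg[of n k] by simp
  have l: "0 \<le> ?l" "?l \<le> L" "0 \<le> ?l'"
    using L l' hR loss_diff(1)[of 0 k n] by (auto simp: loss_def)
  have hn: "0 \<le> h n" using h_pos[of n] by simp
  note ed = size_densityD[OF euler_density[of n k]]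
  have gg: "(\<lambda>x. rtrunc n x * euler n k x) = g n k" by (auto simp: g_def)
  have E0: "0 \<le> ?E" by simp
  \<comment> \<open>\<open>T1\<close> is the error of the exponential factor, \<open>T2\<close> below that of the weight in the gain term.\<close>
  define T1 where "T1 = (LBINT x. expw \<sigma> ?l' x * (1 - h n * R n k * rtrunc n x) * ?e x - expw \<sigma> ?l x * ?e x)"
  have bd: "\<bar>expw \<sigma> ?l' x * (1 - h n * R n k * rtrunc n x) - expw \<sigma> ?l x\<bar> \<le> ?E * (b X * (h n * R n k))\<^sup>2" for x
  proof (cases "x > real X")
    case False
    define z where "z = h n * R n k * rtrunc n x"
    have rt: "rtrunc n x = r x" using False X by (simp add: rtrunc_def)
    have z0: "0 \<le> z" unfolding z_def using hR rtrunc_bounds[of n x] by simp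
    \<comment> \<open>The global bound \<open>b n\<close> gives \<open>z \<le> 1\<close>; the local bound \<open>b X\<close> gives estimates uniform in \<open>n\<close>.\<close>
    have "z \<le> h n * (b n * M0) * b n"
      unfolding z_def using hR rtrunc_bounds[of n x] h_pos[of n] R_bound[of n k] R_nonneg[of n k] M_nonneg b_nonneg[of n]
      by (intro mult_mono) auto
    then have z1: "z \<le> 1" using h_small(3)[of n] by (simp add: algebra_simps)
    have zb: "z \<le> b X * (h n * R n k)"
      unfolding z_def rt using r_bound[of x X] False hR by (simp add: mult.commute[of "b X"] mult_left_mono)
    have "expw \<sigma> ?l' x * (1 - h n * R n k * rtrunc n x) - expw \<sigma> ?l x = expw \<sigma> ?l x * (exp z * (1 - z) - 1)"
      unfolding expw_def l' by (simp add: z_def rt algebra_simps exp_add)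
    also have "\<bar>\<dots>\<bar> \<le> ?E * z\<^sup>2"
      unfolding abs_mult using l z0 z1 by (intro mult_mono expw_bound exp_times_one_minus) auto
    also have "\<dots> \<le> ?E * (b X * (h n * R n k))\<^sup>2" using zb z0 by (intro mult_left_mono power_mono) auto
    finally show ?thesis .
  qed (simp add: expw_def \<sigma>0)
  have i1: "integrable lborel (\<lambda>x. expw \<sigma> ?l x * ?e x)" and i2: "integrable lborel (\<lambda>x. expw \<sigma> ?l' x * ?e x)"
    by (rule integrable_bounded_mult(1)[OF ed(1) _ expw_bound[of _ L]]; use l L in simp)+
  have i3: "integrable lborel (\<lambda>x. expw \<sigma> ?l' x * (1 - h n * R n k * rtrunc n x) * ?e x)"
  proof -
    have "integrable lborel (\<lambda>x. expw \<sigma> ?l' x * g n k x)"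
      by (rule integrable_bounded_mult(1)[OF size_densityD(1)[OF g_density] _ expw_bound[of _ L]]) (use l L in auto)
    then have "integrable lborel (\<lambda>x. expw \<sigma> ?l' x * ?e x - h n * R n k * (expw \<sigma> ?l' x * g n k x))" using i2 by simp
    moreover have "expw \<sigma> ?l' x * ?e x - h n * R n k * (expw \<sigma> ?l' x * g n k x) =
       expw \<sigma> ?l' x * (1 - h n * R n k * rtrunc n x) * ?e x" for x by (simp add: g_def algebra_simps)
    ultimately show ?thesis by simp
  qed
  have T1_eq: "T1 = (LBINT x. (expw \<sigma> ?l' x * (1 - h n * R n k * rtrunc n x) - expw \<sigma> ?l x) * ?e x)"
    unfolding T1_def by (simp add: left_diff_distrib)
  have "\<bar>T1\<bar> \<le> ?E * (b X * (h n * R n k))\<^sup>2 * (LBINT x. \<bar>?e x\<bar>)"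
    unfolding T1_eq by (rule integrable_bounded_mult(2)[OF ed(1) _ bd]) simp
  also have "\<dots> \<le> ?E * (b X * (h n * R n k))\<^sup>2 * M0"
    using euler_mass[of n k] ed(3) by (intro mult_left_mono) auto
  finally have T1: "\<bar>T1\<bar> \<le> ?E * (b X * (h n * R n k))\<^sup>2 * M0" .
  have T2: "\<bar>dual X \<sigma> ?l' ?e - dual X \<sigma> ?l ?e\<bar> \<le> ?E * (b X * (h n * R n k)) * (b X * M0)\<^sup>2"
    using dual_diff_time[of ?l' L ?l ?e] l L euler_density euler_mass hR l' by simp
  have z: "expw \<sigma> ?l' x = 0" if "x > real X" for x using \<sigma>0[OF that] by (simp add: expw_def)
  note w = coag_step_weak_split(2)[OF euler_density[of n k] rtrunc_meas[of n] rtrunc_bounds hn expw_meas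
      expw_bound[OF l(3) L], unfolded gg R_def[symmetric]]
  have "(LBINT x. expw \<sigma> ?l' x * euler n (Suc k) x) =
    (LBINT x. expw \<sigma> ?l' x * (1 - h n * R n k * rtrunc n x) * ?e x) + h n / 2 * dual X \<sigma> ?l' ?e"
    using w pairing_restrict[of X n "expw \<sigma> ?l'" k] X z unfolding dual_def euler.simps by simp
  then have eq: "(LBINT x. expw \<sigma> ?l' x * euler n (Suc k) x)
      - (LBINT x. expw \<sigma> ?l x * ?e x) - h n / 2 * dual X \<sigma> ?l ?e
    = T1 + h n / 2 * (dual X \<sigma> ?l' ?e - dual X \<sigma> ?l ?e)"
    unfolding T1_def using i1 i3 by (simp add: right_diff_distrib)
  have "\<bar>T1 + h n / 2 * (dual X \<sigma> ?l' ?e - dual X \<sigma> ?l ?e)\<bar> \<le> \<bar>T1\<bar> + h n / 2 * \<bar>dual X \<sigma> ?l' ?e - dual X \<sigma> ?l ?e\<bar>"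
    using abs_triangle_ineq[of T1 "h n / 2 * (dual X \<sigma> ?l' ?e - dual X \<sigma> ?l ?e)"] hn by (simp add: abs_mult)
  also have "\<dots> \<le> ?E * (b X * (h n * R n k))\<^sup>2 * M0 + h n / 2 * (?E * (b X * (h n * R n k)) * (b X * M0)\<^sup>2)"
    using T1 T2 hn by (intro add_mono mult_left_mono) auto
  also have "\<dots> = ?E * h n * ((b X)\<^sup>2 * M0 * (h n * (R n k)\<^sup>2) + (b X)^3 * M0\<^sup>2 / 2 * (h n * R n k))"
    by (simp add: power2_eq_square power3_eq_cube algebra_simps)
  finally show ?thesis unfolding eq .
qed

text \<open>
  The errors are summed with \<open>h \<Sum> R\<^sup>2 \<le> 2 M\<^sub>0\<close> and \<open>h \<Sum> R \<le> L\<close>, which leaves one factor \<open>h\<close>.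
\<close>

lemma dual_sum:
  assumes X: "X \<le> n" and L: "loss n N \<le> L"
  shows "\<bar>(LBINT x. expw \<sigma> (loss n N) x * euler n N x) - (LBINT x. \<sigma> x * f0 x)
      - h n / 2 * (\<Sum>k<N. dual X \<sigma> (loss n k) (euler n k))\<bar>
    \<le> exp (b X * L) * h n * (2 * (b X)\<^sup>2 * M0\<^sup>2 + (b X)^3 * M0\<^sup>2 / 2 * L)"
proof -
  have "\<bar>(LBINT x. expw \<sigma> (loss n N) x * euler n N x) - (LBINT x. \<sigma> x * f0 x)
      - h n / 2 * (\<Sum>k<N. dual X \<sigma> (loss n k) (euler n k))\<bar>
    \<le> exp (b X * L) * h n * ((b X)\<^sup>2 * M0 * (h n * (\<Sum>k<N. (R n k)\<^sup>2)) + (b X)^3 * M0\<^sup>2 / 2 * loss n N)"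
    using L
  proof (induction N)
    case 0
    then show ?case by (simp add: expw_def loss_def)
  next
    case (Suc N)
    have "loss n N \<le> loss n (Suc N)" using loss_diff(1)[of N "Suc N" n] by simp
    then have L': "loss n N \<le> L" using Suc.prems by linarith
    have e: "exp (b X * L) * h n * ((b X)\<^sup>2 * M0 * (h n * (\<Sum>k<Suc N. (R n k)\<^sup>2)) + (b X)^3 * M0\<^sup>2 / 2 * loss n (Suc N))
      = exp (b X * L) * h n * ((b X)\<^sup>2 * M0 * (h n * (\<Sum>k<N. (R n k)\<^sup>2)) + (b X)^3 * M0\<^sup>2 / 2 * loss n N)
       + exp (b X * L) * h n * ((b X)\<^sup>2 * M0 * (h n * (R n N)\<^sup>2) + (b X)^3 * M0\<^sup>2 / 2 * (h n * R n N))"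
      by (simp add: loss_def algebra_simps)
    have e2: "h n / 2 * (\<Sum>k<Suc N. dual X \<sigma> (loss n k) (euler n k)) =
      h n / 2 * (\<Sum>k<N. dual X \<sigma> (loss n k) (euler n k)) + h n / 2 * dual X \<sigma> (loss n N) (euler n N)"
      by (simp add: algebra_simps)
    show ?case
      unfolding e e2 using Suc.IH[OF L'] dual_step[OF X Suc.prems] by linarith
  qed
  also have "\<dots> \<le> exp (b X * L) * h n * ((b X)\<^sup>2 * M0 * (2 * M0) + (b X)^3 * M0\<^sup>2 / 2 * L)"
    using h_pos[of n] sum_R[of n N] L b_nonneg[of X] M_nonneg
    by (intro mult_left_mono add_mono) auto
  also have "(b X)\<^sup>2 * M0 * (2 * M0) = 2 * (b X)\<^sup>2 * M0\<^sup>2" by (simp add: power2_eq_square)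
  finally show ?thesis .
qed

text \<open>
  Up to an error of order \<open>h\<close>, the Euler approximation satisfies a mild equation whose coefficients depend
  on the approximation index only through \<open>A n\<close>. The number \<open>L\<close> bounds \<open>A n\<close> on \<open>[0,T]\<close> for all \<open>n\<close>.
\<close>

lemma dual_mild:
  assumes X: "X \<le> n" and t: "0 \<le> t" "t \<le> T" and L_def: "L = sqrt (2 * M0 * T)"
  shows "set_integrable lborel {0..t} (\<lambda>s. dual X \<sigma> (A n s) (F n s))"
   and "\<bar>(LBINT x. expw \<sigma> (A n t) x * F n t x) - (LBINT x. \<sigma> x * f0 x)
     - 1/2 * (LBINT s:{0..t}. dual X \<sigma> (A n s) (F n s))\<bar>
    \<le> h n * (exp (b X * L) * (2 * (b X)\<^sup>2 * M0\<^sup>2 + (b X)^3 * M0\<^sup>2 / 2 * L + (b X)\<^sup>2 * M0\<^sup>2 / 2))"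
proof -
  let ?d = "\<lambda>k. dual X \<sigma> (loss n k) (euler n k)"
  define k where "k = step_idx (h n) t"
  have eq: "(\<lambda>s. dual X \<sigma> (A n s) (F n s)) = (\<lambda>s. ?d (step_idx (h n) s))" by (simp add: A_def F_def)
  note I = integral_step_idx[OF h_pos[of n] t(1), of ?d, folded eq k_def]
  show "set_integrable lborel {0..t} (\<lambda>s. dual X \<sigma> (A n s) (F n s))" by (rule I(1))
  note kb = step_idx_bounds[OF h_pos[of n] t(1), folded k_def]
  have lb: "0 \<le> loss n k" "loss n k \<le> L"
    using loss_bound[of n k T] kb t by (auto simp: mult.commute L_def)
  have "\<bar>?d k\<bar> \<le> exp (b X * L) * (b X * M0)\<^sup>2"
    by (intro dual_bound lb euler_density euler_mass)
  moreover have "\<bar>t - real k * h n\<bar> \<le> h n" using kb by (simp add: algebra_simps)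
  ultimately have rem: "\<bar>(t - real k * h n) * ?d k\<bar> \<le> h n * (exp (b X * L) * (b X * M0)\<^sup>2)"
    unfolding abs_mult using h_pos[of n] by (intro mult_mono) auto
  have s: "\<bar>(LBINT x. expw \<sigma> (A n t) x * F n t x) - (LBINT x. \<sigma> x * f0 x)
     - h n / 2 * (\<Sum>j<k. ?d j)\<bar> \<le> exp (b X * L) * h n * (2 * (b X)\<^sup>2 * M0\<^sup>2 + (b X)^3 * M0\<^sup>2 / 2 * L)"
    using dual_sum[OF X lb(2)] by (simp add: A_def F_def k_def)
  show "\<bar>(LBINT x. expw \<sigma> (A n t) x * F n t x) - (LBINT x. \<sigma> x * f0 x)
     - 1/2 * (LBINT s:{0..t}. dual X \<sigma> (A n s) (F n s))\<bar>
    \<le> h n * (exp (b X * L) * (2 * (b X)\<^sup>2 * M0\<^sup>2 + (b X)^3 * M0\<^sup>2 / 2 * L + (b X)\<^sup>2 * M0\<^sup>2 / 2))"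
  proof -
    have e1: "h n * (exp (b X * L) * (2 * (b X)\<^sup>2 * M0\<^sup>2 + (b X)^3 * M0\<^sup>2 / 2 * L + (b X)\<^sup>2 * M0\<^sup>2 / 2))
      = exp (b X * L) * h n * (2 * (b X)\<^sup>2 * M0\<^sup>2 + (b X)^3 * M0\<^sup>2 / 2 * L) + h n * (exp (b X * L) * (b X * M0)\<^sup>2) / 2"
      by (simp add: power_mult_distrib algebra_simps)
    have e2: "1/2 * (h n * (\<Sum>j<k. ?d j) + (t - real k * h n) * ?d k)
      = h n / 2 * (\<Sum>j<k. ?d j) + ((t - real k * h n) * ?d k) / 2"
      by (simp add: add_divide_distrib)
    show ?thesis unfolding I(2) e1 e2 using s rem by linarith
  qed
qed

end

definition near :: "nat \<Rightarrow> (real \<Rightarrow> real) \<Rightarrow> (real \<Rightarrow> real) \<Rightarrow> real" where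
  "near X u v = (LBINT x. indicator {..real X} x * \<bar>u x - v x\<bar>)"

lemma near_integrable:
  assumes "size_density u" "size_density v"
  shows "integrable lborel (\<lambda>x. indicator {..real X} x * \<bar>u x - v x\<bar>)"
  using size_densityD[OF assms(1)] size_densityD[OF assms(2)]
  by (intro integrable_bounded_mult(1)[where C=1]) (auto simp: indicator_def)

lemma near_bounds:
  assumes u: "size_density u" and v: "size_density v"
  shows "0 \<le> near X u v" "near X u v \<le> (LBINT x. u x) + (LBINT x. v x)"
proof -
  note ud = size_densityD[OF u] and vd = size_densityD[OF v]
  show "0 \<le> near X u v" unfolding near_def by (intro integral_nonneg_AE) auto
  have "near X u v \<le> (LBINT x. u x + v x)"
    unfolding near_def
  proof (rule integral_mono[OF near_integrable[OF u v]])
    fix x show "indicator {..real X} x * \<bar>u x - v x\<bar> \<le> u x + v x"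
      using ud(3)[of x] vd(3)[of x] by (auto simp: indicator_def)
  qed (use ud vd in auto)
  then show "near X u v \<le> (LBINT x. u x) + (LBINT x. v x)" using ud vd by simp
qed

lemma set_integrable_near_F:
  "set_integrable lborel {0..t} (\<lambda>s. near X (F n s) (F m s))"
proof -
  have m: "(\<lambda>s. near X (F n s) (F m s)) \<in> borel_measurable borel"
  proof -
    have "(\<lambda>s. near X (euler n (step_idx (h n) s)) (euler m j)) \<in> borel_measurable borel" for j
      by (rule measurable_compose[OF measurable_step_idx]) simp
    from measurable_compose_countable[OF this measurable_step_idx]
    have "(\<lambda>s. near X (euler n (step_idx (h n) s)) (euler m (step_idx (h m) s))) \<in> borel_measurable borel" .
    then show ?thesis by (simp add: F_def)
  qed
  have "\<bar>near X (F n s) (F m s)\<bar> \<le> 2 * M0" for s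
    using near_bounds[OF F_density F_density, of X n s m s] F_mass[of n s] F_mass[of m s] by auto
  then show ?thesis
    unfolding set_integrable_def using m
    by (intro integrableI_bounded_set_indicator[where B="2 * M0"] AE_I2) (auto simp: emeasure_lborel_Icc_eq)
qed

text \<open>
  The two mild equations differ in the weights, by a multiple of \<open>\<alpha>\<close>, and in the densities inside the gain
  term, by a multiple of their distance up to \<open>X\<close>.
\<close>

lemma F_Cauchy_dual:
  assumes X: "X \<le> n" "X \<le> m" and \<alpha>: "\<And>s. 0 \<le> s \<Longrightarrow> s \<le> T \<Longrightarrow> \<bar>A n s - A m s\<bar> \<le> \<alpha>"
    and t: "0 \<le> t" "t \<le> T" and L: "L = sqrt (2 * M0 * T)"
    and \<sigma>: "\<sigma> \<in> borel_measurable borel" "\<And>x. \<bar>\<sigma> x\<bar> \<le> 1" "\<And>x. x > real X \<Longrightarrow> \<sigma> x = 0"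
  shows "(LBINT x. expw \<sigma> (A n t) x * F n t x) - (LBINT x. expw \<sigma> (A m t) x * F m t x)
    \<le> (h n + h m) * (exp (b X * L) * (2 * (b X)\<^sup>2 * M0\<^sup>2 + (b X)^3 * M0\<^sup>2 / 2 * L + (b X)\<^sup>2 * M0\<^sup>2 / 2))
      + 1/2 * (LBINT s:{0..t}. exp (b X * L) * (2 * (b X)\<^sup>2 * M0) * near X (F n s) (F m s)
         + exp (b X * L) * (b X * \<alpha>) * (b X * M0)\<^sup>2)"
proof -
  note mn = dual_mild[OF \<sigma> X(1) t L] and mm = dual_mild[OF \<sigma> X(2) t L]
  let ?E = "exp (b X * L)"
  let ?q = "\<lambda>s. ?E * (2 * (b X)\<^sup>2 * M0) * near X (F n s) (F m s) + ?E * (b X * \<alpha>) * (b X * M0)\<^sup>2"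
  have iq: "set_integrable lborel {0..t} ?q"
    using set_integrable_near_F[of t X n m]
    by (intro set_integral_add(1) set_integrable_mult_right) (auto simp: set_integrable_def emeasure_lborel_Icc_eq)
  have le: "dual X \<sigma> (A n s) (F n s) - dual X \<sigma> (A m s) (F m s) \<le> ?q s" if s: "s \<in> {0..t}" for s
  proof -
    have An: "0 \<le> A n s" "A n s \<le> L" and Am: "0 \<le> A m s" "A m s \<le> L"
      using A_bounds[of s T] s t by (auto simp: L)
    have 1: "\<bar>dual X \<sigma> (A n s) (F n s) - dual X \<sigma> (A n s) (F m s)\<bar> \<le> ?E * (2 * (b X)\<^sup>2 * M0 * near X (F n s) (F m s))"
      using dual_diff_arg[OF \<sigma> An F_density F_mass F_density F_mass] by (simp add: near_def)
    have "\<bar>dual X \<sigma> (A n s) (F m s) - dual X \<sigma> (A m s) (F m s)\<bar> \<le> ?E * (b X * \<bar>A n s - A m s\<bar>) * (b X * M0)\<^sup>2"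
      by (rule dual_diff_time[OF \<sigma> An Am F_density F_mass])
    also have "\<dots> \<le> ?E * (b X * \<alpha>) * (b X * M0)\<^sup>2"
      using \<alpha>[of s] s t b_nonneg[of X] by (intro mult_right_mono mult_left_mono) auto
    finally have 2: "\<bar>dual X \<sigma> (A n s) (F m s) - dual X \<sigma> (A m s) (F m s)\<bar> \<le> ?E * (b X * \<alpha>) * (b X * M0)\<^sup>2" .
    have "?E * (2 * (b X)\<^sup>2 * M0 * near X (F n s) (F m s)) = ?E * (2 * (b X)\<^sup>2 * M0) * near X (F n s) (F m s)" by simp
    then show ?thesis using 1 2 by linarith
  qed
  have "(LBINT s:{0..t}. dual X \<sigma> (A n s) (F n s)) - (LBINT s:{0..t}. dual X \<sigma> (A m s) (F m s))
     = (LBINT s:{0..t}. dual X \<sigma> (A n s) (F n s) - dual X \<sigma> (A m s) (F m s))"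
    using set_integral_diff(2)[OF mn(1) mm(1)] by simp
  also have "\<dots> \<le> (LBINT s:{0..t}. ?q s)"
    using le by (intro set_integral_mono set_integral_diff(1) mn(1) mm(1) iq) auto
  finally show ?thesis
    using mn(2) mm(2) unfolding distrib_right[of "h n" "h m"] by linarith
qed

text \<open>
  The previous lemma with the optimal \<open>\<sigma>\<close> bounds the distance of the weighted densities. Removing the
  weights costs another multiple of \<open>\<alpha>\<close>, and Gronwall's inequality closes the estimate.
\<close>

lemma F_Cauchy:
  fixes X :: nat and T :: real
  assumes T: "0 \<le> T"
  shows "\<exists>c\<ge>0. \<forall>n m \<alpha>. X \<le> n \<longrightarrow> X \<le> m \<longrightarrow> 0 \<le> \<alpha> \<longrightarrow> (\<forall>s\<in>{0..T}. \<bar>A n s - A m s\<bar> \<le> \<alpha>) \<longrightarrow>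
    (\<forall>t\<in>{0..T}. near X (F n t) (F m t) \<le> c * (h n + h m + \<alpha>))"
proof -
  define L where "L = sqrt (2 * M0 * T)"
  define E where "E = exp (b X * L)"
  define c1 where "c1 = E * (2 * (b X)\<^sup>2 * M0\<^sup>2 + (b X)^3 * M0\<^sup>2 / 2 * L + (b X)\<^sup>2 * M0\<^sup>2 / 2)"
  \<comment> \<open>The summand \<open>1\<close> only makes the Gronwall constant strictly positive.\<close>
  define c2 where "c2 = E * (b X)\<^sup>2 * M0 + 1"
  define c3 where "c3 = E * b X * (b X * M0)\<^sup>2 * T / 2 + b X * E * M0"
  have L0: "0 \<le> L" using T M_nonneg by (simp add: L_def)
  have E1: "1 \<le> E" using b_nonneg[of X] L0 by (simp add: E_def)
  have nn: "0 \<le> c1" "0 < c2" "0 \<le> c3"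
  proof -
    have "0 \<le> E * (b X)\<^sup>2 * M0" using E1 M_nonneg by simp
    then show "0 < c2" by (simp add: c2_def)
    show "0 \<le> c1" "0 \<le> c3"
      unfolding c1_def c3_def using E1 L0 b_nonneg[of X] M_nonneg T by simp_all
  qed
  define c where "c = 2 * (c1 + c3) * exp (2 * c2 * T)"
  have c0: "0 \<le> c" using nn by (simp add: c_def)
  have "near X (F n t) (F m t) \<le> c * (h n + h m + \<alpha>)"
    if X: "X \<le> n" "X \<le> m" and \<alpha>0: "0 \<le> \<alpha>" and \<alpha>: "\<forall>s\<in>{0..T}. \<bar>A n s - A m s\<bar> \<le> \<alpha>" and t: "t \<in> {0..T}"
    for n m \<alpha> t
  proof -
    define e where "e = (h n + h m) * c1 + \<alpha> * c3"
    have hh: "0 \<le> h n" "0 \<le> h m" using h_pos[of n] h_pos[of m] by auto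
    have e0: "0 \<le> e" using hh nn \<alpha>0 by (simp add: e_def)
    have ineq: "near X (F n t) (F m t) \<le> e + c2 * (LBINT s:{0..t}. near X (F n s) (F m s))"
      if t: "0 \<le> t" "t \<le> T" for t
    proof -
      have An: "0 \<le> A n t" "A n t \<le> L" and Am: "0 \<le> A m t" "A m t \<le> L"
        using A_bounds[OF t] by (auto simp: L_def)
      note nd[measurable] = size_densityD(2)[OF F_density[of n t]] and md[measurable] = size_densityD(2)[OF F_density[of m t]]
      define H where "H = (\<lambda>x. exp (r x * A n t) * F n t x - exp (r x * A m t) * F m t x)"
      \<comment> \<open>With this \<open>\<sigma>\<close> the difference of the weighted integrals is the \<open>L\<^sup>1\<close> norm of \<open>H\<close> up to \<open>X\<close>.\<close>
      define \<sigma> where "\<sigma> = (\<lambda>x. indicator {..real X} x * sgn (H x))"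
      have Hm[measurable]: "H \<in> borel_measurable borel" unfolding H_def by measurable
      have \<sigma>: "\<sigma> \<in> borel_measurable borel" "\<And>x. \<bar>\<sigma> x\<bar> \<le> 1" "\<And>x. x > real X \<Longrightarrow> \<sigma> x = 0"
      proof -
        show "\<sigma> \<in> borel_measurable borel" unfolding \<sigma>_def by measurable
      qed (auto simp: \<sigma>_def indicator_def sgn_if)
      have i1: "integrable lborel (\<lambda>x. expw \<sigma> (A n t) x * F n t x)"
        by (rule integrable_bounded_mult(1)[OF size_densityD(1)[OF F_density] _ expw_bound[OF \<sigma> An]])
           (use expw_meas[OF \<sigma>] in simp)
      have i2: "integrable lborel (\<lambda>x. expw \<sigma> (A m t) x * F m t x)"
        by (rule integrable_bounded_mult(1)[OF size_densityD(1)[OF F_density] _ expw_bound[OF \<sigma> Am]])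
           (use expw_meas[OF \<sigma>] in simp)
      have Heq: "expw \<sigma> (A n t) x * F n t x - expw \<sigma> (A m t) x * F m t x = indicator {..real X} x * \<bar>H x\<bar>" for x
        by (simp add: \<sigma>_def expw_def H_def[THEN fun_cong] right_diff_distrib[symmetric] mult.assoc abs_sgn)
      have iH: "integrable lborel (\<lambda>x. indicator {..real X} x * \<bar>H x\<bar>)"
        using Bochner_Integration.integrable_diff[OF i1 i2] by (simp only: Heq)
      have H_eq: "(LBINT x. indicator {..real X} x * \<bar>H x\<bar>) =
         (LBINT x. expw \<sigma> (A n t) x * F n t x) - (LBINT x. expw \<sigma> (A m t) x * F m t x)"
        using Bochner_Integration.integral_diff[OF i1 i2] by (simp only: Heq)
      let ?I = "LBINT s:{0..t}. near X (F n s) (F m s)"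
      have ic: "set_integrable lborel {0..t} (\<lambda>s. c::real)" for c
        by (auto simp: set_integrable_def emeasure_lborel_Icc_eq)
      have q: "(LBINT s:{0..t}. E * (2 * (b X)\<^sup>2 * M0) * near X (F n s) (F m s) + E * (b X * \<alpha>) * (b X * M0)\<^sup>2)
        = E * (2 * (b X)\<^sup>2 * M0) * ?I + t * (E * (b X * \<alpha>) * (b X * M0)\<^sup>2)"
        using t set_integrable_near_F[of t X n m] ic[of "E * (b X * \<alpha>) * (b X * M0)\<^sup>2"]
        by (subst set_integral_add(2)) (auto simp: set_lebesgue_integral_def measure_lborel_Icc)
      have H_le: "(LBINT x. indicator {..real X} x * \<bar>H x\<bar>) \<le>
        (h n + h m) * c1 + 1/2 * (E * (2 * (b X)\<^sup>2 * M0) * ?I + t * (E * (b X * \<alpha>) * (b X * M0)\<^sup>2))"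
        unfolding H_eq q[symmetric] unfolding c1_def E_def
        using F_Cauchy_dual[OF X _ t L_def \<sigma>, of \<alpha>] \<alpha> by auto
      have pt: "indicator {..real X} x * \<bar>F n t x - F m t x\<bar> \<le> indicator {..real X} x * \<bar>H x\<bar> + b X * \<alpha> * E * F m t x" for x
      proof (cases "x \<le> real X")
        case True
        let ?p = "exp (- (r x * A n t))" and ?q = "exp (- (r x * A m t))"
        let ?u = "exp (r x * A n t) * F n t x" and ?v = "exp (r x * A m t) * F m t x"
        have rx: "0 \<le> r x" "r x \<le> b X" using r_nonneg r_bound True by auto
        have Fm: "0 \<le> F m t x" using size_densityD(3)[OF F_density] .
        have uv: "?p * ?u = F n t x" "?q * ?v = F m t x" by (simp_all add: exp_minus)
        have "?p * H x = ?p * ?u - ?p * ?v" by (simp only: H_def right_diff_distrib)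
        then have "F n t x - F m t x = ?p * H x + (?p - ?q) * ?v"
          unfolding left_diff_distrib uv by simp
        then have "\<bar>F n t x - F m t x\<bar> \<le> \<bar>?p * H x\<bar> + \<bar>(?p - ?q) * ?v\<bar>" by simp
        moreover have "\<bar>?p * H x\<bar> \<le> 1 * \<bar>H x\<bar>"
          unfolding abs_mult using rx An by (intro mult_right_mono) auto
        moreover have "\<bar>(?p - ?q) * ?v\<bar> \<le> (b X * \<alpha>) * (E * F m t x)"
          unfolding abs_mult
        proof (rule mult_mono)
          have "\<bar>?p - ?q\<bar> \<le> exp 0 * \<bar>- (r x * A n t) - - (r x * A m t)\<bar>"
            using rx An Am by (intro exp_diff_le) auto
          also have "\<dots> = r x * \<bar>A n t - A m t\<bar>"
            using rx by (simp add: abs_mult right_diff_distrib[symmetric] abs_minus_commute)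
          also have "\<dots> \<le> b X * \<alpha>" using rx \<alpha> t by (intro mult_mono) auto
          finally show "\<bar>?p - ?q\<bar> \<le> b X * \<alpha>" .
          have "r x * A m t \<le> b X * L" using rx Am b_nonneg[of X] by (intro mult_mono) auto
          then show "\<bar>exp (r x * A m t)\<bar> * \<bar>F m t x\<bar> \<le> E * F m t x"
            using Fm by (auto simp: E_def intro!: mult_right_mono)
        qed (use b_nonneg[of X] \<alpha>0 in auto)
        ultimately show ?thesis using True by (simp add: algebra_simps)
      next
        case False
        then show ?thesis using b_nonneg[of X] \<alpha>0 E1 size_densityD(3)[OF F_density, of m t x] by simp
      qed
      have "near X (F n t) (F m t) \<le> (LBINT x. indicator {..real X} x * \<bar>H x\<bar> + b X * \<alpha> * E * F m t x)"
        unfolding near_def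
        by (rule integral_mono[OF near_integrable[OF F_density F_density] _ pt])
           (use iH size_densityD(1)[OF F_density[of m t]] in auto)
      also have "\<dots> = (LBINT x. indicator {..real X} x * \<bar>H x\<bar>) + b X * \<alpha> * E * (LBINT x. F m t x)"
        using iH size_densityD(1)[OF F_density[of m t]] by simp
      also have "\<dots> \<le> ((h n + h m) * c1 + 1/2 * (E * (2 * (b X)\<^sup>2 * M0) * ?I + t * (E * (b X * \<alpha>) * (b X * M0)\<^sup>2)))
         + b X * \<alpha> * E * M0"
        using H_le F_mass[of m t] b_nonneg[of X] \<alpha>0 E1 by (intro add_mono mult_left_mono) auto
      also have "\<dots> \<le> ((h n + h m) * c1 + 1/2 * (E * (2 * (b X)\<^sup>2 * M0) * ?I + T * (E * (b X * \<alpha>) * (b X * M0)\<^sup>2)))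
         + b X * \<alpha> * E * M0"
        using t E1 b_nonneg[of X] \<alpha>0
        by (intro add_mono mult_left_mono mult_right_mono order_refl) auto
      also have "\<dots> = e + E * (b X)\<^sup>2 * M0 * ?I" by (simp add: e_def c3_def algebra_simps)
      also have "\<dots> \<le> e + c2 * ?I"
      proof -
        have "0 \<le> ?I" using near_bounds(1)[OF F_density F_density]
          by (auto simp: set_lebesgue_integral_def intro!: integral_nonneg_AE)
        then show ?thesis by (simp add: c2_def algebra_simps)
      qed
      finally show ?thesis .
    qed
    have "near X (F n t) (F m t) \<le> 2 * e * exp (2 * c2 * t)"
    proof (rule Gronwall[where T=T and M="2 * M0"])
      show "near X (F n t) (F m t) \<le> 2 * M0" for t
        using near_bounds(2)[OF F_density F_density, of X n t m t] F_mass[of n t] F_mass[of m t] by linarith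
    qed (use ineq set_integrable_near_F nn e0 t in auto)
    also have "\<dots> \<le> 2 * e * exp (2 * c2 * T)"
      using t nn e0 by (intro mult_left_mono) auto
    also have "\<dots> \<le> 2 * ((c1 + c3) * (h n + h m + \<alpha>)) * exp (2 * c2 * T)"
    proof -
      have "e \<le> (c1 + c3) * (h n + h m + \<alpha>)"
        unfolding e_def using nn hh \<alpha>0 by (simp add: algebra_simps)
      then show ?thesis by (intro mult_right_mono mult_left_mono) auto
    qed
    also have "\<dots> = c * (h n + h m + \<alpha>)" by (simp add: c_def)
    finally show ?thesis .
  qed
  then show ?thesis using c0 by blast
qed

end

section \<open>The limit of the Euler approximations\<close>

context coagulation_data
begin

lemma A_increment:
  assumes "0 \<le> s" "s \<le> t"
  shows "(A n t - A n s)\<^sup>2 \<le> 2 * M0 * (t - s + h n)"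
proof -
  let ?j = "step_idx (h n) s" and ?k = "step_idx (h n) t"
  have jk: "?j \<le> ?k" using step_idx_mono[OF h_pos assms(2)] .
  have "h n * real (?k - ?j) = real ?k * h n - real ?j * h n"
    using jk by (simp add: of_nat_diff algebra_simps)
  also have "\<dots> \<le> t - s + h n"
    using step_idx_bounds[OF h_pos[of n], of t] step_idx_bounds[OF h_pos[of n], of s] assms
    by (simp add: algebra_simps)
  finally have "2 * M0 * (h n * real (?k - ?j)) \<le> 2 * M0 * (t - s + h n)"
    using M_nonneg by (intro mult_left_mono) auto
  then show ?thesis using loss_diff(2)[OF jk, of n] by (simp add: A_def)
qed

text \<open>
  The functions \<open>A n\<close> are bounded at each time but not uniformly in time, so a diagonal argument over the
  rational times is applied to \<open>A n q\<close> divided by a bound for it.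
\<close>

lemma A_convergent_subsequence:
  obtains \<sigma> :: "nat \<Rightarrow> nat" where "strict_mono \<sigma>"
    "\<And>q. q \<in> \<rat> \<Longrightarrow> 0 \<le> q \<Longrightarrow> Cauchy (\<lambda>n. A (\<sigma> n) q)"
proof -
  let ?w = "\<lambda>q. 1 + sqrt (2 * M0 * q)"
  have w: "1 \<le> ?w q" if "0 \<le> q" for q using that M_nonneg by simp
  have "countable (\<rat> \<inter> {0::real..})" by (simp add: countable_rat)
  moreover have "norm (A n q / ?w q) \<le> 1" if "q \<in> \<rat> \<inter> {0..}" for n q
    using that A_bounds[of q q n] w[of q] by auto
  ultimately obtain \<sigma> :: "nat \<Rightarrow> nat" where \<sigma>: "strict_mono \<sigma>"
    "\<And>q. q \<in> \<rat> \<inter> {0..} \<Longrightarrow> \<exists>l. (\<lambda>n. A (\<sigma> n) q / ?w q) \<longlonglongrightarrow> l"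
    by (rule function_convergent_subsequence[where f="\<lambda>n q. A n q / ?w q"]) blast+
  show ?thesis
  proof (rule that[OF \<sigma>(1)])
    fix q :: real assume q: "q \<in> \<rat>" "0 \<le> q"
    then obtain l where "(\<lambda>n. A (\<sigma> n) q / ?w q) \<longlonglongrightarrow> l" using \<sigma>(2)[of q] by auto
    then have "(\<lambda>n. A (\<sigma> n) q / ?w q * ?w q) \<longlonglongrightarrow> l * ?w q" by (intro tendsto_intros)
    moreover have "A (\<sigma> n) q / ?w q * ?w q = A (\<sigma> n) q" for n
    proof -
      have "?w q \<noteq> 0" using w[OF q(2)] by linarith
      then show ?thesis unfolding times_divide_eq_left by (rule nonzero_mult_div_cancel_right)
    qed
    ultimately have "convergent (\<lambda>n. A (\<sigma> n) q)" by (auto simp: convergent_def)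
    then show "Cauchy (\<lambda>n. A (\<sigma> n) q)" by (rule convergent_Cauchy)
  qed
qed

lemma h_eventually_small:
  assumes "0 < e" shows "\<exists>N. \<forall>n\<ge>N. h n \<le> e"
proof -
  obtain N where N: "inverse (real (Suc N)) < e" using reals_Archimedean[OF assms] by blast
  have "h n \<le> e" if "n \<ge> N" for n
  proof -
    have "h n \<le> 1 / (real n + 1)" by (rule h_small(1))
    also have "\<dots> \<le> 1 / (real N + 1)" using that by (intro divide_left_mono) auto
    also have "\<dots> < e" using N by (simp add: inverse_eq_divide add.commute)
    finally show ?thesis by simp
  qed
  then show ?thesis by blast
qed

text \<open>
  By the Hoelder estimate, convergence on a fine enough finite grid of rational times controls all of \<open>[0,T]\<close>.
\<close>

lemma A_uniformly_Cauchy: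
  assumes \<sigma>: "strict_mono \<sigma>" and C: "\<And>q. q \<in> \<rat> \<Longrightarrow> 0 \<le> q \<Longrightarrow> Cauchy (\<lambda>n. A (\<sigma> n) q)"
    and T: "0 \<le> T" and e: "0 < e"
  shows "\<exists>N. \<forall>n\<ge>N. \<forall>m\<ge>N. \<forall>s\<in>{0..T}. \<bar>A (\<sigma> n) s - A (\<sigma> m) s\<bar> \<le> e"
proof -
  \<comment> \<open>Grid width and step size at most \<open>\<eta>\<close> keep the increments of \<open>A\<close> over one cell at most \<open>e/3\<close>.\<close>
  define \<eta> where "\<eta> = (e/3)\<^sup>2 / (4 * (M0 + 1))"
  have \<eta>: "0 < \<eta>" using e M_nonneg by (simp add: \<eta>_def)
  have \<eta>2: "2 * M0 * (\<eta> + \<eta>) \<le> (e/3)\<^sup>2"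
  proof -
    have "2 * M0 * (\<eta> + \<eta>) = (e/3)\<^sup>2 * (M0 / (M0 + 1))" by (simp add: \<eta>_def divide_simps)
    also have "\<dots> \<le> (e/3)\<^sup>2 * 1" using M_nonneg by (intro mult_left_mono) auto
    finally show ?thesis by simp
  qed
  obtain p0 where "inverse (real (Suc p0)) < \<eta>" using reals_Archimedean[OF \<eta>] by blast
  then obtain d :: real where d: "0 < d" "d \<le> \<eta>" "d \<in> \<rat>"
    by (meson Rats_inverse Rats_of_nat inverse_positive_iff_positive less_imp_le of_nat_0_less_iff zero_less_Suc)
  obtain N0 where N0: "\<And>n. n \<ge> N0 \<Longrightarrow> h n \<le> \<eta>" using h_eventually_small[OF \<eta>] by blast
  have "\<exists>N. \<forall>m\<ge>N. \<forall>n\<ge>N. dist (A (\<sigma> m) (real j * d)) (A (\<sigma> n) (real j * d)) < e/3" for j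
    by (rule metric_CauchyD[OF C]) (use d e in auto)
  then obtain Nf where Nf: "\<And>j m n. m \<ge> Nf j \<Longrightarrow> n \<ge> Nf j \<Longrightarrow>
      dist (A (\<sigma> m) (real j * d)) (A (\<sigma> n) (real j * d)) < e/3" by metis
  define J where "J = step_idx d T"
  define N where "N = N0 + (\<Sum>j\<le>J. Nf j)"
  have "\<bar>A (\<sigma> n) s - A (\<sigma> m) s\<bar> \<le> e" if nm: "n \<ge> N" "m \<ge> N" and s: "s \<in> {0..T}" for n m s
  proof -
    define j where "j = step_idx d s"
    have "j \<le> J" unfolding j_def J_def using s d by (intro step_idx_mono) auto
    then have "Nf j \<le> N" using member_le_sum[of j "{..J}" Nf] by (auto simp: N_def)
    then have mid: "\<bar>A (\<sigma> n) (real j * d) - A (\<sigma> m) (real j * d)\<bar> < e/3"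
      using Nf[of j n m] nm by (auto simp: dist_real_def)
    have q: "0 \<le> real j * d" "real j * d \<le> s" "s - real j * d \<le> \<eta>"
      using step_idx_bounds[OF d(1), of s] s d by (auto simp: j_def algebra_simps)
    have near: "\<bar>A (\<sigma> k) s - A (\<sigma> k) (real j * d)\<bar> \<le> e/3" if k: "k \<ge> N" for k
    proof -
      have "N0 \<le> \<sigma> k" using seq_suble[OF \<sigma>, of k] k by (auto simp: N_def)
      then have hk: "h (\<sigma> k) \<le> \<eta>" by (rule N0)
      have "(A (\<sigma> k) s - A (\<sigma> k) (real j * d))\<^sup>2 \<le> 2 * M0 * (s - real j * d + h (\<sigma> k))"
        by (rule A_increment[OF q(1,2)])
      also have "\<dots> \<le> 2 * M0 * (\<eta> + \<eta>)" using q hk M_nonneg by (intro mult_left_mono add_mono) auto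
      also have "\<dots> \<le> (e/3)\<^sup>2" by (rule \<eta>2)
      finally show ?thesis using e by (simp add: abs_le_square_iff[symmetric])
    qed
    show ?thesis using near[OF nm(1)] near[OF nm(2)] mid by linarith
  qed
  then show ?thesis by blast
qed

lemma L1_dist_near_tail:
  assumes u: "size_density u" and v: "size_density v"
  shows "(LBINT x. \<bar>u x - v x\<bar>) \<le> near X u v
    + (LBINT x. indicator {real X<..} x * u x) + (LBINT x. indicator {real X<..} x * v x)"
proof -
  note ud = size_densityD[OF u] and vd = size_densityD[OF v]
  have iu: "integrable lborel (\<lambda>x. indicator {real X<..} x * u x)"
    and iv: "integrable lborel (\<lambda>x. indicator {real X<..} x * v x)"
    using ud vd by (auto intro!: integrable_bounded_mult(1)[where C=1] simp: indicator_def)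
  note iN = near_integrable[OF u v, of X]
  have "(LBINT x. \<bar>u x - v x\<bar>) \<le> (LBINT x. indicator {..real X} x * \<bar>u x - v x\<bar>
     + indicator {real X<..} x * u x + indicator {real X<..} x * v x)"
  proof (rule integral_mono)
    fix x show "\<bar>u x - v x\<bar> \<le> indicator {..real X} x * \<bar>u x - v x\<bar>
     + indicator {real X<..} x * u x + indicator {real X<..} x * v x"
      using ud(3)[of x] vd(3)[of x] by (auto simp: indicator_def)
  qed (use ud vd iu iv iN in auto)
  also have "\<dots> = near X u v
    + (LBINT x. indicator {real X<..} x * u x) + (LBINT x. indicator {real X<..} x * v x)"
    unfolding near_def using iu iv iN by simp
  finally show ?thesis .
qed

lemma tail_mass_small:
  assumes "0 < e" shows "\<exists>X::nat. 0 < X \<and> M1 / real X \<le> e"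
proof -
  obtain X :: nat where X: "M1 / e < real X" using reals_Archimedean2 by blast
  then have "M1 < e * real (Suc X)" using assms by (simp add: field_simps)
  then have "M1 / real (Suc X) \<le> e" by (simp add: field_simps)
  then show ?thesis by blast
qed

lemma F_tail:
  assumes "0 < X" shows "(LBINT x. indicator {real X<..} x * F n t x) \<le> M1 / real X"
  using assms by (intro cut_mass_tail F_density F_cut_mass) auto

lemma F_uniformly_Cauchy:
  assumes \<sigma>: "strict_mono \<sigma>" and C: "\<And>q. q \<in> \<rat> \<Longrightarrow> 0 \<le> q \<Longrightarrow> Cauchy (\<lambda>n. A (\<sigma> n) q)"
    and T: "0 \<le> T" and e: "0 < e"
  shows "\<exists>N. \<forall>n\<ge>N. \<forall>m\<ge>N. \<forall>t\<in>{0..T}. (LBINT x. \<bar>F (\<sigma> n) t x - F (\<sigma> m) t x\<bar>) \<le> e"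
proof -
  obtain X where X: "0 < X" "M1 / real X \<le> e / 4" using tail_mass_small[of "e/4"] e by auto
  obtain c where c: "0 \<le> c" "\<And>n m \<alpha> t. X \<le> n \<Longrightarrow> X \<le> m \<Longrightarrow> 0 \<le> \<alpha> \<Longrightarrow> \<forall>s\<in>{0..T}. \<bar>A n s - A m s\<bar> \<le> \<alpha>
     \<Longrightarrow> t \<in> {0..T} \<Longrightarrow> near X (F n t) (F m t) \<le> c * (h n + h m + \<alpha>)"
    using F_Cauchy[OF T, of X] by blast
  define \<alpha> where "\<alpha> = e / (6 * (c + 1))"
  have \<alpha>: "0 < \<alpha>" using e c by (simp add: \<alpha>_def)
  have c\<alpha>: "c * (\<alpha> + \<alpha> + \<alpha>) \<le> e / 2"
  proof -
    have "c * (\<alpha> + \<alpha> + \<alpha>) = (e / 2) * (c / (c + 1))" using c(1) by (simp add: \<alpha>_def divide_simps)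
    also have "\<dots> \<le> (e / 2) * 1" using c(1) e by (intro mult_left_mono) auto
    finally show ?thesis by simp
  qed
  obtain N1 where N1: "\<And>n m s. n \<ge> N1 \<Longrightarrow> m \<ge> N1 \<Longrightarrow> s \<in> {0..T} \<Longrightarrow> \<bar>A (\<sigma> n) s - A (\<sigma> m) s\<bar> \<le> \<alpha>"
    using A_uniformly_Cauchy[OF \<sigma> C T \<alpha>] by blast
  obtain N2 where N2: "\<And>n. n \<ge> N2 \<Longrightarrow> h n \<le> \<alpha>" using h_eventually_small[OF \<alpha>] by blast
  have "(LBINT x. \<bar>F (\<sigma> n) t x - F (\<sigma> m) t x\<bar>) \<le> e"
    if nm: "n \<ge> N1 + N2 + X" "m \<ge> N1 + N2 + X" and t: "t \<in> {0..T}" for n m t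
  proof -
    have s: "\<sigma> n \<ge> N1 + N2 + X" "\<sigma> m \<ge> N1 + N2 + X"
      using nm seq_suble[OF \<sigma>, of n] seq_suble[OF \<sigma>, of m] by linarith+
    have "near X (F (\<sigma> n) t) (F (\<sigma> m) t) \<le> c * (h (\<sigma> n) + h (\<sigma> m) + \<alpha>)"
      using s N1 nm t \<alpha> by (intro c(2)) auto
    also have "\<dots> \<le> c * (\<alpha> + \<alpha> + \<alpha>)"
      using c(1) N2[of "\<sigma> n"] N2[of "\<sigma> m"] s by (intro mult_left_mono add_mono) auto
    finally have "near X (F (\<sigma> n) t) (F (\<sigma> m) t) \<le> e / 2" using c\<alpha> by linarith
    then show ?thesis
      using L1_dist_near_tail[OF F_density F_density, of "\<sigma> n" t "\<sigma> m" t X]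
        F_tail[OF X(1), of "\<sigma> n" t] F_tail[OF X(1), of "\<sigma> m" t] X(2) by linarith
  qed
  then show ?thesis by blast
qed

lemma F_negative_time: "t \<le> 0 \<Longrightarrow> F n t = F n 0"
proof -
  assume "t \<le> 0"
  then have "t / h n \<le> 0" using h_pos[of n] by (simp add: divide_nonpos_pos)
  then have "\<lfloor>t / h n\<rfloor> \<le> 0" by linarith
  then show "F n t = F n 0" by (simp add: F_def step_idx_def)
qed

text \<open>
  The limit is chosen at each nonnegative time separately and extended constantly to negative times, which
  makes the convergence uniform on all of \<open>(-\<infinity>,T]\<close>.
\<close>

lemma F_limit_exists:
  obtains \<sigma> :: "nat \<Rightarrow> nat" and f :: "real \<Rightarrow> real \<Rightarrow> real" where "strict_mono \<sigma>" "\<And>t. size_density (f t)"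
    "\<And>T e. 0 < e \<Longrightarrow> \<exists>N. \<forall>n\<ge>N. \<forall>t\<le>T. (LBINT x. \<bar>F (\<sigma> n) t x - f t x\<bar>) \<le> e"
proof -
  obtain \<sigma> :: "nat \<Rightarrow> nat" where \<sigma>: "strict_mono \<sigma>" "\<And>q. q \<in> \<rat> \<Longrightarrow> 0 \<le> q \<Longrightarrow> Cauchy (\<lambda>n. A (\<sigma> n) q)"
    by (rule A_convergent_subsequence) blast
  have UC: "\<exists>N. \<forall>n\<ge>N. \<forall>m\<ge>N. \<forall>t\<in>{0..T}. (LBINT x. \<bar>F (\<sigma> n) t x - F (\<sigma> m) t x\<bar>) \<le> e"
    if "0 \<le> T" "0 < e" for T e
    by (rule F_uniformly_Cauchy[OF \<sigma> that])
  define P where "P t f \<longleftrightarrow> size_density f \<and>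
    (\<forall>e N m. m \<ge> N \<longrightarrow> (\<forall>m\<ge>N. \<forall>n\<ge>N. (LBINT x. \<bar>F (\<sigma> m) t x - F (\<sigma> n) t x\<bar>) \<le> e)
     \<longrightarrow> (LBINT x. \<bar>F (\<sigma> m) t x - f x\<bar>) \<le> e)" for t f
  have "\<exists>f. P t f" if t: "0 \<le> t" for t
  proof -
    have i: "integrable lborel (F (\<sigma> n) t)" for n using size_densityD(1)[OF F_density] .
    have c: "\<exists>N. \<forall>m\<ge>N. \<forall>n\<ge>N. (LBINT x. \<bar>F (\<sigma> m) t x - F (\<sigma> n) t x\<bar>) < e" if "0 < e" for e
    proof -
      obtain N where N: "\<forall>n\<ge>N. \<forall>m\<ge>N. \<forall>s\<in>{0..t}. (LBINT x. \<bar>F (\<sigma> n) s x - F (\<sigma> m) s x\<bar>) \<le> e / 2"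
        using UC[OF t half_gt_zero[OF \<open>0 < e\<close>]] by blast
      have "(LBINT x. \<bar>F (\<sigma> n) t x - F (\<sigma> m) t x\<bar>) < e" if "n \<ge> N" "m \<ge> N" for n m
        using N[rule_format, OF that, of t] t \<open>0 < e\<close> by simp
      then show ?thesis by blast
    qed
    show ?thesis
    proof (rule L1_complete[OF i c size_densityD(3)[OF F_density]])
      fix f
      assume f: "integrable lborel f" "\<And>x. 0 \<le> f x"
        "\<And>e N m. m \<ge> N \<Longrightarrow> \<forall>m\<ge>N. \<forall>n\<ge>N. (LBINT x. \<bar>F (\<sigma> m) t x - F (\<sigma> n) t x\<bar>) \<le> e \<Longrightarrow>
          (LBINT x. \<bar>F (\<sigma> m) t x - f x\<bar>) \<le> e"
      let ?f = "\<lambda>x. indicator {0<..} x * f x"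
      have fi: "integrable lborel ?f"
        using f(1) by (intro integrable_bounded_mult(1)[where C=1]) (auto simp: indicator_def)
      have le: "(LBINT x. \<bar>F (\<sigma> m) t x - ?f x\<bar>) \<le> (LBINT x. \<bar>F (\<sigma> m) t x - f x\<bar>)" for m
      proof (rule integral_mono)
        fix x show "\<bar>F (\<sigma> m) t x - ?f x\<bar> \<le> \<bar>F (\<sigma> m) t x - f x\<bar>"
          using size_densityD(4)[OF F_density, of x "\<sigma> m" t] f(2)[of x] by (auto simp: indicator_def not_less)
      qed (use fi f(1) i in auto)
      have "P t ?f" unfolding P_def
      proof (intro conjI allI impI)
        show "size_density ?f" using fi f(2) by (auto simp: size_density_def)
        fix e N m
        assume "m \<ge> N" "\<forall>m\<ge>N. \<forall>n\<ge>N. (LBINT x. \<bar>F (\<sigma> m) t x - F (\<sigma> n) t x\<bar>) \<le> e"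
        from f(3)[OF this] show "(LBINT x. \<bar>F (\<sigma> m) t x - ?f x\<bar>) \<le> e" using le[of m] by linarith
      qed
      then show ?thesis by blast
    qed
  qed
  then have "\<forall>t. \<exists>f. 0 \<le> t \<longrightarrow> P t f" by blast
  from choice[OF this] obtain f where P: "\<And>t. 0 \<le> t \<Longrightarrow> P t (f t)" by blast
  have f: "\<And>t. 0 \<le> t \<Longrightarrow> size_density (f t)"
    "\<And>t e N m. 0 \<le> t \<Longrightarrow> m \<ge> N \<Longrightarrow> \<forall>m\<ge>N. \<forall>n\<ge>N. (LBINT x. \<bar>F (\<sigma> m) t x - F (\<sigma> n) t x\<bar>) \<le> e
     \<Longrightarrow> (LBINT x. \<bar>F (\<sigma> m) t x - f t x\<bar>) \<le> e"
    using P unfolding P_def by blast+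
  show ?thesis
  proof (rule that[OF \<sigma>(1), of "\<lambda>t. f (max 0 t)"])
    show "size_density (f (max 0 t))" for t by (rule f(1)) simp
    fix T e :: real assume e: "0 < e"
    obtain N where N: "\<forall>n\<ge>N. \<forall>m\<ge>N. \<forall>t\<in>{0..max 0 T}. (LBINT x. \<bar>F (\<sigma> n) t x - F (\<sigma> m) t x\<bar>) \<le> e"
      using UC[OF _ e, of "max 0 T"] by auto
    have "(LBINT x. \<bar>F (\<sigma> n) t x - f (max 0 t) x\<bar>) \<le> e" if "n \<ge> N" "t \<le> T" for n t
    proof -
      have "F (\<sigma> n) t = F (\<sigma> n) (max 0 t)" using F_negative_time[of t] by (cases "t \<le> 0") (auto simp: max_def)
      then show ?thesis using f(2)[of "max 0 t" N n e] N that by auto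
    qed
    then show "\<exists>N. \<forall>n\<ge>N. \<forall>t\<le>T. (LBINT x. \<bar>F (\<sigma> n) t x - f (max 0 t) x\<bar>) \<le> e" by blast
  qed
qed

end

section \<open>The weak formulation for the limit\<close>

text \<open>
  The pairs lost by the cutoff contribute at most twice the full rate times the tail rate. Young's inequality
  with parameter \<open>\<alpha>\<close> separates the two, as each is controlled in \<open>L\<^sup>2\<close> of time on its own.
\<close>

lemma pairing_truncation:
  assumes w: "size_density w" and \<alpha>: "0 < \<alpha>"
    and \<phi>: "\<phi> \<in> borel_measurable (borel \<Otimes>\<^sub>M borel)" "\<And>z. \<bar>\<phi> z\<bar> \<le> C"
  shows "\<bar>pairing \<phi> w w - pairing \<phi> (\<lambda>x. indicator {..a} x * w x) (\<lambda>x. indicator {..a} x * w x)\<bar>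
    \<le> C * (\<alpha> * (LBINT x. w x)\<^sup>2 + (LBINT x. indicator {a<..} x * w x)\<^sup>2 / \<alpha>)"
proof -
  note wd = size_densityD[OF w]
  let ?v = "\<lambda>x. indicator {..a} x * w x" and ?N = "LBINT x. w x" and ?S = "LBINT x. indicator {a<..} x * w x"
  have iv: "integrable lborel ?v"
    using wd by (intro integrable_bounded_mult(1)[where C=1]) (auto simp: indicator_def)
  have C: "0 \<le> C" using \<phi>(2)[of undefined] by linarith
  have S: "0 \<le> ?S" using wd by (intro integral_nonneg_AE) auto
  have N: "0 \<le> ?N" using wd by (intro integral_nonneg_AE) auto
  have "(LBINT x. \<bar>?v x\<bar>) \<le> ?N"
    using iv wd by (intro integral_mono) (auto simp: indicator_def)
  moreover have "(LBINT x. \<bar>w x\<bar>) = ?N" using wd by simp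
  moreover have "(LBINT x. \<bar>w x - ?v x\<bar>) = ?S"
    using wd by (intro Bochner_Integration.integral_cong) (auto simp: indicator_def)
  ultimately have "\<bar>pairing \<phi> w w - pairing \<phi> ?v ?v\<bar> \<le> C * ((?N + ?N) * ?S)"
    using pairing_diff_bound[OF wd(1) iv \<phi>] C S
    by (smt (verit) mult_left_mono mult_right_mono)
  also have "(?N + ?N) * ?S \<le> \<alpha> * ?N\<^sup>2 + ?S\<^sup>2 / \<alpha>"
  proof -
    \<comment> \<open>Young's inequality: \<open>2 N S \<le> \<alpha> N\<^sup>2 + S\<^sup>2 / \<alpha>\<close>.\<close>
    have "0 \<le> (\<alpha> * ?N - ?S)\<^sup>2 / \<alpha>" using \<alpha> by simp
    also have "\<dots> = \<alpha> * ?N\<^sup>2 + ?S\<^sup>2 / \<alpha> - (?N + ?N) * ?S"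
      using \<alpha> by (simp add: power2_eq_square field_simps)
    finally show ?thesis by simp
  qed
  then have "C * ((?N + ?N) * ?S) \<le> C * (\<alpha> * ?N\<^sup>2 + ?S\<^sup>2 / \<alpha>)" using C by (rule mult_left_mono)
  finally show ?thesis .
qed

context coagulation_data
begin

lemma step_integral_le:
  assumes c: "\<And>j. 0 \<le> c j" "\<And>k. h n * (\<Sum>j<k. c j) \<le> K" and t: "0 \<le> t"
  shows "(LBINT s:{0..t}. c (step_idx (h n) s)) \<le> K"
proof -
  let ?k = "step_idx (h n) t"
  have "(LBINT s:{0..t}. c (step_idx (h n) s)) = h n * (\<Sum>j<?k. c j) + (t - real ?k * h n) * c ?k"
    by (rule integral_step_idx(2)[OF h_pos t])
  also have "\<dots> \<le> h n * (\<Sum>j<?k. c j) + h n * c ?k"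
    using step_idx_bounds[OF h_pos[of n] t] c(1)
    by (intro add_left_mono mult_right_mono) (auto simp: algebra_simps)
  also have "\<dots> \<le> K" using c(2)[of "Suc ?k"] by (simp add: algebra_simps)
  finally show ?thesis .
qed

lemma act_euler: "X \<le> n \<Longrightarrow> act X (euler n k) = (\<lambda>x. indicator {..real X} x * g n k x)"
  by (auto simp: act_def g_def rtrunc_def indicator_def)

text \<open>
  The rate on the window \<open>(a,X]\<close> is Lipschitz continuous in \<open>L\<^sup>1\<close>, unlike the rate on \<open>(a,\<infinity>)\<close>, for which \<open>r\<close> may
  be unbounded. Bounds are passed to the limit on windows first, and then \<open>X\<close> tends to infinity.
\<close>

definition rate :: "real \<Rightarrow> nat \<Rightarrow> (real \<Rightarrow> real) \<Rightarrow> real" where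
  "rate a X u = (LBINT x. indicator {a<..} x * act X u x)"

lemma rate_integrable:
  assumes "size_density u" shows "integrable lborel (\<lambda>x. indicator {a<..} x * act X u x)"
  using size_densityD[OF act_bound(1)[OF assms]]
  by (intro integrable_bounded_mult(1)[where C=1]) (auto simp: indicator_def)

lemma rate_bounds:
  assumes u: "size_density u" "(LBINT x. u x) \<le> M0"
  shows "0 \<le> rate a X u" "rate a X u \<le> b X * M0"
proof -
  note ad = size_densityD[OF act_bound(1)[OF u(1)]]
  show "0 \<le> rate a X u" unfolding rate_def using ad by (intro integral_nonneg_AE) auto
  have "rate a X u \<le> (LBINT x. \<bar>act X u x\<bar>)"
    unfolding rate_def using ad rate_integrable[OF u(1)]
    by (intro integral_mono) (auto simp: indicator_def)
  also have "\<dots> \<le> b X * M0"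
    by (rule order_trans[OF act_bound(2)[OF u(1)] mult_left_mono[OF u(2) b_nonneg]])
  finally show "rate a X u \<le> b X * M0" .
qed

lemma rate_diff_bound:
  assumes u: "size_density u" and v: "size_density v"
  shows "\<bar>rate a X u - rate a X v\<bar> \<le> b X * (LBINT x. \<bar>u x - v x\<bar>)"
proof -
  note au = size_densityD[OF act_bound(1)[OF u]] and av = size_densityD[OF act_bound(1)[OF v]]
  have i: "integrable lborel (\<lambda>x. act X u x - act X v x)" using au av by auto
  have "rate a X u - rate a X v = (LBINT x. indicator {a<..} x * (act X u x - act X v x))"
    unfolding rate_def using rate_integrable[OF u] rate_integrable[OF v] by (simp add: right_diff_distrib)
  also have "\<bar>(LBINT x. indicator {a<..} x * (act X u x - act X v x))\<bar> \<le> 1 * (LBINT x. \<bar>act X u x - act X v x\<bar>)"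
    by (rule integrable_bounded_mult(2)[OF i]) (auto simp: indicator_def)
  also have "\<dots> \<le> b X * (LBINT x. indicator {..real X} x * \<bar>u x - v x\<bar>)"
    using act_diff_bound[OF u v, of X] by simp
  also have "\<dots> \<le> b X * (LBINT x. \<bar>u x - v x\<bar>)"
    using near_integrable[OF u v, of X] size_densityD(1)[OF u] size_densityD(1)[OF v] b_nonneg[of X]
    by (intro mult_left_mono integral_mono) (auto simp: indicator_def)
  finally show ?thesis .
qed

lemma rate_euler:
  assumes X: "X \<le> n"
  shows "rate a X (euler n k) \<le> R n k" "rate a X (euler n k) \<le> S a n k"
proof -
  note gd = size_densityD[OF g_density[of n k]]
  have iS: "integrable lborel (\<lambda>x. indicator {a<..} x * g n k x)"
    using gd by (intro integrable_bounded_mult(1)[where C=1]) (auto simp: indicator_def)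
  have le: "indicator {a<..} x * act X (euler n k) x \<le> g n k x"
    "indicator {a<..} x * act X (euler n k) x \<le> indicator {a<..} x * g n k x" for x
    using gd(3)[of x] unfolding act_euler[OF X] by (auto simp: indicator_def)
  show "rate a X (euler n k) \<le> R n k"
    unfolding rate_def R_def by (rule integral_mono[OF rate_integrable[OF euler_density] gd(1) le(1)])
  show "rate a X (euler n k) \<le> S a n k"
    unfolding rate_def S_def by (rule integral_mono[OF rate_integrable[OF euler_density] iS le(2)])
qed

lemma rate_F_sq_integral:
  assumes X: "X \<le> n" and t: "0 \<le> t"
  shows "(LBINT s:{0..t}. (rate a X (F n s))\<^sup>2) \<le> 2 * M0"
    and "0 < a \<Longrightarrow> (LBINT s:{0..t}. (rate a X (F n s))\<^sup>2) \<le> 2 * M1 / a"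
proof -
  have r0: "0 \<le> rate a X (euler n k)" for k using rate_bounds(1)[OF euler_density euler_mass] .
  have "h n * (\<Sum>j<k. (rate a X (euler n j))\<^sup>2) \<le> h n * (\<Sum>j<k. (R n j)\<^sup>2)" for k
    using rate_euler(1)[OF X] r0 h_pos[of n] by (intro mult_left_mono sum_mono power_mono) auto
  then have 1: "h n * (\<Sum>j<k. (rate a X (euler n j))\<^sup>2) \<le> 2 * M0" for k
    using sum_R[of n k] order_trans by blast
  show "(LBINT s:{0..t}. (rate a X (F n s))\<^sup>2) \<le> 2 * M0"
    unfolding F_def using step_integral_le[OF _ 1 t] by simp
  have "h n * (\<Sum>j<k. (rate a X (euler n j))\<^sup>2) \<le> h n * (\<Sum>j<k. (S a n j)\<^sup>2)" for k
    using rate_euler(2)[OF X] r0 h_pos[of n] by (intro mult_left_mono sum_mono power_mono) auto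
  then have 2: "h n * (\<Sum>j<k. (rate a X (euler n j))\<^sup>2) \<le> 2 * M1 / a" if "0 < a" for k
    using sum_S[OF that, of n k] order_trans by blast
  show "(LBINT s:{0..t}. (rate a X (F n s))\<^sup>2) \<le> 2 * M1 / a" if "0 < a"
    unfolding F_def using step_integral_le[OF _ 2[OF that] t] by simp
qed

text \<open>
  The first error comes from the incomplete last time step, the second from the cutoff of the collision
  term at \<open>X\<close>. With \<open>\<alpha> = 1 / sqrt X\<close>, the bounds \<open>2 M\<^sub>0\<close> and \<open>2 M\<^sub>1 / X\<close> on the two squared rates contribute
  at the same order.
\<close>

lemma F_weak_approx:
  assumes \<theta>: "\<theta> \<in> borel_measurable borel" "\<And>x. \<bar>\<theta> x\<bar> \<le> C" and X: "0 < X" "X \<le> n" and t: "0 \<le> t"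
  shows "\<bar>(LBINT x. \<theta> x * F n t x) - (LBINT x. \<theta> x * f0 x)
     - 1/2 * (LBINT s:{0..t}. pairing (pair_tilde \<theta>) (act X (F n s)) (act X (F n s)))\<bar>
    \<le> 3 * C / (real n + 1) + 3 * C * (M0 + M1) / sqrt (real X)"
proof -
  define Q where "Q = (\<lambda>k. pairing (pair_tilde \<theta>) (g n k) (g n k))"
  define QX where "QX = (\<lambda>k. pairing (pair_tilde \<theta>) (act X (euler n k)) (act X (euler n k)))"
  have \<phi>: "pair_tilde \<theta> \<in> borel_measurable (borel \<Otimes>\<^sub>M borel)" "\<And>z. \<bar>pair_tilde \<theta> z\<bar> \<le> 3 * C"
    using measurable_pair_tilde[OF \<theta>(1)] pair_tilde_bound[of \<theta> C] \<theta>(2) by auto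
  have C0: "0 \<le> C" using \<theta>(2)[of 0] by linarith
  have hn: "0 \<le> h n" using h_pos[of n] by simp
  define \<alpha> where "\<alpha> = 1 / sqrt (real X)"
  have \<alpha>: "0 < \<alpha>" using X by (simp add: \<alpha>_def)
  have R_abs: "(LBINT x. \<bar>g n k x\<bar>) = R n k" for k
    using size_densityD(3)[OF g_density, of n k] by (simp add: R_def)
  have sum: "(LBINT x. \<theta> x * euler n k x) = (LBINT x. \<theta> x * f0 x) + h n / 2 * (\<Sum>j<k. Q j)" for k
  proof (induction k)
    case (Suc k)
    have gg: "(\<lambda>x. rtrunc n x * euler n k x) = g n k" by (auto simp: g_def)
    show ?case
      using coag_step_weak[OF euler_density[of n k] rtrunc_meas[of n] rtrunc_bounds hn \<theta>, unfolded gg] Suc.IH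
      by (simp add: Q_def algebra_simps)
  qed simp
  define k where "k = step_idx (h n) t"
  note kb = step_idx_bounds[OF h_pos[of n] t, folded k_def]
  note IQ = integral_step_idx[OF h_pos[of n] t, of Q, folded k_def]
  note IQX = integral_step_idx(1)[OF h_pos[of n] t, of QX]
  have QR: "\<bar>Q j\<bar> \<le> 3 * C * (R n j)\<^sup>2" for j
    unfolding Q_def using pairing_bound[OF size_densityD(1)[OF g_density] size_densityD(1)[OF g_density] \<phi>, of n j n j]
    by (simp add: R_abs power2_eq_square)
  have rem: "\<bar>(t - real k * h n) * Q k\<bar> \<le> 3 * C / (real n + 1)"
  proof -
    have "\<bar>(t - real k * h n) * Q k\<bar> \<le> h n * (3 * C * (R n k)\<^sup>2)"
      unfolding abs_mult using kb QR hn by (intro mult_mono) (auto simp: algebra_simps)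
    also have "\<dots> \<le> h n * (3 * C * (b n * (1 + M0))\<^sup>2)"
    proof (intro mult_left_mono power_mono)
      show "R n k \<le> b n * (1 + M0)" using R_bound[of n k] b_nonneg[of n] by (simp add: algebra_simps)
    qed (use hn C0 R_nonneg in auto)
    also have "\<dots> = 3 * C * (h n * (b n)\<^sup>2 * (1 + M0)\<^sup>2)" by (simp add: power_mult_distrib)
    also have "\<dots> \<le> 3 * C * (1 / (real n + 1))" using h_small(2)[of n] C0 by (intro mult_left_mono) auto
    finally show ?thesis by simp
  qed
  have diff: "\<bar>Q j - QX j\<bar> \<le> 3 * C * (\<alpha> * (R n j)\<^sup>2 + (S X n j)\<^sup>2 / \<alpha>)" for j
    unfolding Q_def QX_def act_euler[OF X(2)] R_def S_def
    by (rule pairing_truncation[OF g_density \<alpha> \<phi>])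
  let ?B = "\<lambda>j. 3 * C * (\<alpha> * (R n j)\<^sup>2 + (S X n j)\<^sup>2 / \<alpha>)"
  have "\<bar>(LBINT s:{0..t}. Q (step_idx (h n) s)) - (LBINT s:{0..t}. QX (step_idx (h n) s))\<bar>
     = \<bar>LBINT s:{0..t}. (Q (step_idx (h n) s) - QX (step_idx (h n) s))\<bar>"
    using set_integral_diff(2)[OF IQ(1) IQX] by simp
  also have "\<dots> \<le> (LBINT s:{0..t}. \<bar>Q (step_idx (h n) s) - QX (step_idx (h n) s)\<bar>)"
    using set_integral_norm_bound[OF set_integral_diff(1)[OF IQ(1) IQX]] by simp
  also have "\<dots> \<le> (LBINT s:{0..t}. ?B (step_idx (h n) s))"
  proof (rule set_integral_mono)
    show "set_integrable lborel {0..t} (\<lambda>s. \<bar>Q (step_idx (h n) s) - QX (step_idx (h n) s)\<bar>)"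
      by (rule set_integrable_abs[OF set_integral_diff(1)[OF IQ(1) IQX]])
    show "set_integrable lborel {0..t} (\<lambda>s. ?B (step_idx (h n) s))"
      by (rule integral_step_idx(1)[OF h_pos t, where c="?B"])
  qed (rule diff)
  also have "\<dots> \<le> 3 * C * (\<alpha> * (2 * M0) + (2 * M1 / X) / \<alpha>)"
  proof (rule step_integral_le[OF _ _ t])
    show "0 \<le> ?B j" for j using C0 \<alpha> by simp
    fix k
    have "h n * (\<Sum>j<k. ?B j) = 3 * C * (\<alpha> * (h n * (\<Sum>j<k. (R n j)\<^sup>2)) + (h n * (\<Sum>j<k. (S X n j)\<^sup>2)) / \<alpha>)"
      by (simp add: sum.distrib sum_distrib_left sum_divide_distrib algebra_simps)
    also have "\<dots> \<le> 3 * C * (\<alpha> * (2 * M0) + (2 * M1 / X) / \<alpha>)"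
      using sum_R[of n k] sum_S[of "real X" n k] X C0 \<alpha>
      by (intro mult_left_mono add_mono divide_right_mono) auto
    finally show "h n * (\<Sum>j<k. ?B j) \<le> 3 * C * (\<alpha> * (2 * M0) + (2 * M1 / X) / \<alpha>)" .
  qed
  also have "\<dots> = 2 * (3 * C * (M0 + M1) / sqrt (real X))"
  proof -
    have "3 * C * (1 / p * (2 * M0) + (2 * M1 / (p * p)) / (1 / p)) = 2 * (3 * C * (M0 + M1) / p)" if "0 < p" for p
      using that by (simp add: field_simps)
    from this[of "sqrt (real X)"] X show ?thesis by (simp add: \<alpha>_def)
  qed
  finally have D: "\<bar>(LBINT s:{0..t}. Q (step_idx (h n) s)) - (LBINT s:{0..t}. QX (step_idx (h n) s))\<bar>
     \<le> 2 * (3 * C * (M0 + M1) / sqrt (real X))" .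
  have e: "(LBINT x. \<theta> x * F n t x) - (LBINT x. \<theta> x * f0 x) - 1/2 * (LBINT s:{0..t}. Q (step_idx (h n) s))
     = - (1/2) * ((t - real k * h n) * Q k)"
    unfolding IQ(2) F_def k_def[symmetric] sum by (simp add: algebra_simps)
  have aux: "\<bar>I - 1/2 * q'\<bar> \<le> A + B"
    if "I - 1/2 * q = - (1/2) * \<delta>" "\<bar>\<delta>\<bar> \<le> A" "\<bar>q - q'\<bar> \<le> 2 * B" for I q q' \<delta> A B :: real
    using that by linarith
  have "\<bar>(LBINT x. \<theta> x * F n t x) - (LBINT x. \<theta> x * f0 x) - 1/2 * (LBINT s:{0..t}. QX (step_idx (h n) s))\<bar>
    \<le> 3 * C / (real n + 1) + 3 * C * (M0 + M1) / sqrt (real X)"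
    by (rule aux[OF e rem D])
  then show ?thesis by (simp add: QX_def F_def)
qed

end

locale coagulation_limit = coagulation_data +
  fixes \<sigma> :: "nat \<Rightarrow> nat" and f :: "real \<Rightarrow> real \<Rightarrow> real"
  assumes \<sigma>: "strict_mono \<sigma>"
    and f_density: "\<And>t. size_density (f t)"
    and f_limit: "\<And>T e. 0 < e \<Longrightarrow> \<exists>N. \<forall>n\<ge>N. \<forall>t\<le>T. (LBINT x. \<bar>F (\<sigma> n) t x - f t x\<bar>) \<le> e"
begin

lemma \<sigma>_ge: "n \<le> \<sigma> n" by (rule seq_suble[OF \<sigma>])

lemma L1_tendsto: "(\<lambda>n. LBINT x. \<bar>F (\<sigma> n) t x - f t x\<bar>) \<longlonglongrightarrow> 0"
proof (rule LIMSEQ_I)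
  fix e :: real assume "0 < e"
  then obtain N where N: "\<forall>n\<ge>N. \<forall>s\<le>t. (LBINT x. \<bar>F (\<sigma> n) s x - f s x\<bar>) \<le> e / 2"
    using f_limit[of "e/2" t] by auto
  have "norm ((LBINT x. \<bar>F (\<sigma> n) t x - f t x\<bar>) - 0) < e" if "n \<ge> N" for n
  proof -
    have "0 \<le> (LBINT x. \<bar>F (\<sigma> n) t x - f t x\<bar>)" by simp
    then show ?thesis using N that \<open>0 < e\<close> by fastforce
  qed
  then show "\<exists>N. \<forall>n\<ge>N. norm ((LBINT x. \<bar>F (\<sigma> n) t x - f t x\<bar>) - 0) < e" by blast
qed

lemma tendsto_by_L1:
  fixes \<Phi> :: "(real \<Rightarrow> real) \<Rightarrow> real"
  assumes "\<And>n. \<bar>\<Phi> (F (\<sigma> n) t) - \<Phi> (f t)\<bar> \<le> C * (LBINT x. \<bar>F (\<sigma> n) t x - f t x\<bar>)"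
  shows "(\<lambda>n. \<Phi> (F (\<sigma> n) t)) \<longlonglongrightarrow> \<Phi> (f t)"
proof -
  have "(\<lambda>n. C * (LBINT x. \<bar>F (\<sigma> n) t x - f t x\<bar>)) \<longlonglongrightarrow> 0"
    using tendsto_mult[OF tendsto_const[of C] L1_tendsto] by simp
  then have "(\<lambda>n. \<Phi> (F (\<sigma> n) t) - \<Phi> (f t)) \<longlonglongrightarrow> 0"
    by (rule Lim_null_comparison[rotated]) (use assms in auto)
  then show ?thesis by (simp add: LIM_zero_iff)
qed

lemma tendsto_test:
  assumes \<psi>: "\<psi> \<in> borel_measurable borel" "\<And>x. \<bar>\<psi> x\<bar> \<le> C"
  shows "(\<lambda>n. LBINT x. \<psi> x * F (\<sigma> n) t x) \<longlonglongrightarrow> (LBINT x. \<psi> x * f t x)"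
proof (rule tendsto_by_L1[where \<Phi>="\<lambda>u. LBINT x. \<psi> x * u x"])
  fix n
  note Fd = size_densityD(1)[OF F_density[of "\<sigma> n" t]] and fd = size_densityD(1)[OF f_density[of t]]
  have \<psi>m: "\<psi> \<in> borel_measurable lborel" using \<psi>(1) by simp
  have i: "integrable lborel (\<lambda>x. F (\<sigma> n) t x - f t x)" using Fd fd by simp
  have "(LBINT x. \<psi> x * F (\<sigma> n) t x) - (LBINT x. \<psi> x * f t x) = (LBINT x. \<psi> x * (F (\<sigma> n) t x - f t x))"
    using integrable_bounded_mult(1)[OF Fd \<psi>m \<psi>(2)] integrable_bounded_mult(1)[OF fd \<psi>m \<psi>(2)]
    by (simp add: right_diff_distrib)
  then show "\<bar>(LBINT x. \<psi> x * F (\<sigma> n) t x) - (LBINT x. \<psi> x * f t x)\<bar> \<le> C * (LBINT x. \<bar>F (\<sigma> n) t x - f t x\<bar>)"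
    using integrable_bounded_mult(2)[OF i \<psi>m \<psi>(2)] by simp
qed

lemma f_mass: "(LBINT x. f t x) \<le> M0"
  using tendsto_test[of "\<lambda>x. 1" 1 t] F_mass by (auto intro: LIMSEQ_le_const2)

lemma f_cut_mass: "0 \<le> a \<Longrightarrow> (LBINT x. cut a x * f t x) \<le> M1"
  using tendsto_test[OF measurable_cut cut_bound, of a t] F_cut_mass[of a] by (auto intro: LIMSEQ_le_const2)

text \<open>
  Fatou's lemma, applied to the bounded test functions \<open>cut n\<close>.
\<close>

lemma f_first_moment:
  shows "integrable lborel (\<lambda>x. x * f t x)" "(LBINT x. x * f t x) \<le> M1"
proof -
  note fd = size_densityD[OF f_density[of t]]
  have [measurable]: "f t \<in> borel_measurable borel" by (rule fd(2))
  have nn: "0 \<le> x * f t x" for x using fd(3)[of x] fd(4)[of x] by (cases "x \<le> 0") auto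
  have "(\<integral>\<^sup>+x. ennreal (x * f t x) \<partial>lborel) = (\<integral>\<^sup>+x. liminf (\<lambda>n. ennreal (cut (real n) x * f t x)) \<partial>lborel)"
  proof (rule nn_integral_cong)
    fix x
    have "eventually (\<lambda>n. ennreal (cut (real n) x * f t x) = ennreal (x * f t x)) sequentially"
    proof -
      obtain N :: nat where "x \<le> real N" using real_arch_simple by blast
      then have "cut (real n) x * f t x = x * f t x" if "n \<ge> N" for n
        using that fd(4)[of x] by (cases "x \<le> 0") (auto simp: cut_def)
      then show ?thesis unfolding eventually_sequentially by metis
    qed
    then have "(\<lambda>n. ennreal (cut (real n) x * f t x)) \<longlonglongrightarrow> ennreal (x * f t x)" by (rule tendsto_eventually)
    then show "ennreal (x * f t x) = liminf (\<lambda>n. ennreal (cut (real n) x * f t x))"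
      by (intro lim_imp_Liminf[symmetric]) simp_all
  qed
  also have "\<dots> \<le> liminf (\<lambda>n. \<integral>\<^sup>+x. ennreal (cut (real n) x * f t x) \<partial>lborel)"
    by (rule nn_integral_liminf) simp
  also have "\<dots> \<le> liminf (\<lambda>n. ennreal M1)"
  proof (rule Liminf_mono, rule always_eventually, rule allI)
    fix n
    have "integrable lborel (\<lambda>x. cut (real n) x * f t x)"
      by (rule integrable_bounded_mult(1)[OF fd(1) _ cut_bound]) auto
    then have "(\<integral>\<^sup>+x. ennreal (cut (real n) x * f t x) \<partial>lborel) = ennreal (LBINT x. cut (real n) x * f t x)"
      using fd(3) by (intro nn_integral_eq_integral) (auto simp: cut_def)
    then show "(\<integral>\<^sup>+x. ennreal (cut (real n) x * f t x) \<partial>lborel) \<le> ennreal M1"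
      using f_cut_mass[of "real n" t] by (simp add: ennreal_leI)
  qed
  finally have le: "(\<integral>\<^sup>+x. ennreal (x * f t x) \<partial>lborel) \<le> ennreal M1" by (simp add: Liminf_const)
  show i: "integrable lborel (\<lambda>x. x * f t x)"
    by (rule integrableI_bounded) (use le nn in \<open>auto intro: le_less_trans\<close>)
  have "ennreal (LBINT x. x * f t x) = (\<integral>\<^sup>+x. ennreal (x * f t x) \<partial>lborel)"
    using i nn by (intro nn_integral_eq_integral[symmetric]) auto
  then show "(LBINT x. x * f t x) \<le> M1"
    using le M_nonneg by (metis ennreal_le_iff)
qed

subsection \<open>Reaction rates of the limit\<close>

text \<open>
  Along the approximations \<open>\<Phi>\<close> is a step function of time. Its limit is thus Borel
  measurable in time, and dominated convergence applies.
\<close>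

lemma time_functional:
  fixes \<Phi> :: "(real \<Rightarrow> real) \<Rightarrow> real"
  assumes lip: "\<And>n s. \<bar>\<Phi> (F (\<sigma> n) s) - \<Phi> (f s)\<bar> \<le> C * (LBINT x. \<bar>F (\<sigma> n) s x - f s x\<bar>)"
    and bound: "\<And>n s. \<bar>\<Phi> (F (\<sigma> n) s)\<bar> \<le> B"
  shows "(\<lambda>s. \<Phi> (f s)) \<in> borel_measurable borel"
    and "set_integrable lborel {0..t} (\<lambda>s. \<Phi> (f s))"
    and "(\<lambda>n. LBINT s:{0..t}. \<Phi> (F (\<sigma> n) s)) \<longlonglongrightarrow> (LBINT s:{0..t}. \<Phi> (f s))"
proof -
  let ?s = "\<lambda>n s. indicator {0..t} s *\<^sub>R \<Phi> (F (\<sigma> n) s)"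
  note lim = tendsto_by_L1[OF lip]
  have mF: "(\<lambda>s. \<Phi> (F n s)) \<in> borel_measurable borel" for n
    unfolding F_def by (rule measurable_compose[OF measurable_step_idx]) simp
  show mf: "(\<lambda>s. \<Phi> (f s)) \<in> borel_measurable borel"
    by (rule borel_measurable_LIMSEQ_real[OF lim mF])
  have m: "?s n \<in> borel_measurable lborel" for n using mF by simp
  have mf': "(\<lambda>s. indicator {0..t} s *\<^sub>R \<Phi> (f s)) \<in> borel_measurable lborel" using mf by simp
  have iB: "integrable lborel (\<lambda>s. indicator {0..t} s *\<^sub>R B)" by (simp add: emeasure_lborel_Icc_eq)
  have le: "norm (?s n s) \<le> indicator {0..t} s *\<^sub>R B" for n s using bound by (simp add: indicator_def)
  have lim': "(\<lambda>n. ?s n s) \<longlonglongrightarrow> indicator {0..t} s *\<^sub>R \<Phi> (f s)" for s by (intro tendsto_intros lim)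
  note dc = integrable_dominated_convergence[where s="?s", OF mf' m iB]
    integral_dominated_convergence[where s="?s", OF mf' m iB]
  show "set_integrable lborel {0..t} (\<lambda>s. \<Phi> (f s))"
    unfolding set_integrable_def by (rule dc(1)) (use le lim' in auto)
  show "(\<lambda>n. LBINT s:{0..t}. \<Phi> (F (\<sigma> n) s)) \<longlonglongrightarrow> (LBINT s:{0..t}. \<Phi> (f s))"
    unfolding set_lebesgue_integral_def by (rule dc(2)) (use le lim' in auto)
qed

lemma rate_bounded: "\<bar>rate a X (F n s)\<bar> \<le> b X * M0" "\<bar>rate a X (f s)\<bar> \<le> b X * M0"
  using rate_bounds[OF F_density F_mass, of a X n s] rate_bounds[OF f_density f_mass, of a X s] by auto

lemma measurable_rate_f[measurable]: "(\<lambda>s. rate a X (f s)) \<in> borel_measurable borel"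
  by (rule time_functional(1)[OF rate_diff_bound[OF F_density f_density] rate_bounded(1)])

lemma rate_f_sq_integral:
  assumes K: "\<And>n. X \<le> n \<Longrightarrow> (LBINT s:{0..t}. (rate a X (F n s))\<^sup>2) \<le> K"
  shows "set_integrable lborel {0..t} (\<lambda>s. (rate a X (f s))\<^sup>2)"
    and "(LBINT s:{0..t}. (rate a X (f s))\<^sup>2) \<le> K"
proof -
  have lip: "\<bar>(rate a X (F (\<sigma> n) s))\<^sup>2 - (rate a X (f s))\<^sup>2\<bar>
    \<le> (2 * (b X * M0) * b X) * (LBINT x. \<bar>F (\<sigma> n) s x - f s x\<bar>)" for n s
  proof -
    let ?u = "rate a X (F (\<sigma> n) s)" and ?v = "rate a X (f s)"
    have "\<bar>?u\<^sup>2 - ?v\<^sup>2\<bar> = \<bar>?u + ?v\<bar> * \<bar>?u - ?v\<bar>"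
      by (simp add: power2_eq_square square_diff_square_factored abs_mult)
    also have "\<dots> \<le> (2 * (b X * M0)) * (b X * (LBINT x. \<bar>F (\<sigma> n) s x - f s x\<bar>))"
    proof (rule mult_mono[OF _ rate_diff_bound[OF F_density f_density]])
      show "\<bar>?u + ?v\<bar> \<le> 2 * (b X * M0)"
        using rate_bounded(1)[of a X "\<sigma> n" s] rate_bounded(2)[of a X s] by linarith
    qed (use b_nonneg[of X] M_nonneg in auto)
    finally show ?thesis by (simp add: mult.assoc)
  qed
  have bd: "\<bar>(rate a X (F (\<sigma> n) s))\<^sup>2\<bar> \<le> (b X * M0)\<^sup>2" for n s
    using power_mono[OF rate_bounded(1)[of a X "\<sigma> n" s], of 2] by simp
  note T = time_functional[of "\<lambda>u. (rate a X u)\<^sup>2", OF lip bd]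
  show "set_integrable lborel {0..t} (\<lambda>s. (rate a X (f s))\<^sup>2)" by (rule T(2))
  show "(LBINT s:{0..t}. (rate a X (f s))\<^sup>2) \<le> K"
    by (rule LIMSEQ_le_const2[OF T(3)]) (use K \<sigma>_ge order_trans in blast)
qed

definition reactant :: "real \<Rightarrow> real \<Rightarrow> real" where "reactant s x = r x * f s x"

text \<open>
  The rate of the limit beyond size \<open>a\<close>. It may be infinite at exceptional times, hence the values in
  \<^typ>\<open>ennreal\<close>.
\<close>

definition activity :: "real \<Rightarrow> real \<Rightarrow> ennreal" where
  "activity a s = (\<integral>\<^sup>+x. ennreal (indicator {a<..} x * reactant s x) \<partial>lborel)"

lemma measurable_f[measurable]: "f s \<in> borel_measurable borel"
  by (rule size_densityD(2)[OF f_density])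

lemma measurable_reactant[measurable]: "reactant s \<in> borel_measurable borel"
  unfolding reactant_def[abs_def] by measurable

lemma reactant_nonneg: "0 \<le> reactant s x" "x \<le> 0 \<Longrightarrow> reactant s x = 0"
  using size_densityD(3,4)[OF f_density[of s]] r_nonneg by (auto simp: reactant_def)

lemma act_f: "act X (f s) = (\<lambda>x. indicator {..real X} x * reactant s x)"
  by (auto simp: act_def reactant_def)

lemma rate_f_mono: "X \<le> Y \<Longrightarrow> rate a X (f s) \<le> rate a Y (f s)"
  unfolding rate_def
  by (rule integral_mono[OF rate_integrable[OF f_density] rate_integrable[OF f_density]])
     (use reactant_nonneg in \<open>auto simp: act_f indicator_def\<close>)

lemma activity_SUP: "activity a s = (SUP X. ennreal (rate a X (f s)))"
proof -
  have rate: "ennreal (rate a X (f s)) = (\<integral>\<^sup>+x. ennreal (indicator {a<..} x * act X (f s) x) \<partial>lborel)" for X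
    unfolding rate_def using rate_integrable[OF f_density, of a X s] reactant_nonneg
    by (intro nn_integral_eq_integral[symmetric]) (auto simp: act_f)
  have "activity a s = (\<integral>\<^sup>+x. (SUP X. ennreal (indicator {a<..} x * act X (f s) x)) \<partial>lborel)"
    unfolding activity_def
  proof (rule nn_integral_cong)
    fix x
    obtain N :: nat where N: "x \<le> real N" using real_arch_simple by blast
    show "ennreal (indicator {a<..} x * reactant s x) = (SUP X. ennreal (indicator {a<..} x * act X (f s) x))"
    proof (rule antisym)
      have "ennreal (indicator {a<..} x * reactant s x) = ennreal (indicator {a<..} x * act N (f s) x)"
        using N by (simp add: act_f)
      also have "\<dots> \<le> (SUP X. ennreal (indicator {a<..} x * act X (f s) x))"
        by (rule SUP_upper) simp
      finally show "ennreal (indicator {a<..} x * reactant s x) \<le> (SUP X. ennreal (indicator {a<..} x * act X (f s) x))" .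
      show "(SUP X. ennreal (indicator {a<..} x * act X (f s) x)) \<le> ennreal (indicator {a<..} x * reactant s x)"
        using reactant_nonneg by (intro SUP_least ennreal_leI) (auto simp: act_f indicator_def)
    qed
  qed
  also have "\<dots> = (SUP X. \<integral>\<^sup>+x. ennreal (indicator {a<..} x * act X (f s) x) \<partial>lborel)"
  proof (rule nn_integral_monotone_convergence_SUP)
    show "incseq (\<lambda>X x. ennreal (indicator {a<..} x * act X (f s) x))"
      using reactant_nonneg by (auto simp: incseq_def le_fun_def act_f indicator_def intro!: ennreal_leI)
    show "(\<lambda>x. ennreal (indicator {a<..} x * act X (f s) x)) \<in> borel_measurable lborel" for X
      unfolding act_f by measurable
  qed
  finally show ?thesis unfolding rate .
qed

lemma measurable_activity[measurable]: "activity a \<in> borel_measurable borel"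
  unfolding activity_SUP[abs_def] by measurable

lemma activity_sq_integral:
  assumes K: "\<And>n X. X \<le> n \<Longrightarrow> (LBINT s:{0..t}. (rate a X (F n s))\<^sup>2) \<le> K"
  shows "(\<integral>\<^sup>+s. indicator {0..t} s * (activity a s)\<^sup>2 \<partial>lborel) \<le> ennreal K"
proof -
  have nn: "0 \<le> rate a X (f s)" for X s by (rule rate_bounds(1)[OF f_density f_mass])
  have inc: "incseq (\<lambda>X. ennreal (rate a X (f s)))" for s
    using rate_f_mono by (auto simp: incseq_def intro!: ennreal_leI)
  have sq: "(activity a s)\<^sup>2 = (SUP X. ennreal ((rate a X (f s))\<^sup>2))" for s
  proof (rule LIMSEQ_unique)
    have "(\<lambda>X. ennreal (rate a X (f s))) \<longlonglongrightarrow> activity a s"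
      unfolding activity_SUP by (rule LIMSEQ_SUP[OF inc])
    then show "(\<lambda>X. (ennreal (rate a X (f s)))\<^sup>2) \<longlonglongrightarrow> (activity a s)\<^sup>2"
      unfolding power2_eq_square by (intro tendsto_mult_ennreal) auto
    have "incseq (\<lambda>X. ennreal ((rate a X (f s))\<^sup>2))"
      using rate_f_mono nn by (auto simp: incseq_def intro!: ennreal_leI power_mono)
    from LIMSEQ_SUP[OF this] show "(\<lambda>X. (ennreal (rate a X (f s)))\<^sup>2) \<longlonglongrightarrow> (SUP X. ennreal ((rate a X (f s))\<^sup>2))"
      using nn by (simp add: ennreal_power)
  qed
  have "(\<integral>\<^sup>+s. indicator {0..t} s * (activity a s)\<^sup>2 \<partial>lborel) =
    (\<integral>\<^sup>+s. (SUP X. ennreal (indicator {0..t} s * (rate a X (f s))\<^sup>2)) \<partial>lborel)"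
    by (rule nn_integral_cong) (auto simp: sq indicator_def)
  also have "\<dots> = (SUP X. \<integral>\<^sup>+s. ennreal (indicator {0..t} s * (rate a X (f s))\<^sup>2) \<partial>lborel)"
  proof (rule nn_integral_monotone_convergence_SUP)
    show "incseq (\<lambda>X s. ennreal (indicator {0..t} s * (rate a X (f s))\<^sup>2))"
      using rate_f_mono nn by (auto simp: incseq_def le_fun_def intro!: ennreal_leI mult_left_mono power_mono)
  qed measurable
  also have "\<dots> \<le> ennreal K"
  proof (rule SUP_least)
    fix X
    note rf = rate_f_sq_integral[of X t a K, OF K]
    have "(\<integral>\<^sup>+s. ennreal (indicator {0..t} s * (rate a X (f s))\<^sup>2) \<partial>lborel) = ennreal (LBINT s:{0..t}. (rate a X (f s))\<^sup>2)"
      using rf(1) unfolding set_lebesgue_integral_def set_integrable_def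
      by (subst nn_integral_eq_integral) auto
    then show "(\<integral>\<^sup>+s. ennreal (indicator {0..t} s * (rate a X (f s))\<^sup>2) \<partial>lborel) \<le> ennreal K"
      using rf(2) by (simp add: ennreal_leI)
  qed
  finally show ?thesis .
qed

lemma activity_bounds:
  assumes t: "0 \<le> t"
  shows "(\<integral>\<^sup>+s. indicator {0..t} s * (activity a s)\<^sup>2 \<partial>lborel) \<le> ennreal (2 * M0)"
    "0 < a \<Longrightarrow> (\<integral>\<^sup>+s. indicator {0..t} s * (activity a s)\<^sup>2 \<partial>lborel) \<le> ennreal (2 * M1 / a)"
  using activity_sq_integral rate_F_sq_integral t by blast+

definition regular_time :: "real \<Rightarrow> bool" where "regular_time s \<longleftrightarrow> activity 0 s < \<infinity>"

lemma measurable_regular_time[measurable]: "Measurable.pred borel regular_time"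
  unfolding regular_time_def[abs_def] by measurable

lemma AE_regular_time: "0 \<le> t \<Longrightarrow> AE s in lborel. s \<in> {0..t} \<longrightarrow> regular_time s"
proof -
  assume t: "0 \<le> t"
  have "AE s in lborel. indicator {0..t} s * (activity 0 s)\<^sup>2 \<noteq> \<infinity>"
    by (rule nn_integral_PInf_AE) (use activity_bounds(1)[OF t, of 0] in \<open>auto intro: le_less_trans simp: top_unique\<close>)
  then show ?thesis
  proof eventually_elim
    case (elim s)
    show ?case
    proof (rule impI, rule ccontr)
      assume "s \<in> {0..t}" "\<not> regular_time s"
      then show False using elim by (simp add: regular_time_def power2_eq_square less_top[symmetric])
    qed
  qed
qed

lemma regular_time_iff: "regular_time s \<longleftrightarrow> size_density (reactant s)"
proof -
  have "activity 0 s = (\<integral>\<^sup>+x. ennreal (reactant s x) \<partial>lborel)"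
    unfolding activity_def using reactant_nonneg(2)[of _ s]
    by (intro nn_integral_cong) (auto simp: indicator_def not_less)
  moreover have "integrable lborel (reactant s) \<longleftrightarrow> (\<integral>\<^sup>+x. ennreal (reactant s x) \<partial>lborel) < \<infinity>"
    using reactant_nonneg(1)[where s=s] by (simp add: integrable_iff_bounded)
  ultimately show ?thesis using reactant_nonneg[where s=s] by (auto simp: regular_time_def size_density_def)
qed

lemma activity_integral:
  assumes "regular_time s"
  shows "enn2real (activity a s) = (LBINT x. indicator {a<..} x * reactant s x)"
proof -
  have d: "size_density (reactant s)" using assms regular_time_iff by simp
  have "integrable lborel (\<lambda>x. indicator {a<..} x * reactant s x)"
    using size_densityD[OF d] by (intro integrable_bounded_mult(1)[where C=1]) (auto simp: indicator_def)
  then show ?thesis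
    unfolding activity_def using reactant_nonneg[where s=s]
    by (subst nn_integral_eq_integral) (auto intro!: integral_nonneg_AE)
qed

lemma activity_sq_set_integrable:
  assumes t: "0 \<le> t" and K: "(\<integral>\<^sup>+s. indicator {0..t} s * (activity a s)\<^sup>2 \<partial>lborel) \<le> ennreal K" "0 \<le> K"
  shows "set_integrable lborel {0..t} (\<lambda>s. (enn2real (activity a s))\<^sup>2)"
    "(LBINT s:{0..t}. (enn2real (activity a s))\<^sup>2) \<le> K"
proof -
  have le: "(\<integral>\<^sup>+s. ennreal (indicator {0..t} s * (enn2real (activity a s))\<^sup>2) \<partial>lborel) \<le> ennreal K"
  proof (rule order_trans[OF nn_integral_mono K(1)])
    fix s
    show "ennreal (indicator {0..t} s * (enn2real (activity a s))\<^sup>2) \<le> indicator {0..t} s * (activity a s)\<^sup>2"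
      by (cases "activity a s") (auto simp: indicator_def ennreal_power)
  qed
  show i: "set_integrable lborel {0..t} (\<lambda>s. (enn2real (activity a s))\<^sup>2)"
    unfolding set_integrable_def
    by (rule integrableI_bounded) (use le in \<open>auto intro: le_less_trans\<close>)
  have "ennreal (LBINT s:{0..t}. (enn2real (activity a s))\<^sup>2) = (\<integral>\<^sup>+s. ennreal (indicator {0..t} s * (enn2real (activity a s))\<^sup>2) \<partial>lborel)"
    using i unfolding set_lebesgue_integral_def set_integrable_def
    by (subst nn_integral_eq_integral) auto
  with le show "(LBINT s:{0..t}. (enn2real (activity a s))\<^sup>2) \<le> K"
    using K(2) by (metis ennreal_le_iff)
qed

text \<open>
  The value \<open>0\<close> at irregular times makes \<open>flux \<phi>\<close> an everywhere defined limit of Borel functions of time.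
\<close>

definition flux :: "(real \<times> real \<Rightarrow> real) \<Rightarrow> real \<Rightarrow> real" where
  "flux \<phi> s = (if regular_time s then pairing \<phi> (reactant s) (reactant s) else 0)"

definition flux_trunc :: "(real \<times> real \<Rightarrow> real) \<Rightarrow> nat \<Rightarrow> (real \<Rightarrow> real) \<Rightarrow> real" where
  "flux_trunc \<phi> X u = pairing \<phi> (act X u) (act X u)"

lemma act_norm_le:
  assumes "size_density u" "(LBINT x. u x) \<le> M0"
  shows "(LBINT x. \<bar>act X u x\<bar>) \<le> b X * M0"
  by (rule order_trans[OF act_bound(2)[OF assms(1)] mult_left_mono[OF assms(2) b_nonneg]])

context
  fixes \<phi> :: "real \<times> real \<Rightarrow> real" and C :: real
  assumes \<phi>[measurable]: "\<phi> \<in> borel_measurable (borel \<Otimes>\<^sub>M borel)" and \<phi>C: "\<And>z. \<bar>\<phi> z\<bar> \<le> C"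
begin

lemma C_nonneg: "0 \<le> C" using \<phi>C[of undefined] by linarith

lemma flux_trunc_bound:
  assumes u: "size_density u" "(LBINT x. u x) \<le> M0"
  shows "\<bar>flux_trunc \<phi> X u\<bar> \<le> C * (b X * M0)\<^sup>2"
proof -
  note a = size_densityD(1)[OF act_bound(1)[OF u(1)]]
  have "\<bar>flux_trunc \<phi> X u\<bar> \<le> C * ((LBINT x. \<bar>act X u x\<bar>) * (LBINT x. \<bar>act X u x\<bar>))"
    unfolding flux_trunc_def by (rule pairing_bound[OF a a \<phi> \<phi>C])
  also have "\<dots> \<le> C * ((b X * M0) * (b X * M0))"
    using act_norm_le[OF u, of X] b_nonneg[of X] M_nonneg C_nonneg by (intro mult_left_mono mult_mono) auto
  finally show ?thesis by (simp add: power2_eq_square)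
qed

lemma flux_trunc_diff:
  assumes u: "size_density u" "(LBINT x. u x) \<le> M0" and v: "size_density v" "(LBINT x. v x) \<le> M0"
  shows "\<bar>flux_trunc \<phi> X u - flux_trunc \<phi> X v\<bar> \<le> (C * (b X * M0 + b X * M0) * b X) * (LBINT x. \<bar>u x - v x\<bar>)"
proof -
  note a = size_densityD(1)[OF act_bound(1)[OF u(1)]] and a' = size_densityD(1)[OF act_bound(1)[OF v(1)]]
  have d: "(LBINT x. \<bar>act X u x - act X v x\<bar>) \<le> b X * (LBINT x. \<bar>u x - v x\<bar>)"
  proof (rule order_trans[OF act_diff_bound[OF u(1) v(1)] mult_left_mono[OF _ b_nonneg]])
    show "(LBINT x. indicator {..real X} x * \<bar>u x - v x\<bar>) \<le> (LBINT x. \<bar>u x - v x\<bar>)"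
      using near_integrable[OF u(1) v(1), of X] size_densityD(1)[OF u(1)] size_densityD(1)[OF v(1)]
      by (intro integral_mono) (auto simp: indicator_def)
  qed
  have "\<bar>flux_trunc \<phi> X u - flux_trunc \<phi> X v\<bar> \<le> C * (((LBINT x. \<bar>act X u x\<bar>) + (LBINT x. \<bar>act X v x\<bar>)) *
      (LBINT x. \<bar>act X u x - act X v x\<bar>))"
    unfolding flux_trunc_def by (rule pairing_diff_bound[OF a a' \<phi> \<phi>C])
  also have "\<dots> \<le> C * ((b X * M0 + b X * M0) * (b X * (LBINT x. \<bar>u x - v x\<bar>)))"
    using act_norm_le[OF u, of X] act_norm_le[OF v, of X] d b_nonneg[of X] M_nonneg C_nonneg
    by (intro mult_left_mono mult_mono add_mono) auto
  finally show ?thesis by (simp add: mult.assoc)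
qed

lemmas flux_trunc_in_time = time_functional[OF flux_trunc_diff[OF F_density F_mass f_density f_mass]
  flux_trunc_bound[OF F_density F_mass]]

lemma measurable_flux_trunc[measurable]: "(\<lambda>s. flux_trunc \<phi> X (f s)) \<in> borel_measurable borel"
  by (rule flux_trunc_in_time(1))

lemma flux_trunc_tendsto_flux:
  assumes s: "regular_time s"
  shows "(\<lambda>X. flux_trunc \<phi> X (f s)) \<longlonglongrightarrow> flux \<phi> s"
proof -
  have d: "size_density (reactant s)" using s regular_time_iff by simp
  note i = integrable_pairing[OF size_densityD(1)[OF d] size_densityD(1)[OF d] \<phi> \<phi>C]
  let ?u = "\<lambda>z. \<phi> z * (reactant s (fst z) * reactant s (snd z))"
  let ?s = "\<lambda>X z. \<phi> z * (act X (f s) (fst z) * act X (f s) (snd z))"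
  have "(\<lambda>X. integral\<^sup>L (lborel \<Otimes>\<^sub>M lborel) (?s X)) \<longlonglongrightarrow> integral\<^sup>L (lborel \<Otimes>\<^sub>M lborel) ?u"
  proof (rule integral_dominated_convergence[where w="\<lambda>z. norm (?u z)"])
    show "?u \<in> borel_measurable (lborel \<Otimes>\<^sub>M lborel)" using i by auto
    show "?s X \<in> borel_measurable (lborel \<Otimes>\<^sub>M lborel)" for X unfolding act_f by measurable
    show "integrable (lborel \<Otimes>\<^sub>M lborel) (\<lambda>z. norm (?u z))" using i by (rule integrable_norm)
    show "AE z in lborel \<Otimes>\<^sub>M lborel. (\<lambda>X. ?s X z) \<longlonglongrightarrow> ?u z"
    proof (rule AE_I2, rule tendsto_eventually)
      fix z :: "real \<times> real"
      obtain N :: nat where N: "max (fst z) (snd z) \<le> real N" using real_arch_simple by blast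
      then have "?s X z = ?u z" if "X \<ge> N" for X using that by (simp add: act_f)
      then show "\<forall>\<^sub>F X in sequentially. ?s X z = ?u z" unfolding eventually_sequentially by blast
    qed
    show "AE z in lborel \<Otimes>\<^sub>M lborel. norm (?s X z) \<le> norm (?u z)" for X
      by (rule AE_I2) (auto simp: act_f indicator_def)
  qed
  then show ?thesis using s by (simp add: flux_def flux_trunc_def pairing_def)
qed

lemma measurable_flux[measurable]: "flux \<phi> \<in> borel_measurable borel"
proof (rule borel_measurable_LIMSEQ_real[where u="\<lambda>X s. if regular_time s then flux_trunc \<phi> X (f s) else 0"])
  fix s show "(\<lambda>X. if regular_time s then flux_trunc \<phi> X (f s) else 0) \<longlonglongrightarrow> flux \<phi> s"
    using flux_trunc_tendsto_flux[of s] by (cases "regular_time s") (simp_all add: flux_def)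
qed measurable

lemma flux_bound: "\<bar>flux \<phi> s\<bar> \<le> C * (enn2real (activity 0 s))\<^sup>2"
proof (cases "regular_time s")
  case True
  then have d: "size_density (reactant s)" using regular_time_iff by simp
  note dd = size_densityD[OF d]
  have "(LBINT x. \<bar>reactant s x\<bar>) = (LBINT x. indicator {0<..} x * reactant s x)"
    using dd by (intro Bochner_Integration.integral_cong) (auto simp: indicator_def not_less)
  then have "(LBINT x. \<bar>reactant s x\<bar>) = enn2real (activity 0 s)"
    using activity_integral[OF True] by simp
  then show ?thesis
    using pairing_bound[OF dd(1) dd(1) \<phi> \<phi>C] True by (simp add: flux_def power2_eq_square)
qed (use C_nonneg in \<open>simp add: flux_def\<close>)

lemma flux_integrable:
  assumes t: "0 \<le> t" shows "set_integrable lborel {0..t} (flux \<phi>)"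
proof -
  have i: "set_integrable lborel {0..t} (\<lambda>s. C * (enn2real (activity 0 s))\<^sup>2)"
    using activity_sq_set_integrable(1)[OF t activity_bounds(1)[OF t]] M_nonneg by (intro set_integrable_mult_right) auto
  show ?thesis
    by (rule set_integrable_bound[OF i])
       (use flux_bound in \<open>auto simp: set_borel_measurable_def intro!: AE_I2 order_trans[OF flux_bound]\<close>)
qed

text \<open>
  The same cutoff error as for the approximations: the limit inherits the square-integral bounds for the
  rate and for its tail.
\<close>

lemma flux_truncation_error:
  assumes t: "0 \<le> t" and X: "0 < X"
  shows "\<bar>(LBINT s:{0..t}. flux \<phi> s) - (LBINT s:{0..t}. flux_trunc \<phi> X (f s))\<bar>
    \<le> 2 * (C * (M0 + M1) / sqrt (real X))"
proof -
  define \<alpha> where "\<alpha> = 1 / sqrt (real X)"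
  have \<alpha>: "0 < \<alpha>" using X by (simp add: \<alpha>_def)
  let ?V = "\<lambda>a s. (enn2real (activity a s))\<^sup>2"
  note V0 = activity_sq_set_integrable[OF t activity_bounds(1)[OF t, of 0]]
  note VX = activity_sq_set_integrable[OF t activity_bounds(2)[OF t, of "real X"]]
  have V: "set_integrable lborel {0..t} (?V 0)" "(LBINT s:{0..t}. ?V 0 s) \<le> 2 * M0"
    "set_integrable lborel {0..t} (?V (real X))" "(LBINT s:{0..t}. ?V (real X) s) \<le> 2 * M1 / real X"
    using V0 VX M_nonneg X by auto
  note fi = flux_integrable[OF t] and ti = flux_trunc_in_time(2)[of t X]
  have "\<bar>(LBINT s:{0..t}. flux \<phi> s) - (LBINT s:{0..t}. flux_trunc \<phi> X (f s))\<bar>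
     = \<bar>LBINT s:{0..t}. (flux \<phi> s - flux_trunc \<phi> X (f s))\<bar>"
    using set_integral_diff(2)[OF fi ti] by simp
  also have "\<dots> \<le> (LBINT s:{0..t}. \<bar>flux \<phi> s - flux_trunc \<phi> X (f s)\<bar>)"
    using set_integral_norm_bound[OF set_integral_diff(1)[OF fi ti]] by simp
  also have "\<dots> \<le> (LBINT s:{0..t}. C * (\<alpha> * ?V 0 s + ?V (real X) s / \<alpha>))"
    unfolding set_lebesgue_integral_def
  proof (rule integral_mono_AE)
    show "integrable lborel (\<lambda>s. indicator {0..t} s *\<^sub>R \<bar>flux \<phi> s - flux_trunc \<phi> X (f s)\<bar>)"
      using set_integrable_abs[OF set_integral_diff(1)[OF fi ti]] by (simp add: set_integrable_def)
    have "set_integrable lborel {0..t} (\<lambda>s. C * (\<alpha> * ?V 0 s + ?V (real X) s / \<alpha>))"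
      using V by (intro set_integrable_mult_right set_integral_add(1) set_integrable_divide) auto
    then show "integrable lborel (\<lambda>s. indicator {0..t} s *\<^sub>R (C * (\<alpha> * ?V 0 s + ?V (real X) s / \<alpha>)))"
      by (simp add: set_integrable_def)
    show "AE s in lborel. indicator {0..t} s *\<^sub>R \<bar>flux \<phi> s - flux_trunc \<phi> X (f s)\<bar>
      \<le> indicator {0..t} s *\<^sub>R (C * (\<alpha> * ?V 0 s + ?V (real X) s / \<alpha>))"
      using AE_regular_time[OF t]
    proof eventually_elim
      case (elim s)
      show ?case
      proof (cases "s \<in> {0..t}")
        case True
        then have s: "regular_time s" using elim by simp
        then have d: "size_density (reactant s)" using regular_time_iff by simp
        have "(LBINT x. reactant s x) = (LBINT x. indicator {0<..} x * reactant s x)"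
          using reactant_nonneg(2)[where s=s] by (intro Bochner_Integration.integral_cong) (auto simp: indicator_def not_less)
        then have "\<bar>flux \<phi> s - flux_trunc \<phi> X (f s)\<bar> \<le> C * (\<alpha> * ?V 0 s + ?V (real X) s / \<alpha>)"
          using pairing_truncation[OF d \<alpha> \<phi> \<phi>C, of "real X"] s
          unfolding flux_trunc_def act_f by (simp add: flux_def activity_integral)
        then show ?thesis using True by simp
      qed simp
    qed
  qed
  also have "\<dots> = C * (\<alpha> * (LBINT s:{0..t}. ?V 0 s) + (LBINT s:{0..t}. ?V (real X) s) / \<alpha>)"
    using V by (simp add: set_integral_add(2))
  also have "\<dots> \<le> C * (\<alpha> * (2 * M0) + (2 * M1 / real X) / \<alpha>)"
    using V C_nonneg \<alpha> by (intro mult_left_mono add_mono divide_right_mono) auto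
  also have "\<dots> = 2 * (C * (M0 + M1) / sqrt (real X))"
  proof -
    have "C * (1 / p * (2 * M0) + (2 * M1 / (p * p)) / (1 / p)) = 2 * (C * (M0 + M1) / p)" if "0 < p" for p
      using that by (simp add: field_simps)
    from this[of "sqrt (real X)"] X show ?thesis by (simp add: \<alpha>_def)
  qed
  finally show ?thesis .
qed

end

text \<open>
  For fixed \<open>X\<close> the truncated equation passes to the limit in \<open>n\<close>; the cutoff error occurs twice, once for the
  approximations and once for the limit, and vanishes as \<open>X\<close> tends to infinity.
\<close>

theorem f_weak_formulation:
  assumes \<theta>: "\<theta> \<in> borel_measurable borel" "\<And>x. \<bar>\<theta> x\<bar> \<le> C" and t: "0 \<le> t"
  shows "(LBINT x. \<theta> x * f t x) - (LBINT x. \<theta> x * f0 x) = 1/2 * (LBINT s:{0..t}. flux (pair_tilde \<theta>) s)"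
proof -
  have \<phi>: "pair_tilde \<theta> \<in> borel_measurable (borel \<Otimes>\<^sub>M borel)" "\<And>z. \<bar>pair_tilde \<theta> z\<bar> \<le> 3 * C"
    using measurable_pair_tilde[OF \<theta>(1)] pair_tilde_bound[of \<theta> C] \<theta>(2) by auto
  define \<Delta> where "\<Delta> = (LBINT x. \<theta> x * f t x) - (LBINT x. \<theta> x * f0 x) - 1/2 * (LBINT s:{0..t}. flux (pair_tilde \<theta>) s)"
  define c where "c = 3 * C * (M0 + M1)"
  have C0: "0 \<le> C" using \<theta>(2)[of 0] by linarith
  have bound: "\<bar>\<Delta>\<bar> \<le> 2 * (c / sqrt (real X))" if X: "0 < X" for X
  proof -
    let ?I = "\<lambda>u. LBINT s:{0..t}. flux_trunc (pair_tilde \<theta>) X (u s)"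
    have lim: "(\<lambda>n. \<bar>(LBINT x. \<theta> x * F (\<sigma> n) t x) - (LBINT x. \<theta> x * f0 x) - 1/2 * ?I (F (\<sigma> n))\<bar>)
       \<longlonglongrightarrow> \<bar>(LBINT x. \<theta> x * f t x) - (LBINT x. \<theta> x * f0 x) - 1/2 * ?I f\<bar>"
      by (intro tendsto_intros tendsto_test[OF \<theta>] flux_trunc_in_time(3)[OF \<phi>])
    have lim2: "(\<lambda>n. 3 * C * (1 / (real n + 1)) + c / sqrt (real X)) \<longlonglongrightarrow> 3 * C * 0 + c / sqrt (real X)"
    proof (intro tendsto_intros)
      show "(\<lambda>n. 1 / (real n + 1)) \<longlonglongrightarrow> 0" using LIMSEQ_inverse_real_of_nat by (simp add: inverse_eq_divide add.commute)
    qed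
    have "\<bar>(LBINT x. \<theta> x * F (\<sigma> n) t x) - (LBINT x. \<theta> x * f0 x) - 1/2 * ?I (F (\<sigma> n))\<bar>
       \<le> 3 * C * (1 / (real n + 1)) + c / sqrt (real X)" if n: "X \<le> n" for n
    proof -
      have "X \<le> \<sigma> n" using n \<sigma>_ge[of n] by simp
      from F_weak_approx[OF \<theta> X this t]
      have "\<bar>(LBINT x. \<theta> x * F (\<sigma> n) t x) - (LBINT x. \<theta> x * f0 x) - 1/2 * ?I (F (\<sigma> n))\<bar>
         \<le> 3 * C / (real (\<sigma> n) + 1) + c / sqrt (real X)" by (simp add: flux_trunc_def c_def)
      also have "3 * C / (real (\<sigma> n) + 1) \<le> 3 * C / (real n + 1)"
        using C0 \<sigma>_ge[of n] by (intro divide_left_mono) auto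
      finally show ?thesis by simp
    qed
    then have "\<bar>(LBINT x. \<theta> x * f t x) - (LBINT x. \<theta> x * f0 x) - 1/2 * ?I f\<bar> \<le> 3 * C * 0 + c / sqrt (real X)"
      by (intro LIMSEQ_le[OF lim lim2]) blast
    moreover have "\<bar>(LBINT s:{0..t}. flux (pair_tilde \<theta>) s) - ?I f\<bar> \<le> 2 * (c / sqrt (real X))"
      using flux_truncation_error[OF \<phi> t X] by (simp add: c_def)
    ultimately show ?thesis unfolding \<Delta>_def by linarith
  qed
  have "(\<lambda>X. c / sqrt (real X)) \<longlonglongrightarrow> 0"
    by (rule real_tendsto_divide_at_top[OF tendsto_const filterlim_compose[OF sqrt_at_top filterlim_real_sequentially]])
  from tendsto_mult[OF tendsto_const[of 2] this] have "(\<lambda>X. 2 * (c / sqrt (real X))) \<longlonglongrightarrow> 0" by simp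
  then have "\<bar>\<Delta>\<bar> \<le> 0"
    by (rule LIMSEQ_le_const) (use bound in \<open>auto intro!: exI[of _ 1]\<close>)
  then show ?thesis by (simp add: \<Delta>_def)
qed

definition dissipation :: "real \<Rightarrow> real" where
  "dissipation t = (LBINT s:{0..t}. (enn2real (activity 0 s))\<^sup>2)"

lemma dissipation_integrable: "0 \<le> t \<Longrightarrow> set_integrable lborel {0..t} (\<lambda>s. (enn2real (activity 0 s))\<^sup>2)"
  using activity_sq_set_integrable(1)[OF _ activity_bounds(1)] M_nonneg by simp

lemma continuous_dissipation: "continuous_on {0..T} dissipation"
proof (cases "0 \<le> T")
  case True
  let ?V = "\<lambda>s. (enn2real (activity 0 s))\<^sup>2"
  have "continuous_on {0..T} (\<lambda>t. integral {0..t} ?V)"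
    using set_borel_integral_eq_integral(1)[OF dissipation_integrable[OF True]]
    by (rule indefinite_integral_continuous_1)
  then show ?thesis
  proof (rule continuous_on_eq)
    show "integral {0..t} ?V = dissipation t" if "t \<in> {0..T}" for t
      using set_borel_integral_eq_integral(2)[OF dissipation_integrable, of t] that by (simp add: dissipation_def)
  qed
qed simp

text \<open>
  The weak formulation between \<open>s\<close> and \<open>t\<close>, tested with the sign of \<open>f t - f s\<close>; the kernel is then bounded
  by \<open>3\<close>.
\<close>

theorem f_L1_modulus:
  assumes "0 \<le> s" "s \<le> t"
  shows "(LBINT x. \<bar>f t x - f s x\<bar>) \<le> 3 / 2 * (dissipation t - dissipation s)"
proof -
  define \<theta> where "\<theta> = (\<lambda>x. sgn (f t x - f s x))"
  have \<theta>: "\<theta> \<in> borel_measurable borel" "\<And>x. \<bar>\<theta> x\<bar> \<le> 1"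
  proof -
    show "\<theta> \<in> borel_measurable borel" unfolding \<theta>_def by measurable
  qed (auto simp: \<theta>_def sgn_if)
  have \<phi>: "pair_tilde \<theta> \<in> borel_measurable (borel \<Otimes>\<^sub>M borel)" "\<And>z. \<bar>pair_tilde \<theta> z\<bar> \<le> 3"
    using measurable_pair_tilde[OF \<theta>(1)] pair_tilde_bound[of \<theta> 1] \<theta>(2) by auto
  have t: "0 \<le> t" using assms by simp
  have i: "integrable lborel (\<lambda>x. \<theta> x * f u x)" for u
    by (rule integrable_bounded_mult(1)[OF size_densityD(1)[OF f_density] _ \<theta>(2)]) (use \<theta>(1) in simp)
  let ?V = "\<lambda>s. (enn2real (activity 0 s))\<^sup>2" and ?q = "flux (pair_tilde \<theta>)"
  have split: "(LBINT u:{0..t}. w u) = (LBINT u:{0..s}. w u) + (LBINT u:{s<..t}. w u)"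
    and sub: "set_integrable lborel {s<..t} w"
    if w: "set_integrable lborel {0..t} w" for w :: "real \<Rightarrow> real"
  proof -
    have e: "{0..t} = {0..s} \<union> {s<..t}" using assms by auto
    have "set_integrable lborel {0..s} w" by (rule set_integrable_subset[OF w]) (use assms in auto)
    moreover show "set_integrable lborel {s<..t} w" by (rule set_integrable_subset[OF w]) (use assms in auto)
    ultimately show "(LBINT u:{0..t}. w u) = (LBINT u:{0..s}. w u) + (LBINT u:{s<..t}. w u)"
      unfolding e by (intro set_integral_Un) auto
  qed
  note fi = flux_integrable[OF \<phi> t] and di = dissipation_integrable[OF t]
  have pt: "\<theta> x * f t x - \<theta> x * f s x = \<bar>f t x - f s x\<bar>" for x
    by (simp add: \<theta>_def abs_sgn algebra_simps)
  have "(LBINT x. \<bar>f t x - f s x\<bar>) = (LBINT x. \<theta> x * f t x) - (LBINT x. \<theta> x * f s x)"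
    using Bochner_Integration.integral_diff[OF i[of t] i[of s]] by (simp only: pt)
  also have "\<dots> = 1/2 * (LBINT u:{s<..t}. ?q u)"
    using f_weak_formulation[OF \<theta> t] f_weak_formulation[OF \<theta> assms(1)] split[OF fi] by simp
  also have "\<dots> \<le> 1/2 * (LBINT u:{s<..t}. 3 * ?V u)"
  proof -
    have "(LBINT u:{s<..t}. ?q u) \<le> (LBINT u:{s<..t}. 3 * ?V u)"
    proof (rule set_integral_mono[OF sub[OF fi] set_integrable_mult_right[OF sub[OF di]]])
      show "?q u \<le> 3 * ?V u" for u using flux_bound[OF \<phi>, of u] by linarith
    qed
    then show ?thesis by simp
  qed
  also have "\<dots> = 3 / 2 * (dissipation t - dissipation s)"
    using split[OF di] by (simp add: dissipation_def)
  finally show ?thesis .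
qed

end

section \<open>Passing between Borel and Lebesgue representatives\<close>

text \<open>
  A function that agrees almost everywhere with a Borel function is Lebesgue measurable, because
  Lebesgue measure is complete.
\<close>

lemma lebesgue_integral_representative:
  fixes u v :: "'a::euclidean_space \<Rightarrow> real"
  assumes S: "S \<in> sets borel" and u: "u \<in> borel_measurable borel"
    and ae: "AE x in lborel. x \<in> S \<longrightarrow> v x = u x"
  shows "(LINT x:S|lebesgue. v x) = (LINT x:S|lborel. u x)"
    and "v absolutely_integrable_on S \<longleftrightarrow> set_integrable lborel S u"
proof -
  have mu: "(\<lambda>x. indicator S x *\<^sub>R u x) \<in> borel_measurable lborel" using S u by simp
  have ae': "AE x in lebesgue. indicator S x *\<^sub>R u x = indicator S x *\<^sub>R v x"
    by (rule AE_completion, use ae in eventually_elim) (auto simp: indicator_def)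
  have mv: "(\<lambda>x. indicator S x *\<^sub>R v x) \<in> borel_measurable lebesgue"
    by (rule borel_measurable_AE[OF measurable_completion[OF mu] ae'])
  have "(LINT x:S|lebesgue. v x) = (\<integral>x. indicator S x *\<^sub>R u x \<partial>lebesgue)"
    unfolding set_lebesgue_integral_def
    by (rule integral_cong_AE[OF mv measurable_completion[OF mu] AE_symmetric[OF ae']])
  also have "\<dots> = (LINT x:S|lborel. u x)"
    unfolding set_lebesgue_integral_def by (rule integral_completion[OF mu])
  finally show "(LINT x:S|lebesgue. v x) = (LINT x:S|lborel. u x)" .
  have "v absolutely_integrable_on S \<longleftrightarrow> integrable lebesgue (\<lambda>x. indicator S x *\<^sub>R u x)"
    unfolding set_integrable_def
    by (rule integrable_cong_AE[OF mv measurable_completion[OF mu] AE_symmetric[OF ae']])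
  also have "\<dots> \<longleftrightarrow> set_integrable lborel S u"
    unfolding set_integrable_def by (rule integrable_completion[OF mu])
  finally show "v absolutely_integrable_on S \<longleftrightarrow> set_integrable lborel S u" .
qed

lemma lebesgue_integral_half_line:
  fixes u v :: "real \<Rightarrow> real"
  assumes u: "u \<in> borel_measurable borel" "\<And>x. x \<le> 0 \<Longrightarrow> u x = 0"
    and ae: "AE x in lborel. 0 < x \<longrightarrow> v x = u x"
  shows "(LINT x:{0<..}|lebesgue. v x) = (LBINT x. u x)"
    and "v absolutely_integrable_on {0<..} \<longleftrightarrow> integrable lborel u"
proof -
  have e: "indicator {0<..} x *\<^sub>R u x = u x" for x using u(2)[of x] by (auto simp: indicator_def)
  have ae': "AE x in lborel. x \<in> {0<..} \<longrightarrow> v x = u x" using ae by simp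
  note L = lebesgue_integral_representative[OF _ u(1) ae']
  show "(LINT x:{0<..}|lebesgue. v x) = (LBINT x. u x)"
    using L(1) unfolding set_lebesgue_integral_def e by simp
  show "v absolutely_integrable_on {0<..} \<longleftrightarrow> integrable lborel u"
    using L(2) unfolding set_integrable_def[of lborel] e by simp
qed

lemma Borel_representative:
  fixes v :: "real \<Rightarrow> real"
  assumes "v \<in> borel_measurable (lebesgue_on {0<..})"
  obtains u where "u \<in> borel_measurable borel" "\<And>x. x \<le> 0 \<Longrightarrow> u x = 0" "AE x in lborel. 0 < x \<longrightarrow> v x = u x"
proof -
  have "(\<lambda>x. if x \<in> {0<..} then v x else 0) \<in> borel_measurable lebesgue"
    using assms borel_measurable_if[of "{0<..}" v] by simp
  then obtain g where g: "g \<in> borel_measurable lborel" "AE x in lborel. (if x \<in> {0<..} then v x else 0) = g x"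
    using completion_ex_borel_measurable_real by blast
  show ?thesis
  proof (rule that[of "\<lambda>x. indicator {0<..} x * g x"])
    show "(\<lambda>x. indicator {0<..} x * g x) \<in> borel_measurable borel" using g(1) by simp
    show "AE x in lborel. 0 < x \<longrightarrow> v x = indicator {0<..} x * g x"
      using g(2) by eventually_elim auto
  qed simp
qed

lemma AE_half_line_iff:
  "(AE x in lebesgue_on {0<..}. P x) \<longleftrightarrow> (AE x in lborel. (0::real) < x \<longrightarrow> P x)"
  by (subst AE_restrict_space_iff) (auto simp: AE_completion_iff)

lemma Linf_representative:
  assumes "\<theta> \<in> Linf"
  obtains \<theta>' C N where "\<theta>' \<in> borel_measurable borel" "\<And>x. \<bar>\<theta>' x\<bar> \<le> C"
    "N \<in> null_sets lborel" "\<And>x. 0 < x \<Longrightarrow> x \<notin> N \<Longrightarrow> \<theta> x = \<theta>' x"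
proof -
  obtain C where C: "AE x in lborel. 0 < x \<longrightarrow> \<bar>\<theta> x\<bar> \<le> C"
    using assms by (auto simp: Linf_def AE_half_line_iff)
  obtain u where u: "u \<in> borel_measurable borel" "AE x in lborel. 0 < x \<longrightarrow> \<theta> x = u x"
    by (rule Borel_representative[of \<theta>]) (use assms in \<open>auto simp: Linf_def\<close>)
  let ?\<theta> = "\<lambda>x. max (- \<bar>C\<bar>) (min \<bar>C\<bar> (u x))"
  have "AE x in lborel. 0 < x \<longrightarrow> \<theta> x = ?\<theta> x"
    using C u(2) by eventually_elim auto
  then obtain N where N: "{x \<in> space lborel. \<not> (0 < x \<longrightarrow> \<theta> x = ?\<theta> x)} \<subseteq> N" "N \<in> null_sets lborel"
    by (auto elim!: AE_E simp: null_sets_def)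
  show ?thesis
  proof (rule that[of ?\<theta> "\<bar>C\<bar>" N])
    show "?\<theta> \<in> borel_measurable borel" using u(1) by simp
    show "\<theta> x = ?\<theta> x" if "0 < x" "x \<notin> N" for x using N that by auto
  qed (use N in auto)
qed

lemma null_set_translate:
  fixes N :: "real set"
  assumes "N \<in> null_sets lborel"
  shows "AE y in lborel. x + y \<notin> N"
proof -
  have "AE y in distr lborel borel ((+) x). y \<notin> N"
    by (subst lborel_distr_plus) (rule AE_not_in[OF assms])
  then show ?thesis using assms by (subst (asm) AE_distr_iff) (auto simp: null_sets_def)
qed

text \<open>
  The collision term evaluates the test function at \<open>x\<close>, \<open>y\<close> and \<open>x + y\<close>. Changing it on a null set is
  harmless because for each \<open>x\<close> almost every translate by \<open>y\<close> avoids the null set.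
\<close>

lemma null_set_pairs:
  fixes N :: "real set"
  assumes N: "N \<in> null_sets lborel"
  shows "AE z in lborel. fst z \<notin> N \<and> snd z \<notin> N \<and> fst z + snd z \<notin> N"
proof -
  have [measurable]: "N \<in> sets borel" using N by auto
  have "AE z in lborel \<Otimes>\<^sub>M lborel. fst z \<notin> N \<and> snd z \<notin> N \<and> fst z + snd z \<notin> N"
  proof (rule lborel_pair.AE_pair_measure)
    show "{z \<in> space (lborel \<Otimes>\<^sub>M lborel). fst z \<notin> N \<and> snd z \<notin> N \<and> fst z + snd z \<notin> N} \<in> sets (lborel \<Otimes>\<^sub>M lborel)"
      by measurable
    show "AE x in lborel. AE y in lborel. fst (x, y) \<notin> N \<and> snd (x, y) \<notin> N \<and> fst (x, y) + snd (x, y) \<notin> N"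
      using AE_not_in[OF N]
    proof eventually_elim
      case (elim x)
      show ?case using AE_not_in[OF N] null_set_translate[OF N, of x] by eventually_elim (use elim in auto)
    qed
  qed
  then show ?thesis by (subst lborel_prod[symmetric])
qed

section \<open>The limit as a solution in the Lebesgue setting\<close>

context coagulation_limit
begin

lemma flux_representative:
  assumes s: "regular_time s" and \<theta>: "\<theta>' \<in> borel_measurable borel" "\<And>x. \<bar>\<theta>' x\<bar> \<le> C"
    and N: "N \<in> null_sets lborel" "\<And>x. 0 < x \<Longrightarrow> x \<notin> N \<Longrightarrow> \<theta> x = \<theta>' x"
    and K: "\<And>x y. 0 < x \<Longrightarrow> 0 < y \<Longrightarrow> K x y = r x * r y"
  shows "(LINT x:{0<..}|lebesgue. LINT y:{0<..}|lebesgue. tilde \<theta> x y * K x y * f s x * f s y) = flux (pair_tilde \<theta>') s"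
    and "(\<lambda>(x, y). tilde \<theta> x y * K x y * f s x * f s y) absolutely_integrable_on ({0<..} \<times> {0<..})"
proof -
  let ?\<phi> = "pair_tilde \<theta>'" and ?w = "reactant s"
  have \<phi>: "?\<phi> \<in> borel_measurable (borel \<Otimes>\<^sub>M borel)" "\<And>z. \<bar>?\<phi> z\<bar> \<le> 3 * C"
    using measurable_pair_tilde[OF \<theta>(1)] pair_tilde_bound[of \<theta>' C] \<theta>(2) by auto
  note [measurable] = \<phi>(1)
  have d: "size_density ?w" using s regular_time_iff by simp
  note wi = size_densityD(1)[OF d] and w0 = size_densityD(4)[OF d]
  note i = integrable_pairing[OF wi wi \<phi>]
  have eq: "tilde \<theta> x y * K x y * f s x * f s y = ?\<phi> (x, y) * (?w x * ?w y)"
    if "0 < x" "0 < y" "x \<notin> N" "y \<notin> N" "x + y \<notin> N" for x y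
  proof -
    have "\<theta> x = \<theta>' x" "\<theta> y = \<theta>' y" "\<theta> (x + y) = \<theta>' (x + y)" using N(2) that by auto
    then show ?thesis using K[OF that(1,2)] by (simp add: pair_tilde_def tilde_def reactant_def)
  qed
  have inner: "(LINT y:{0<..}|lebesgue. tilde \<theta> x y * K x y * f s x * f s y) = (LBINT y. ?\<phi> (x, y) * (?w x * ?w y))"
    if x: "0 < x" "x \<notin> N" for x
  proof (rule lebesgue_integral_half_line(1))
    show "(\<lambda>y. ?\<phi> (x, y) * (?w x * ?w y)) \<in> borel_measurable borel" by measurable
    show "AE y in lborel. 0 < y \<longrightarrow> tilde \<theta> x y * K x y * f s x * f s y = ?\<phi> (x, y) * (?w x * ?w y)"
      using AE_not_in[OF N(1)] null_set_translate[OF N(1), of x] by eventually_elim (use eq x in blast)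
  qed (simp add: w0)
  have "(LINT x:{0<..}|lebesgue. LINT y:{0<..}|lebesgue. tilde \<theta> x y * K x y * f s x * f s y)
    = (LBINT x. (LBINT y. ?\<phi> (x, y) * (?w x * ?w y)))"
  proof (rule lebesgue_integral_half_line(1))
    show "(\<lambda>x. LBINT y. ?\<phi> (x, y) * (?w x * ?w y)) \<in> borel_measurable borel" by measurable
    show "AE x in lborel. 0 < x \<longrightarrow> (LINT y:{0<..}|lebesgue. tilde \<theta> x y * K x y * f s x * f s y)
       = (LBINT y. ?\<phi> (x, y) * (?w x * ?w y))"
      using AE_not_in[OF N(1)] by eventually_elim (use inner in blast)
  qed (simp add: w0)
  also have "\<dots> = flux ?\<phi> s"
    using s pairing_iterated[OF wi wi \<phi>] by (simp add: flux_def)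
  finally show "(LINT x:{0<..}|lebesgue. LINT y:{0<..}|lebesgue. tilde \<theta> x y * K x y * f s x * f s y) = flux ?\<phi> s" .
  have i': "integrable lborel (\<lambda>z. ?\<phi> z * (?w (fst z) * ?w (snd z)))" using i by (simp add: lborel_prod)
  have "set_integrable lborel ({0<..} \<times> {0<..}) (\<lambda>z. ?\<phi> z * (?w (fst z) * ?w (snd z)))"
    unfolding set_integrable_def
    by (rule integrable_mult_indicator[OF _ i']) (auto intro!: borel_open open_Times)
  moreover have "(\<lambda>(x, y). tilde \<theta> x y * K x y * f s x * f s y) absolutely_integrable_on ({0<..} \<times> {0<..}) \<longleftrightarrow>
    set_integrable lborel ({0<..} \<times> {0<..}) (\<lambda>z. ?\<phi> z * (?w (fst z) * ?w (snd z)))"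
  proof (rule lebesgue_integral_representative(2))
    show "(\<lambda>z. ?\<phi> z * (?w (fst z) * ?w (snd z))) \<in> borel_measurable borel" using i' by simp
    show "AE z in lborel. z \<in> {0<..} \<times> {0<..} \<longrightarrow> (case z of (x, y) \<Rightarrow> tilde \<theta> x y * K x y * f s x * f s y)
       = ?\<phi> z * (?w (fst z) * ?w (snd z))"
      using null_set_pairs[OF N(1)] by eventually_elim (auto simp: eq)
  qed (auto intro!: borel_open open_Times)
  ultimately show "(\<lambda>(x, y). tilde \<theta> x y * K x y * f s x * f s y) absolutely_integrable_on ({0<..} \<times> {0<..})" by simp
qed

theorem f_coagulation:
  assumes \<theta>: "\<theta> \<in> Linf" and t: "0 < t"
    and K: "\<And>x y. 0 < x \<Longrightarrow> 0 < y \<Longrightarrow> K x y = r x * r y"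
    and f_in: "AE x in lborel. 0 < x \<longrightarrow> f_in x = f0 x"
  shows "coag_integrable K f \<theta> t"
    and "(LINT x:{0<..}|lebesgue. \<theta> x * (f t x - f_in x)) =
       1 / 2 * (LINT s:{0<..<t}|lebesgue. LINT x:{0<..}|lebesgue. LINT y:{0<..}|lebesgue.
                    tilde \<theta> x y * K x y * f s x * f s y)"
proof -
  obtain \<theta>' C N where \<theta>': "\<theta>' \<in> borel_measurable borel" "\<And>x. \<bar>\<theta>' x\<bar> \<le> C"
    and N: "N \<in> null_sets lborel" "\<And>x. 0 < x \<Longrightarrow> x \<notin> N \<Longrightarrow> \<theta> x = \<theta>' x"
    by (rule Linf_representative[OF \<theta>]) blast
  let ?q = "\<lambda>s. LINT x:{0<..}|lebesgue. LINT y:{0<..}|lebesgue. tilde \<theta> x y * K x y * f s x * f s y"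
  let ?\<phi> = "pair_tilde \<theta>'"
  have \<phi>: "?\<phi> \<in> borel_measurable (borel \<Otimes>\<^sub>M borel)" "\<And>z. \<bar>?\<phi> z\<bar> \<le> 3 * C"
    using measurable_pair_tilde[OF \<theta>'(1)] pair_tilde_bound[of \<theta>' C] \<theta>'(2) by auto
  have t0: "0 \<le> t" using t by simp
  note reg = AE_regular_time[OF t0]
  note rep = flux_representative[OF _ \<theta>' N K]
  have aeq: "AE s in lborel. s \<in> {0<..<t} \<longrightarrow> ?q s = flux ?\<phi> s"
    using reg by eventually_elim (use rep(1) in auto)
  have fi: "set_integrable lborel {0<..<t} (flux ?\<phi>)"
    by (rule set_integrable_subset[OF flux_integrable[OF \<phi> t0]]) auto
  note L = lebesgue_integral_representative[OF _ measurable_flux[OF \<phi>] aeq]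
  have "AE s\<in>{0<..<t} in lebesgue.
        (\<lambda>(x, y). tilde \<theta> x y * K x y * f s x * f s y) absolutely_integrable_on ({0<..} \<times> {0<..})"
    by (rule AE_completion, use reg in eventually_elim) (use rep(2) in auto)
  moreover have "?q absolutely_integrable_on {0<..<t}" using L(2) fi by simp
  ultimately show "coag_integrable K f \<theta> t" by (simp add: coag_integrable_def)
  have open_closed: "(LBINT s:{0<..<t}. flux ?\<phi> s) = (LBINT s:{0..t}. flux ?\<phi> s)"
    unfolding set_lebesgue_integral_def
  proof (rule integral_cong_AE)
    show "AE s in lborel. indicator {0<..<t} s *\<^sub>R flux ?\<phi> s = indicator {0..t} s *\<^sub>R flux ?\<phi> s"
      using AE_lborel_singleton[of 0] AE_lborel_singleton[of t] by eventually_elim (auto simp: indicator_def)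
  qed (use measurable_flux[OF \<phi>] in auto)
  have fd: "integrable lborel (\<lambda>x. \<theta>' x * u x)" if "size_density u" for u
    by (rule integrable_bounded_mult(1)[OF size_densityD(1)[OF that] _ \<theta>'(2)]) (use \<theta>'(1) in simp)
  have "(LINT x:{0<..}|lebesgue. \<theta> x * (f t x - f_in x)) = (LBINT x. \<theta>' x * f t x - \<theta>' x * f0 x)"
  proof (rule lebesgue_integral_half_line(1))
    show "(\<lambda>x. \<theta>' x * f t x - \<theta>' x * f0 x) \<in> borel_measurable borel"
      using \<theta>'(1) size_densityD(2)[OF f0] by simp
    show "\<theta>' x * f t x - \<theta>' x * f0 x = 0" if "x \<le> 0" for x
      using size_densityD(4)[OF f0 that] size_densityD(4)[OF f_density that] by simp
    show "AE x in lborel. 0 < x \<longrightarrow> \<theta> x * (f t x - f_in x) = \<theta>' x * f t x - \<theta>' x * f0 x"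
      using AE_not_in[OF N(1)] f_in by eventually_elim (simp add: N(2) right_diff_distrib)
  qed
  also have "\<dots> = (LBINT x. \<theta>' x * f t x) - (LBINT x. \<theta>' x * f0 x)"
    using fd[OF f_density] fd[OF f0] by simp
  also have "\<dots> = 1/2 * (LBINT s:{0..t}. flux ?\<phi> s)" by (rule f_weak_formulation[OF \<theta>' t0])
  also have "\<dots> = 1/2 * (LINT s:{0<..<t}|lebesgue. ?q s)" using L(1) open_closed by simp
  finally show "(LINT x:{0<..}|lebesgue. \<theta> x * (f t x - f_in x)) = 1 / 2 * (LINT s:{0<..<t}|lebesgue. ?q s)" .
qed

lemma size_density_L1: "size_density u \<Longrightarrow> u \<in> L1"
proof -
  assume u: "size_density u"
  have "u absolutely_integrable_on {0<..} \<longleftrightarrow> integrable lborel u"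
    by (rule lebesgue_integral_half_line(2)) (use size_densityD[OF u] in auto)
  then show "u \<in> L1" using size_densityD(1)[OF u] by (simp add: L1_def)
qed

lemma size_density_moments:
  assumes u: "size_density u" and ae: "AE x in lborel. 0 < x \<longrightarrow> v x = u x"
  shows "moment 0 v = (LBINT x. u x)" "moment 1 v = (LBINT x. x * u x)"
proof -
  note ud = size_densityD[OF u]
  show "moment 0 v = (LBINT x. u x)"
    unfolding moment_def
  proof (rule lebesgue_integral_half_line(1))
    show "AE x in lborel. 0 < x \<longrightarrow> x powr 0 * v x = u x" using ae by eventually_elim auto
  qed (use ud in auto)
  show "moment 1 v = (LBINT x. x * u x)"
    unfolding moment_def
  proof (rule lebesgue_integral_half_line(1))
    show "AE x in lborel. 0 < x \<longrightarrow> x powr 1 * v x = x * u x" using ae by eventually_elim auto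
  qed (use ud in auto)
qed

lemma f_moments:
  assumes "AE x in lborel. 0 < x \<longrightarrow> f_in x = f0 x"
  shows "moment 0 (f t) \<le> moment 0 f_in" "moment 1 (f t) \<le> moment 1 f_in"
  using size_density_moments[OF f0 assms] size_density_moments[OF f_density, of "f t" t] f_mass[of t] f_first_moment(2)[of t]
  by (simp_all add: M0_def M1_def)

lemma weighted_half_line:
  assumes u: "u \<in> borel_measurable borel" "\<And>x. x \<le> 0 \<Longrightarrow> u x = 0"
  shows "norm_L1_weighted 1 u = (LBINT x. (1 + x) * \<bar>u x\<bar>)"
    and "u \<in> L1_weighted 1 \<longleftrightarrow> integrable lborel u \<and> integrable lborel (\<lambda>x. (1 + x) * \<bar>u x\<bar>)"
proof -
  have m: "(\<lambda>x. (1 + x) * \<bar>u x\<bar>) \<in> borel_measurable borel" using u(1) by simp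
  note L = lebesgue_integral_half_line[OF m, of "\<lambda>x. (1 + x powr 1) * \<bar>u x\<bar>"]
  show "norm_L1_weighted 1 u = (LBINT x. (1 + x) * \<bar>u x\<bar>)"
    unfolding norm_L1_weighted_def using u by (intro L(1)) auto
  show "u \<in> L1_weighted 1 \<longleftrightarrow> integrable lborel u \<and> integrable lborel (\<lambda>x. (1 + x) * \<bar>u x\<bar>)"
    unfolding L1_weighted_def L1_def using lebesgue_integral_half_line(2)[OF u, of u] L(2) u by auto
qed

lemma f_L1_weighted: "f t \<in> L1_weighted 1" "norm_L1_weighted 1 (f t) \<le> M0 + M1"
proof -
  note fd = size_densityD[OF f_density[of t]] and ff = f_first_moment[of t]
  have e: "(1 + x) * \<bar>f t x\<bar> = f t x + x * f t x" for x using fd(3)[of x] by (simp add: algebra_simps)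
  have "f t \<in> L1_weighted 1 \<longleftrightarrow> integrable lborel (f t) \<and> integrable lborel (\<lambda>x. (1 + x) * \<bar>f t x\<bar>)"
    by (rule weighted_half_line(2)) (use fd in auto)
  then show "f t \<in> L1_weighted 1" unfolding e using fd(1) ff(1) by simp
  have "norm_L1_weighted 1 (f t) = (LBINT x. (1 + x) * \<bar>f t x\<bar>)"
    by (rule weighted_half_line(1)) (use fd in auto)
  then show "norm_L1_weighted 1 (f t) \<le> M0 + M1"
    unfolding e using fd(1) ff f_mass[of t] by simp
qed

lemma f_C_L1: "f \<in> C_L1"
proof -
  have norm: "norm_L1 (\<lambda>x. f s x - f t x) = (LBINT x. \<bar>f s x - f t x\<bar>)" for s t
    unfolding norm_L1_def
    by (rule lebesgue_integral_half_line(1)) (auto simp: size_densityD(4)[OF f_density])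
  have bound: "(LBINT x. \<bar>f s x - f t x\<bar>) \<le> 3 / 2 * \<bar>dissipation s - dissipation t\<bar>" if "0 \<le> s" "0 \<le> t" for s t
  proof -
    have 1: "(LBINT x. \<bar>f v x - f u x\<bar>) \<le> 3 / 2 * \<bar>dissipation v - dissipation u\<bar>" if "0 \<le> u" "u \<le> v" for u v
      by (rule order_trans[OF f_L1_modulus[OF that] mult_left_mono[OF abs_ge_self]]) simp
    have 2: "(LBINT x. \<bar>f s x - f t x\<bar>) = (LBINT x. \<bar>f t x - f s x\<bar>)" by (simp add: abs_minus_commute)
    show ?thesis
    proof (cases "t \<le> s")
      case True
      then show ?thesis using that by (intro 1) auto
    next
      case False
      then have "(LBINT x. \<bar>f t x - f s x\<bar>) \<le> 3 / 2 * \<bar>dissipation t - dissipation s\<bar>"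
        using that by (intro 1) auto
      then show ?thesis by (simp only: 2 abs_minus_commute[of "dissipation s"])
    qed
  qed
  have "((\<lambda>s. norm_L1 (\<lambda>x. f s x - f t x)) \<longlongrightarrow> 0) (at t within {0..})" if t: "0 \<le> t" for t
  proof -
    have "(dissipation \<longlongrightarrow> dissipation t) (at t within {0..t+1})"
      using continuous_dissipation[of "t+1"] t by (auto simp: continuous_on_def)
    moreover have "at t within {0..t+1} = at t within {0..}"
      by (rule at_within_nhd[of t "{t-1<..<t+1}"]) auto
    ultimately have "((\<lambda>s. 3 / 2 * \<bar>dissipation s - dissipation t\<bar>) \<longlongrightarrow> 3 / 2 * \<bar>dissipation t - dissipation t\<bar>) (at t within {0..})"
      by (intro tendsto_intros) simp
    then have lim: "((\<lambda>s. 3 / 2 * \<bar>dissipation s - dissipation t\<bar>) \<longlongrightarrow> 0) (at t within {0..})" by simp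
    show ?thesis
    proof (rule Lim_null_comparison[OF _ lim])
      show "\<forall>\<^sub>F s in at t within {0..}. norm (norm_L1 (\<lambda>x. f s x - f t x)) \<le> 3 / 2 * \<bar>dissipation s - dissipation t\<bar>"
        unfolding eventually_at_filter by (rule always_eventually) (use bound[OF _ t] in \<open>auto simp: norm\<close>)
    qed
  qed
  then show ?thesis using size_density_L1[OF f_density] by (simp add: C_L1_def)
qed

text \<open>
  Cut off at size \<open>n\<close> and time \<open>n\<close>, a sufficiently late Euler approximation is a simple function of time. Up to
  size \<open>n\<close> the weight is at most \<open>1 + n\<close>, so an \<open>L\<^sup>1\<close> error of \<open>1 / (n + 1)\<^sup>2\<close> suffices; beyond size \<open>n\<close> the
  weighted mass of \<open>f t\<close> tends to \<open>0\<close>.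
\<close>

lemma f_Linf_L1_weighted: "f \<in> Linf_L1_weighted 1"
proof -
  have "\<forall>n. \<exists>N. \<forall>t\<le>real n. (LBINT x. \<bar>F (\<sigma> N) t x - f t x\<bar>) \<le> 1 / (real n + 1)\<^sup>2"
  proof
    fix n :: nat
    have "0 < 1 / (real n + 1)\<^sup>2" by simp
    from f_limit[OF this, of "real n"]
    show "\<exists>N. \<forall>t\<le>real n. (LBINT x. \<bar>F (\<sigma> N) t x - f t x\<bar>) \<le> 1 / (real n + 1)\<^sup>2" by blast
  qed
  from choice[OF this] obtain \<nu> where
    \<nu>: "\<And>n t. t \<le> real n \<Longrightarrow> (LBINT x. \<bar>F (\<sigma> (\<nu> n)) t x - f t x\<bar>) \<le> 1 / (real n + 1)\<^sup>2" by blast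
  define k where "k n = \<sigma> (\<nu> n)" for n
  define \<phi> where "\<phi> n t = (if t \<le> real n then (\<lambda>x. indicator {..real n} x * F (k n) t x) else (\<lambda>x. 0))" for n t
  have \<phi>_meas: "\<phi> n t \<in> borel_measurable borel" and \<phi>_zero: "x \<le> 0 \<Longrightarrow> \<phi> n t x = 0" for n t x
    using size_densityD(2,4)[OF F_density[of "k n" t]] by (auto simp: \<phi>_def)
  have simple: "simple_function (lebesgue_on {0<..}) (\<phi> n)" for n
  proof -
    \<comment> \<open>Index \<open>0\<close> stands for the times after \<open>n\<close>, where the approximation vanishes.\<close>
    define idx where "idx = (\<lambda>t. if t \<le> real n then Suc (step_idx (h (k n)) t) else 0)"
    define lift where "lift = (\<lambda>j x. if j = 0 then 0 else indicator {..real n} x * euler (k n) (j - 1) x)"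
    have eq: "\<phi> n = (\<lambda>t. lift (idx t))" by (auto simp: \<phi>_def idx_def lift_def F_def fun_eq_iff)
    have "idx \<in> lborel \<rightarrow>\<^sub>M count_space UNIV" unfolding idx_def by measurable
    then have m: "idx \<in> lebesgue_on {0<..} \<rightarrow>\<^sub>M count_space UNIV"
      by (intro measurable_restrict_space1 measurable_completion)
    have "idx t \<le> Suc (step_idx (h (k n)) (real n))" for t
      using step_idx_mono[OF h_pos, of t "real n" "k n"] by (auto simp: idx_def)
    then have "idx ` space (lebesgue_on {0<..}) \<subseteq> {..Suc (step_idx (h (k n)) (real n))}" by auto
    then have "finite (idx ` space (lebesgue_on {0<..}))" by (rule finite_subset) simp
    then have "simple_function (lebesgue_on {0<..}) idx"
      using measurable_sets[OF m] by (auto simp: simple_function_def)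
    then show ?thesis unfolding eq by (rule simple_function_compose1)
  qed
  have mem: "\<phi> n t \<in> L1_weighted 1" for n t
  proof -
    note Fi = size_densityD(1)[OF F_density[of "k n" t]] and F0 = size_densityD(3,4)[OF F_density[of "k n" t]]
    have i1: "integrable lborel (\<phi> n t)"
      using integrable_bounded_mult(1)[OF Fi, of "indicator {..real n}" 1] by (auto simp: \<phi>_def indicator_def)
    have iF: "integrable lborel (\<lambda>x. (indicator {0<..real n} x * (1 + x)) * F (k n) t x)"
      by (rule integrable_bounded_mult(1)[OF Fi, where C="1 + real n"]) (auto simp: indicator_def)
    have e: "(1 + x) * \<bar>\<phi> n t x\<bar> = (if t \<le> real n then (indicator {0<..real n} x * (1 + x)) * F (k n) t x else 0)" for x
      using F0(1)[of x] F0(2)[of x] by (auto simp: \<phi>_def indicator_def)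
    have i2: "integrable lborel (\<lambda>x. (1 + x) * \<bar>\<phi> n t x\<bar>)"
      unfolding e using iF by (cases "t \<le> real n") simp_all
    have "\<phi> n t \<in> L1_weighted 1 \<longleftrightarrow> integrable lborel (\<phi> n t) \<and> integrable lborel (\<lambda>x. (1 + x) * \<bar>\<phi> n t x\<bar>)"
      by (rule weighted_half_line(2)[OF \<phi>_meas \<phi>_zero])
    then show ?thesis using i1 i2 by simp
  qed
  have conv: "(\<lambda>n. norm_L1_weighted 1 (\<lambda>x. \<phi> n t x - f t x)) \<longlonglongrightarrow> 0" for t
  proof -
    note fd = size_densityD[OF f_density[of t]] and ff = f_first_moment(1)[of t]
    have iw: "integrable lborel (\<lambda>x. (1 + x) * f t x)" using fd(1) ff by (simp add: distrib_right)
    have w0: "0 \<le> (1 + x) * f t x" for x using fd(3)[of x] fd(4)[of x] by (cases "x \<le> 0") auto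
    define tail where "tail n = (LBINT x. indicator {real n<..} x * ((1 + x) * f t x))" for n
    have it: "integrable lborel (\<lambda>x. indicator {real n<..} x * ((1 + x) * f t x))" for n
      by (rule integrable_bounded_mult(1)[OF iw, where C=1]) (auto simp: indicator_def)
    have "tail \<longlonglongrightarrow> (\<integral>x. 0 \<partial>(lborel :: real measure))"
      unfolding tail_def
    proof (rule integral_dominated_convergence[OF _ _ iw])
      show "AE x in lborel. (\<lambda>n. indicator {real n<..} x * ((1 + x) * f t x)) \<longlonglongrightarrow> 0"
      proof (rule AE_I2, rule tendsto_eventually)
        fix x :: real
        obtain N :: nat where N: "x \<le> real N" using real_arch_simple by blast
        then have "indicator {real n<..} x * ((1 + x) * f t x) = 0" if "n \<ge> N" for n using that by simp
        then show "\<forall>\<^sub>F n in sequentially. indicator {real n<..} x * ((1 + x) * f t x) = 0"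
          unfolding eventually_sequentially by blast
      qed
      show "AE x in lborel. norm (indicator {real n<..} x * ((1 + x) * f t x)) \<le> (1 + x) * f t x" for n
        using w0 by (auto simp: indicator_def)
    qed (use fd(2) in auto)
    then have "tail \<longlonglongrightarrow> 0" by simp
    moreover have "(\<lambda>n. 1 / (real n + 1)) \<longlonglongrightarrow> 0"
      using LIMSEQ_inverse_real_of_nat by (simp add: inverse_eq_divide add.commute)
    ultimately have lim: "(\<lambda>n. 1 / (real n + 1) + tail n) \<longlonglongrightarrow> 0" using tendsto_add by fastforce
    have norm: "norm_L1_weighted 1 (\<lambda>x. \<phi> n t x - f t x) = (LBINT x. (1 + x) * \<bar>\<phi> n t x - f t x\<bar>)" for n
      by (rule weighted_half_line(1)) (use \<phi>_meas \<phi>_zero fd in auto)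
    obtain N :: nat where N: "t \<le> real N" using real_arch_simple by blast
    have le: "norm (norm_L1_weighted 1 (\<lambda>x. \<phi> n t x - f t x)) \<le> 1 / (real n + 1) + tail n" if "n \<ge> N" for n
    proof -
      have tn: "t \<le> real n" using N that by linarith
      note Fd = size_densityD[OF F_density[of "k n" t]]
      have id: "integrable lborel (\<lambda>x. \<bar>F (k n) t x - f t x\<bar>)" using Fd(1) fd(1) by auto
      have pt: "(1 + x) * \<bar>\<phi> n t x - f t x\<bar> \<le> (1 + real n) * \<bar>F (k n) t x - f t x\<bar> + indicator {real n<..} x * ((1 + x) * f t x)"
        and pt0: "0 \<le> (1 + x) * \<bar>\<phi> n t x - f t x\<bar>" for x
      proof -
        consider "x \<le> 0" | "0 < x" "x \<le> real n" | "real n < x" by linarith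
        then show "(1 + x) * \<bar>\<phi> n t x - f t x\<bar> \<le> (1 + real n) * \<bar>F (k n) t x - f t x\<bar> + indicator {real n<..} x * ((1 + x) * f t x)"
          by cases (use tn w0[of x] fd(3,4)[of x] Fd(4)[of x] \<phi>_zero[of x n t] in \<open>auto simp: \<phi>_def intro: mult_right_mono\<close>)
        show "0 \<le> (1 + x) * \<bar>\<phi> n t x - f t x\<bar>"
          using \<phi>_zero[of x n t] fd(4)[of x] by (cases "x \<le> 0") auto
      qed
      have "(LBINT x. (1 + x) * \<bar>\<phi> n t x - f t x\<bar>) \<le>
        (LBINT x. (1 + real n) * \<bar>F (k n) t x - f t x\<bar> + indicator {real n<..} x * ((1 + x) * f t x))"
      proof (rule integral_mono')
        show "integrable lborel (\<lambda>x. (1 + real n) * \<bar>F (k n) t x - f t x\<bar> + indicator {real n<..} x * ((1 + x) * f t x))"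
          using id it by (intro Bochner_Integration.integrable_add integrable_mult_right) auto
      qed (rule pt order_trans[OF pt0 pt])+
      also have "\<dots> = (1 + real n) * (LBINT x. \<bar>F (k n) t x - f t x\<bar>) + tail n"
        unfolding tail_def using id it by simp
      also have "\<dots> \<le> (1 + real n) * (1 / (real n + 1)\<^sup>2) + tail n"
        using \<nu>[OF tn] by (intro add_right_mono mult_left_mono) (auto simp: k_def)
      also have "(1 + real n) * (1 / (real n + 1)\<^sup>2) = 1 / (real n + 1)"
        by (simp add: power2_eq_square add.commute)
      finally have "(LBINT x. (1 + x) * \<bar>\<phi> n t x - f t x\<bar>) \<le> 1 / (real n + 1) + tail n" .
      moreover have "0 \<le> (LBINT x. (1 + x) * \<bar>\<phi> n t x - f t x\<bar>)"
        using pt0 by (intro integral_nonneg_AE) auto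
      ultimately show ?thesis by (simp add: norm)
    qed
    show ?thesis
      by (rule Lim_null_comparison[OF _ lim]) (use le in \<open>auto simp: eventually_sequentially\<close>)
  qed
  show ?thesis
    unfolding Linf_L1_weighted_def
    using simple mem conv f_L1_weighted by (auto intro!: exI[of _ \<phi>] exI[of _ "M0 + M1"])
qed

end

section \<open>Existence of weak solutions\<close>

theorem theorem3p8:
  fixes r :: "real \<Rightarrow> real" and K :: "real \<Rightarrow> real \<Rightarrow> real" and f_in :: "real \<Rightarrow> real"
  assumes "continuous_on {0..} r"
    and "\<And>x. x \<ge> 0 \<Longrightarrow> r x \<ge> 0"
    and "\<And>x. x > 0 \<Longrightarrow> r x > 0"
    and "\<And>x y. x > 0 \<Longrightarrow> y > 0 \<Longrightarrow> K x y = r x * r y"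
    and "f_in \<in> L1_weighted 1"
    and "AE x in lebesgue_on {0<..}. f_in x \<ge> 0"
  shows "\<exists>f :: real \<Rightarrow> real \<Rightarrow> real.
    (\<forall>t\<ge>0. \<forall>x>0. f t x \<ge> 0) \<and>
    f \<in> C_L1 \<inter> Linf_L1_weighted 1 \<and>
    (\<forall>t>0. \<forall>\<theta>\<in>Linf.
       coag_integrable K f \<theta> t \<and>
       (LINT x:{0<..}|lebesgue. \<theta> x * (f t x - f_in x)) =
         1 / 2 * (LINT s:{0<..<t}|lebesgue. LINT x:{0<..}|lebesgue. LINT y:{0<..}|lebesgue.
                    tilde \<theta> x y * K x y * f s x * f s y)) \<and>
    (\<forall>t\<ge>0. f t \<in> L1_weighted 1 \<and>
       moment 0 (f t) \<le> moment 0 f_in \<and> moment 1 (f t) \<le> moment 1 f_in)"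
proof -
  define \<rho> where "\<rho> x = (if 0 < x then r x else 0)" for x
  have \<rho>_meas: "\<rho> \<in> borel_measurable borel"
  proof -
    have "continuous_on {0<..} r" by (rule continuous_on_subset[OF assms(1)]) auto
    then have "(\<lambda>x. indicator {0<..} x *\<^sub>R r x) \<in> borel_measurable borel"
      by (rule borel_measurable_continuous_on_indicator[rotated]) simp
    moreover have "(\<lambda>x. indicator {0<..} x *\<^sub>R r x) = \<rho>" by (auto simp: \<rho>_def indicator_def)
    ultimately show ?thesis by simp
  qed
  have "\<forall>n::nat. \<exists>B. \<forall>x\<le>real n. \<rho> x \<le> B"
  proof
    fix n :: nat
    have "compact (r ` {0..real n})"
      by (intro compact_continuous_image continuous_on_subset[OF assms(1)]) auto
    then have "bounded (r ` {0..real n})" by (rule compact_imp_bounded)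
    then obtain B where B: "\<forall>y\<in>r ` {0..real n}. norm y \<le> B" unfolding bounded_iff by blast
    have "\<rho> x \<le> \<bar>B\<bar>" if "x \<le> real n" for x
    proof (cases "0 < x")
      case True
      then have "\<bar>r x\<bar> \<le> B" using B that by simp
      then show ?thesis using True by (simp add: \<rho>_def)
    qed (simp add: \<rho>_def)
    then show "\<exists>B. \<forall>x\<le>real n. \<rho> x \<le> B" by blast
  qed
  from choice[OF this] obtain b where b: "\<And>n x. x \<le> real n \<Longrightarrow> \<rho> x \<le> b n" by blast
  have f_in: "f_in absolutely_integrable_on {0<..}"
    "(\<lambda>x. (1 + x powr 1) * \<bar>f_in x\<bar>) absolutely_integrable_on {0<..}"
    using assms(5) by (auto simp: L1_weighted_def L1_def)
  have f_in_meas: "f_in \<in> borel_measurable (lebesgue_on {0<..})"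
    using f_in(1) absolutely_integrable_measurable[of "{0<..}" f_in] by simp
  obtain u where u: "u \<in> borel_measurable borel" "\<And>x. x \<le> 0 \<Longrightarrow> u x = 0" "AE x in lborel. 0 < x \<longrightarrow> f_in x = u x"
    by (rule Borel_representative[OF f_in_meas]) blast
  define f0 where "f0 x = max 0 (u x)" for x
  have f0_meas: "f0 \<in> borel_measurable borel" unfolding f0_def using u(1) by simp
  have f0_zero: "f0 x = 0" if "x \<le> 0" for x using u(2)[OF that] by (simp add: f0_def)
  have rep: "AE x in lborel. 0 < x \<longrightarrow> f_in x = f0 x"
    using u(3) assms(6)[unfolded AE_half_line_iff] by eventually_elim (auto simp: f0_def)
  have f0_int: "integrable lborel f0"
    using lebesgue_integral_half_line(2)[OF f0_meas f0_zero rep] f_in(1) by simp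
  have wi: "integrable lborel (\<lambda>x. (1 + x) * f0 x)"
  proof -
    have "(\<lambda>x. (1 + x powr 1) * \<bar>f_in x\<bar>) absolutely_integrable_on {0<..} \<longleftrightarrow> integrable lborel (\<lambda>x. (1 + x) * f0 x)"
    proof (rule lebesgue_integral_half_line(2))
      show "AE x in lborel. 0 < x \<longrightarrow> (1 + x powr 1) * \<bar>f_in x\<bar> = (1 + x) * f0 x"
        using rep by eventually_elim (auto simp: f0_def)
    qed (use f0_meas f0_zero in auto)
    then show ?thesis using f_in(2) by simp
  qed
  have "integrable lborel (\<lambda>x. (1 + x) * f0 x - f0 x)" using wi f0_int by (rule Bochner_Integration.integrable_diff)
  then have f0_int1: "integrable lborel (\<lambda>x. x * f0 x)" by (simp add: distrib_right)
  \<comment> \<open>\<open>\<rho>\<close> and \<open>f0\<close> are Borel versions of \<open>r\<close> and \<open>f_in\<close> that vanish off the half-line.\<close>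
  interpret coagulation_data \<rho> b f0
  proof
    show "0 \<le> \<rho> x" for x using assms(2)[of x] by (simp add: \<rho>_def)
    show "size_density f0" using f0_int f0_zero by (auto simp: size_density_def f0_def)
  qed (use \<rho>_meas b f0_int1 in auto)
  show ?thesis
  proof (rule F_limit_exists)
    fix \<sigma> :: "nat \<Rightarrow> nat" and f
    assume lim: "strict_mono \<sigma>" "\<And>t. size_density (f t)"
      "\<And>T e. 0 < e \<Longrightarrow> \<exists>N. \<forall>n\<ge>N. \<forall>t\<le>T. (LBINT x. \<bar>F (\<sigma> n) t x - f t x\<bar>) \<le> e"
    interpret coagulation_limit \<rho> b f0 \<sigma> f
      by unfold_locales (use lim in auto)
    have K: "K x y = \<rho> x * \<rho> y" if "0 < x" "0 < y" for x y
      using assms(4)[OF that] that by (simp add: \<rho>_def)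
    show ?thesis
    proof (intro exI[of _ f] conjI allI impI ballI IntI)
      show "0 \<le> f t x" for t x by (rule size_densityD(3)[OF f_density])
      show "f \<in> C_L1" by (rule f_C_L1)
      show "f \<in> Linf_L1_weighted 1" by (rule f_Linf_L1_weighted)
      fix t :: real and \<theta>
      assume t: "0 < t" and \<theta>: "\<theta> \<in> Linf"
      show "coag_integrable K f \<theta> t" by (rule f_coagulation(1)[OF \<theta> t K rep])
      show "(LINT x:{0<..}|lebesgue. \<theta> x * (f t x - f_in x)) =
          1 / 2 * (LINT s:{0<..<t}|lebesgue. LINT x:{0<..}|lebesgue. LINT y:{0<..}|lebesgue.
                     tilde \<theta> x y * K x y * f s x * f s y)"
        by (rule f_coagulation(2)[OF \<theta> t K rep])
    next
      fix t :: real
      show "f t \<in> L1_weighted 1" by (rule f_L1_weighted)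
      show "moment 0 (f t) \<le> moment 0 f_in" "moment 1 (f t) \<le> moment 1 f_in" by (rule f_moments[OF rep])+
    qed
  qed
qed

end
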